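(* Let $\mathcal{H}_1,\mathcal{H}_2$ be separable complex Hilbert spaces, and let $\rho_1\in\mathrm{T}_+(\mathcal{H}_1)$, $\rho_2\in\mathrm{T}_+(\mathcal{H}_2)$ satisfy $\mathrm{Tr}\,\rho_1=\mathrm{Tr}\,\rho_2$. Then the set $$\mathcal{M}(\rho_1,\rho_2)=\{\gamma\in\mathrm{T}_+(\mathcal{H}_1\otimes\mathcal{H}_2):\ \mathrm{Tr}_2\gamma=\rho_1,\ \mathrm{Tr}_1\gamma=\rho_2\}$$ is nonempty, convex, and a compact metric space with respect to the distance induced by the norm $\|\cdot\|_1$ of $\mathrm{T}(\mathcal{H}_1\otimes\mathcal{H}_2)$. That is, for each sequence $\gamma_m\in\mathcal{M}(\rho_1,\rho_2)$, $m\in\mathbb{N}$, there exists a subsequence $\gamma_{m_k}$ which converges in the norm $\|\cdot\|_1$ to some $\gamma\in\mathcal{M}(\rho_1,\rho_2)$.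
   Context: For a separable complex Hilbert space $\mathcal{H}$: $\mathrm{T}(\mathcal{H})$ is the Banach space of trace class operators with trace norm $\|\cdot\|_1$; $\mathrm{T}_+(\mathcal{H})$ is the cone of positive semidefinite trace class operators. Inner products are linear in the first argument, and $\mathbf{x}\mathbf{y}^\vee$ denotes the operator $\mathbf{z}\mapsto\langle\mathbf{z},\mathbf{y}\rangle\mathbf{x}$. The partial traces $\mathrm{Tr}_1:\mathrm{T}(\mathcal{H}_1\otimes\mathcal{H}_2)\to\mathrm{T}(\mathcal{H}_2)$ and $\mathrm{Tr}_2:\mathrm{T}(\mathcal{H}_1\otimes\mathcal{H}_2)\to\mathrm{T}(\mathcal{H}_1)$ are the unique bounded linear maps with $\mathrm{Tr}_1((\mathbf{x}\otimes\mathbf{y})(\mathbf{u}\otimes\mathbf{v})^\vee)=\langle\mathbf{x},\mathbf{u}\rangle\,\mathbf{y}\mathbf{v}^\vee$ and $\mathrm{Tr}_2((\mathbf{x}\otimes\mathbf{y})(\mathbf{u}\otimes\mathbf{v})^\vee)=\langle\mathbf{y},\mathbf{v}\rangle\,\mathbf{x}\mathbf{u}^\vee$. *)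

theory Defs
  imports "HOL-Analysis.Analysis"
begin

section \<open>Complex Hilbert spaces\<close>

class complex_vector = real_vector +
  fixes scaleC :: "complex \<Rightarrow> 'a \<Rightarrow> 'a"  (infixr \<open>*\<^sub>C\<close> 75)
  assumes scaleC_add_right: "a *\<^sub>C (x + y) = a *\<^sub>C x + a *\<^sub>C y"
    and scaleC_add_left: "(a + b) *\<^sub>C x = a *\<^sub>C x + b *\<^sub>C x"
    and scaleC_scaleC: "a *\<^sub>C b *\<^sub>C x = (a * b) *\<^sub>C x"
    and scaleR_scaleC: "r *\<^sub>R x = complex_of_real r *\<^sub>C x"

text \<open>The inner product is linear in its first argument. The sort also carries the norm and the
  topology; the last axiom says that both come from the inner product.\<close>

class complex_inner = complex_vector + real_normed_vector +
  fixes cinner :: "'a \<Rightarrow> 'a \<Rightarrow> complex"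
  assumes cinner_commute: "cinner x y = cnj (cinner y x)"
    and cinner_add_left: "cinner (x + y) z = cinner x z + cinner y z"
    and cinner_scaleC_left: "cinner (c *\<^sub>C x) y = c * cinner x y"
    and cinner_self_nonneg: "cinner x x \<in> \<real>\<^sub>\<ge>\<^sub>0"
    and cinner_self_eq_0: "cinner x x = 0 \<longleftrightarrow> x = 0"
    and norm_eq_sqrt_cinner: "norm x = sqrt (Re (cinner x x))"

class chilbert_space = complex_inner + complete_space

lemma cinner_self: "cinner x x = complex_of_real ((norm x)\<^sup>2)" for x :: "'a::complex_inner"
  using cinner_self_nonneg[of x] norm_eq_sqrt_cinner[of x]
  by (auto simp: nonneg_Reals_def simp flip: of_real_power)

lemma cinner_add_right: "cinner z (x + y) = cinner z x + cinner z y" for x :: "'a::complex_inner"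
  by (metis cinner_add_left cinner_commute complex_cnj_add)

lemma cinner_scaleC_right: "cinner x (c *\<^sub>C y) = cnj c * cinner x y" for x :: "'a::complex_inner"
  by (metis cinner_commute cinner_scaleC_left complex_cnj_mult)

lemma norm_scaleC: "norm (c *\<^sub>C x) = cmod c * norm x" for x :: "'a::complex_inner"
proof -
  have "complex_of_real ((norm (c *\<^sub>C x))\<^sup>2) = c * cnj c * complex_of_real ((norm x)\<^sup>2)"
    by (simp only: cinner_self[symmetric] cinner_scaleC_left cinner_scaleC_right mult_ac)
  also have "\<dots> = complex_of_real ((cmod c * norm x)\<^sup>2)"
    by (simp add: complex_norm_square[symmetric] power_mult_distrib)
  finally have "(norm (c *\<^sub>C x))\<^sup>2 = (cmod c * norm x)\<^sup>2"
    by (simp only: of_real_eq_iff)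
  then show ?thesis by (simp add: power2_eq_iff_nonneg)
qed

lemma cmod_cinner_le: "cmod (cinner x y) \<le> norm x * norm y" for x y :: "'a::complex_inner"
proof (cases "y = 0")
  case True
  have "cinner x (0::'a) = 0" using cinner_add_right[of x 0 0] by simp
  then show ?thesis using True by simp
next
  case False
  define a where "a = cinner x y"
  define n where "n = (norm y)\<^sup>2"
  have n: "n > 0" using False by (simp add: n_def)
  define k where "k = - (a / complex_of_real n)"
  have "complex_of_real ((norm (x + k *\<^sub>C y))\<^sup>2)
      = cinner x x + cnj k * a + k * cnj a + k * cnj k * complex_of_real n"
    unfolding cinner_self[symmetric] n_def a_def
    by (simp add: cinner_add_left cinner_add_right cinner_scaleC_left cinner_scaleC_right
        cinner_commute[of y x] algebra_simps)
  also have "\<dots> = complex_of_real ((norm x)\<^sup>2) - a * cnj a / complex_of_real n"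
    using n by (simp add: cinner_self k_def field_simps)
  also have "\<dots> = complex_of_real ((norm x)\<^sup>2 - (cmod a)\<^sup>2 / n)"
    by (simp add: complex_norm_square[symmetric])
  finally have "(norm (x + k *\<^sub>C y))\<^sup>2 = (norm x)\<^sup>2 - (cmod a)\<^sup>2 / n"
    by (simp only: of_real_eq_iff)
  then have "(cmod a)\<^sup>2 / n \<le> (norm x)\<^sup>2"
    by (metis diff_ge_0_iff_ge zero_le_power2)
  then have "(cmod a)\<^sup>2 \<le> (norm x * norm y)\<^sup>2"
    using n by (simp add: n_def field_simps)
  then show ?thesis
    unfolding a_def by (rule power2_le_imp_le) simp
qed

definition cspan :: "'a::complex_vector set \<Rightarrow> 'a set" where
  "cspan = module.span scaleC"

definition is_onb :: "'a::chilbert_space set \<Rightarrow> bool" where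
  "is_onb E \<longleftrightarrow> (\<forall>e\<in>E. norm e = 1) \<and> pairwise (\<lambda>e f. cinner e f = 0) E \<and>
    closure (cspan E) = UNIV"

definition some_onb :: "'a::chilbert_space set" where
  "some_onb = (SOME E. is_onb E)"

text \<open>The Hilbert space tensor product, up to unitary isomorphism: a Hilbert space \<open>'c\<close> together
  with the map sending \<open>x\<close>, \<open>y\<close> to \<open>x \<otimes> y\<close>.\<close>

definition is_hilbert_tensor_product ::
    "('a::chilbert_space \<Rightarrow> 'b::chilbert_space \<Rightarrow> 'c::chilbert_space) \<Rightarrow> bool" where
  "is_hilbert_tensor_product t \<longleftrightarrow>
    (\<forall>x x' y. t (x + x') y = t x y + t x' y) \<and>
    (\<forall>x y y'. t x (y + y') = t x y + t x y') \<and>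
    (\<forall>c x y. t (c *\<^sub>C x) y = c *\<^sub>C t x y) \<and>
    (\<forall>c x y. t x (c *\<^sub>C y) = c *\<^sub>C t x y) \<and>
    (\<forall>x y u v. cinner (t x y) (t u v) = cinner x u * cinner y v) \<and>
    closure (cspan {t x y | x y. True}) = UNIV"

section \<open>Bounded operators\<close>

text \<open>The library type of bounded operators is real-linear; complex linearity is the separate
  predicate \<open>clinear_op\<close>.\<close>

definition clinear_op :: "('a::complex_inner \<Rightarrow>\<^sub>L 'b::complex_inner) \<Rightarrow> bool" where
  "clinear_op A \<longleftrightarrow> (\<forall>c x. A (c *\<^sub>C x) = c *\<^sub>C A x)"

instantiation blinfun :: (real_normed_vector, complex_inner) complex_vector
begin

lift_definition scaleC_blinfun :: "complex \<Rightarrow> ('a \<Rightarrow>\<^sub>L 'b) \<Rightarrow> ('a \<Rightarrow>\<^sub>L 'b)"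
  is "\<lambda>c f x. c *\<^sub>C f x"
proof -
  fix c :: complex and f :: "'a \<Rightarrow> 'b"
  assume f: "bounded_linear f"
  have "bounded_linear (\<lambda>y::'b. c *\<^sub>C y)"
    by (rule bounded_linear_intro[where K = "cmod c"])
      (simp_all add: scaleC_add_right scaleR_scaleC scaleC_scaleC norm_scaleC mult.commute)
  then show "bounded_linear (\<lambda>x. c *\<^sub>C f x)"
    using f by (rule bounded_linear_compose)
qed

instance
  by standard
    (transfer; auto simp: scaleC_add_right scaleC_add_left scaleC_scaleC scaleR_scaleC)+

end

text \<open>\<open>rank_one x y\<close> is the operator sending \<open>z\<close> to \<open>\<langle>z, y\<rangle> x\<close>.\<close>

lift_definition rank_one :: "'a::complex_inner \<Rightarrow> 'b::complex_inner \<Rightarrow> 'b \<Rightarrow>\<^sub>L 'a"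
  is "\<lambda>x y z. cinner z y *\<^sub>C x"
proof -
  fix x :: 'a and y :: 'b
  show "bounded_linear (\<lambda>z. cinner z y *\<^sub>C x)"
  proof (rule bounded_linear_intro[where K = "norm y * norm x"])
    show "norm (cinner z y *\<^sub>C x) \<le> norm z * (norm y * norm x)" for z
      using mult_right_mono[OF cmod_cinner_le[of z y], of "norm x"]
      by (simp add: norm_scaleC mult.assoc)
  qed (simp_all add: cinner_add_left scaleC_add_left scaleR_scaleC cinner_scaleC_left scaleC_scaleC)
qed

definition cadjoint :: "('a::chilbert_space \<Rightarrow>\<^sub>L 'b::chilbert_space) \<Rightarrow> 'b \<Rightarrow>\<^sub>L 'a" where
  "cadjoint A = (THE B :: 'b \<Rightarrow>\<^sub>L 'a. \<forall>x y. cinner (A x) y = cinner x (B y))"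

text \<open>Over the complex numbers a non-negative (in particular real) quadratic form forces
  self-adjointness.\<close>

definition psd_op :: "('a::chilbert_space \<Rightarrow>\<^sub>L 'a) \<Rightarrow> bool" where
  "psd_op A \<longleftrightarrow> clinear_op A \<and> (\<forall>x. cinner (A x) x \<in> \<real>\<^sub>\<ge>\<^sub>0)"

definition abs_op :: "('a::chilbert_space \<Rightarrow>\<^sub>L 'a) \<Rightarrow> 'a \<Rightarrow>\<^sub>L 'a" where
  "abs_op A = (THE B. psd_op B \<and> B o\<^sub>L B = cadjoint A o\<^sub>L A)"

section \<open>Trace class operators\<close>

text \<open>Neither \<open>trace\<close> on trace class operators nor membership in \<open>trace_class\<close> depends on the
  orthonormal basis; \<open>some_onb\<close> is an arbitrary choice.\<close>

definition trace_class :: "('a::chilbert_space \<Rightarrow>\<^sub>L 'a) set" where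
  "trace_class = {A. clinear_op A \<and> (\<lambda>e. cinner (abs_op A e) e) summable_on some_onb}"

definition trace_op :: "('a::chilbert_space \<Rightarrow>\<^sub>L 'a) \<Rightarrow> complex" where
  "trace_op A = (\<Sum>\<^sub>\<infinity>e\<in>some_onb. cinner (A e) e)"

definition trace_norm :: "('a::chilbert_space \<Rightarrow>\<^sub>L 'a) \<Rightarrow> real" where
  "trace_norm A = (if A \<in> trace_class then Re (trace_op (abs_op A)) else 0)"

definition psd_trace_class :: "('a::chilbert_space \<Rightarrow>\<^sub>L 'a) set" where
  "psd_trace_class = {A \<in> trace_class. psd_op A}"

section \<open>Partial traces\<close>

definition trace_class_bounded_clinear ::
    "(('a::chilbert_space \<Rightarrow>\<^sub>L 'a) \<Rightarrow> ('b::chilbert_space \<Rightarrow>\<^sub>L 'b)) \<Rightarrow> bool" where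
  "trace_class_bounded_clinear P \<longleftrightarrow>
    (\<forall>A\<in>trace_class. \<forall>B\<in>trace_class. P (A + B) = P A + P B) \<and>
    (\<forall>c. \<forall>A\<in>trace_class. P (c *\<^sub>C A) = c *\<^sub>C P A) \<and>
    (\<exists>K. \<forall>A\<in>trace_class. trace_norm (P A) \<le> K * trace_norm A)"

text \<open>Extensionality of \<open>\<rightarrow>\<^sub>E\<close> fixes the value outside the trace class, so that uniqueness of the
  bounded linear map makes the description definite.\<close>

definition partial_trace1 ::
    "('a::chilbert_space \<Rightarrow> 'b::chilbert_space \<Rightarrow> 'c::chilbert_space) \<Rightarrow> ('c \<Rightarrow>\<^sub>L 'c) \<Rightarrow> ('b \<Rightarrow>\<^sub>L 'b)" where
  "partial_trace1 t = (THE P. P \<in> trace_class \<rightarrow>\<^sub>E trace_class \<and> trace_class_bounded_clinear P \<and>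
    (\<forall>x y u v. P (rank_one (t x y) (t u v)) = cinner x u *\<^sub>C rank_one y v))"

definition partial_trace2 ::
    "('a::chilbert_space \<Rightarrow> 'b::chilbert_space \<Rightarrow> 'c::chilbert_space) \<Rightarrow> ('c \<Rightarrow>\<^sub>L 'c) \<Rightarrow> ('a \<Rightarrow>\<^sub>L 'a)" where
  "partial_trace2 t = (THE P. P \<in> trace_class \<rightarrow>\<^sub>E trace_class \<and> trace_class_bounded_clinear P \<and>
    (\<forall>x y u v. P (rank_one (t x y) (t u v)) = cinner y v *\<^sub>C rank_one x u))"

definition couplings ::
    "('a::chilbert_space \<Rightarrow> 'b::chilbert_space \<Rightarrow> 'c::chilbert_space) \<Rightarrow>
      ('a \<Rightarrow>\<^sub>L 'a) \<Rightarrow> ('b \<Rightarrow>\<^sub>L 'b) \<Rightarrow> ('c \<Rightarrow>\<^sub>L 'c) set" where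
  "couplings t \<rho>\<^sub>1 \<rho>\<^sub>2 =
    {\<gamma> \<in> psd_trace_class. partial_trace2 t \<gamma> = \<rho>\<^sub>1 \<and> partial_trace1 t \<gamma> = \<rho>\<^sub>2}"

definition trace_dist :: "('a::chilbert_space \<Rightarrow>\<^sub>L 'a) \<Rightarrow> ('a \<Rightarrow>\<^sub>L 'a) \<Rightarrow> real" where
  "trace_dist A B = trace_norm (A - B)"

end

theory Submission
  imports Defs
begin

text \<open>The trace norm is handled by duality: \<open>\<parallel>A\<parallel>\<^sub>1 \<le> K\<close> iff \<open>|\<Sum>\<^sub>i \<langle>A x\<^sub>i, y\<^sub>i\<rangle>| \<le> K\<close> for all finite families
  for which \<open>\<Sum>\<^sub>i x\<^sub>i y\<^sub>i\<^sup>\<or>\<close> is a contraction. This makes the triangle inequality, lower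
  semicontinuity (hence completeness) and the contractivity of the partial traces immediate.

  A coupling has at most the mass \<open>\<epsilon>\<^sub>1 + \<epsilon>\<^sub>2\<close> outside a finite rectangle \<open>E\<^sub>0 \<times> F\<^sub>0\<close> of product basis
  vectors, where \<open>\<epsilon>\<^sub>i\<close> is the mass of the marginal \<open>\<rho>\<^sub>i\<close> outside its side of the rectangle. So
  compressing to the rectangle moves all couplings by a uniformly small amount in trace norm, and
  the compressions have finitely many bounded matrix entries. Hence the set of couplings is totally
  bounded; it is complete because the partial traces are continuous. It contains
  \<open>\<rho>\<^sub>1 \<otimes> \<rho>\<^sub>2 / Tr \<rho>\<^sub>1\<close>, which is built from rank one operators.\<close>

text \<open>The trace norm is defined through \<open>abs_op\<close>, and the modulus behaves badly
  under sums: |A + B| need not lie below |A| + |B|. Test families remove the modulus from view,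
  since a test sum is linear in the operator and, being finite, continuous in it. The adjoint, the
  modulus and the partial traces are definite descriptions, so each has to be constructed and shown
  unique before anything can be said about it. Riesz representation and an iteration for positive
  square roots supply the constructions.

  The marginals control only the diagonal entries of a coupling in the product basis. Positivity is
  what makes this enough: if S is the square root of the coupling, its off-diagonal blocks are
  products of two Hilbert-Schmidt operators built from S, and Cauchy-Schwarz bounds their trace norm
  by the geometric mean of the tail mass and the total mass. This is the origin of the square roots
  in the compression error.\<close>

instance chilbert_space \<subseteq> banach ..

interpretation cvec: vector_space "scaleC :: complex \<Rightarrow> 'a::complex_vector \<Rightarrow> 'a"
proof
  show "1 *\<^sub>C x = x" for x :: 'a
    using scaleR_scaleC[of 1 x] by simp
qed (rule scaleC_add_right scaleC_add_left scaleC_scaleC)+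

section \<open>Sesquilinear calculus and continuity of the inner product\<close>

lemma cinner_zero_left [simp]: "cinner 0 x = 0" for x :: "'a::complex_inner"
  using cinner_add_left[of 0 0 x] by simp

lemma cinner_zero_right [simp]: "cinner x 0 = 0" for x :: "'a::complex_inner"
  using cinner_add_right[of x 0 0] by simp

lemma cinner_minus_left [simp]: "cinner (- x) y = - cinner x y" for x y :: "'a::complex_inner"
  using cinner_add_left[of x "-x" y] by (simp add: eq_neg_iff_add_eq_0 add.commute)

lemma cinner_minus_right [simp]: "cinner x (- y) = - cinner x y" for x y :: "'a::complex_inner"
  using cinner_add_right[of x y "-y"] by (simp add: eq_neg_iff_add_eq_0 add.commute)

lemma cinner_diff_left: "cinner (x - y) z = cinner x z - cinner y z" for x :: "'a::complex_inner"
  using cinner_add_left[of x "-y" z] by simp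

lemma cinner_diff_right: "cinner z (x - y) = cinner z x - cinner z y" for x :: "'a::complex_inner"
  using cinner_add_right[of z x "-y"] by simp

lemma cinner_scaleR_left: "cinner (r *\<^sub>R x) y = of_real r * cinner x y" for x :: "'a::complex_inner"
  by (simp add: scaleR_scaleC cinner_scaleC_left)

lemma cinner_scaleR_right: "cinner x (r *\<^sub>R y) = of_real r * cinner x y" for x :: "'a::complex_inner"
  by (simp add: scaleR_scaleC cinner_scaleC_right)

lemma cinner_sum_left: "cinner (sum f A) y = (\<Sum>i\<in>A. cinner (f i) y)"
  for f :: "'i \<Rightarrow> 'a::complex_inner"
  by (induction A rule: infinite_finite_induct) (auto simp: cinner_add_left)

lemma cinner_sum_right: "cinner y (sum f A) = (\<Sum>i\<in>A. cinner y (f i))"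
  for f :: "'i \<Rightarrow> 'a::complex_inner"
  by (induction A rule: infinite_finite_induct) (auto simp: cinner_add_right)

lemmas cinner_simps = cinner_add_left cinner_add_right cinner_diff_left cinner_diff_right
  cinner_scaleC_left cinner_scaleC_right cinner_scaleR_left cinner_scaleR_right

lemma cinner_ext_right: "(\<And>x. cinner x y = cinner x z) \<Longrightarrow> y = z" for y z :: "'a::complex_inner"
  by (metis cinner_diff_right cinner_self_eq_0 eq_iff_diff_eq_0)

lemma cinner_ext_left: "(\<And>x. cinner y x = cinner z x) \<Longrightarrow> y = z" for y z :: "'a::complex_inner"
  by (metis cinner_diff_left cinner_self_eq_0 eq_iff_diff_eq_0)

lemma bounded_linear_cinner_left: "bounded_linear (\<lambda>x. cinner x y)" for y :: "'a::complex_inner"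
  by (rule bounded_linear_intro[where K = "norm y"])
    (simp_all add: cinner_simps cmod_cinner_le scaleR_conv_of_real)

lemma bounded_bilinear_cinner: "bounded_bilinear (cinner :: 'a::complex_inner \<Rightarrow> 'a \<Rightarrow> complex)"
  by standard (auto simp: cinner_simps scaleR_conv_of_real intro!: exI[of _ 1] cmod_cinner_le)

lemmas tendsto_cinner = bounded_bilinear.tendsto[OF bounded_bilinear_cinner]

lemma bounded_linear_scaleC: "bounded_linear (\<lambda>y::'b::complex_inner. c *\<^sub>C y)"
  by (rule bounded_linear_intro[where K = "cmod c"])
    (simp_all add: scaleC_add_right scaleR_scaleC scaleC_scaleC norm_scaleC mult.commute)

lemma norm_sq_cinner: "(norm x)\<^sup>2 = Re (cinner x x)" for x :: "'a::complex_inner"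
  by (simp add: cinner_self)

lemma norm_add_sq: "(norm (x + y))\<^sup>2 = (norm x)\<^sup>2 + (norm y)\<^sup>2 + 2 * Re (cinner x y)"
  for x y :: "'a::complex_inner"
  by (simp add: norm_sq_cinner cinner_simps) (subst cinner_commute, simp)

lemma norm_diff_sq: "(norm (x - y))\<^sup>2 = (norm x)\<^sup>2 + (norm y)\<^sup>2 - 2 * Re (cinner x y)"
  for x y :: "'a::complex_inner"
  using norm_add_sq[of x "-y"] by simp

subsection \<open>The Riesz representation theorem\<close>

text \<open>The representing vector is the limit of \<open>B x\<^sub>n\<close> along a minimising sequence of
  \<open>\<parallel>B x\<parallel>\<^sup>2 - 2 Re (g x)\<close>; no closedness of the subspace \<open>B ` V\<close> is needed.\<close>

lemma riesz_on_subspace: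
  fixes B :: "'i::complex_vector \<Rightarrow> 'b::chilbert_space" and g :: "'i \<Rightarrow> complex"
  assumes V0: "0 \<in> V" and Vadd: "\<And>x y. x \<in> V \<Longrightarrow> y \<in> V \<Longrightarrow> x + y \<in> V"
    and Vsc: "\<And>c x. x \<in> V \<Longrightarrow> c *\<^sub>C x \<in> V"
    and Badd: "\<And>x y. B (x + y) = B x + B y" and Bsc: "\<And>c x. B (c *\<^sub>C x) = c *\<^sub>C B x"
    and gadd: "\<And>x y. g (x + y) = g x + g y" and gsc: "\<And>c x. g (c *\<^sub>C x) = c * g x"
    and bd: "\<And>x. x \<in> V \<Longrightarrow> cmod (g x) \<le> C * norm (B x)"
  obtains w where "w \<in> closure (B ` V)" "\<And>x. x \<in> V \<Longrightarrow> g x = cinner (B x) w" "norm w \<le> \<bar>C\<bar>"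
proof -
  define J where "J x = (norm (B x))\<^sup>2 - 2 * Re (g x)" for x
  have Jlow: "J x \<ge> - C\<^sup>2" if "x \<in> V" for x
  proof -
    have "Re (g x) \<le> C * norm (B x)" using bd[OF that] complex_Re_le_cmod[of "g x"] by linarith
    moreover have "(norm (B x) - C)\<^sup>2 \<ge> 0" by simp
    ultimately show ?thesis unfolding J_def by (simp add: power2_diff algebra_simps)
  qed
  define m where "m = Inf (J ` V)"
  have bdd: "bdd_below (J ` V)" using Jlow by (auto intro!: bdd_belowI)
  have mle: "m \<le> J x" if "x \<in> V" for x unfolding m_def using bdd that by (auto intro: cInf_lower)
  have "\<exists>x\<in>V. J x < m + 1 / real (Suc n)" for n
  proof -
    have "Inf (J ` V) < m + 1 / real (Suc n)" by (simp add: m_def)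
    then show ?thesis using cInf_lessD[of "J ` V"] V0 by blast
  qed
  then obtain x where xV: "\<And>n. x n \<in> V" and xJ: "\<And>n. J (x n) < m + 1 / real (Suc n)"
    by metis
  \<comment> \<open>Parallelogram law: \<open>J\<close> at the midpoint of \<open>u\<close> and
    \<open>v\<close> is at least \<open>m\<close>, so two near-minimisers have nearby images under
    \<open>B\<close>.\<close>
  have par: "(norm (B u - B v))\<^sup>2 \<le> 2 * J u + 2 * J v - 4 * m" if "u \<in> V" "v \<in> V" for u v
  proof -
    let ?h = "(1/2) *\<^sub>C (u + v)"
    have "?h \<in> V" using that Vadd Vsc by blast
    then have "m \<le> J ?h" by (rule mle)
    moreover have "4 * (norm (B ?h))\<^sup>2 = (norm (B u + B v))\<^sup>2"
      by (simp add: Bsc Badd norm_scaleC power_mult_distrib power2_eq_square)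
    moreover have "4 * Re (g ?h) = 2 * Re (g u) + 2 * Re (g v)"
      by (simp add: gsc gadd)
    moreover have "(norm (B u - B v))\<^sup>2 + (norm (B u + B v))\<^sup>2 = 2 * (norm (B u))\<^sup>2 + 2 * (norm (B v))\<^sup>2"
      by (simp add: norm_add_sq norm_diff_sq)
    ultimately show ?thesis unfolding J_def by (simp add: algebra_simps)
  qed
  have "Cauchy (\<lambda>n. B (x n))"
  proof (rule metric_CauchyI)
    fix e :: real assume e: "e > 0"
    obtain N where N: "N > 0" "inverse (real N) < e\<^sup>2 / 4"
      using real_arch_inverse[of "e\<^sup>2 / 4"] e by auto
    have J: "J (x k) < m + e\<^sup>2 / 4" if "k \<ge> N" for k
    proof -
      have "1 / real (Suc k) \<le> inverse (real N)"
        using that N(1) by (simp add: divide_inverse)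
      then show ?thesis using xJ[of k] N(2) by linarith
    qed
    have "dist (B (x k)) (B (x l)) < e" if "k \<ge> N" "l \<ge> N" for k l
    proof -
      have "(norm (B (x k) - B (x l)))\<^sup>2 < e\<^sup>2"
        using par[OF xV xV, of k l] J[OF that(1)] J[OF that(2)] by simp
      then show ?thesis using e by (simp add: dist_norm power_less_imp_less_base)
    qed
    then show "\<exists>M. \<forall>k\<ge>M. \<forall>l\<ge>M. dist (B (x k)) (B (x l)) < e" by blast
  qed
  then obtain w where w: "(\<lambda>n. B (x n)) \<longlonglongrightarrow> w"
    using Cauchy_convergent_iff convergent_def by blast
  have wcl: "w \<in> closure (B ` V)"
    unfolding closure_sequential using w xV by (intro exI[of _ "\<lambda>n. B (x n)"]) auto
  have Jlim: "(\<lambda>n. J (x n)) \<longlonglongrightarrow> m"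
  proof (rule tendsto_sandwich[of "\<lambda>_. m" _ _ "\<lambda>n. m + 1 / real (Suc n)"])
    show "(\<lambda>n. m + 1 / real (Suc n)) \<longlonglongrightarrow> m"
      using tendsto_add[OF tendsto_const LIMSEQ_inverse_real_of_nat, of m]
      by (simp add: divide_inverse)
    show "\<forall>\<^sub>F n in sequentially. J (x n) \<le> m + 1 / real (Suc n)"
      using less_imp_le[OF xJ] by (intro always_eventually) blast
  qed (auto intro!: always_eventually mle xV)
  \<comment> \<open>First variation at the minimum. The limit \<open>w\<close> stands in for the
    image of a minimiser, which need not exist in \<open>V\<close>.\<close>
  have key: "0 \<le> (norm (B u))\<^sup>2 + 2 * Re (cinner w (B u)) - 2 * Re (g u)" if u: "u \<in> V" for u
  proof -
    have "J (x n) + ((norm (B u))\<^sup>2 + 2 * Re (cinner (B (x n)) (B u)) - 2 * Re (g u)) \<ge> m" for n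
    proof -
      have "m \<le> J (x n + u)" by (intro mle Vadd xV u)
      then show ?thesis unfolding J_def Badd gadd norm_add_sq by simp
    qed
    moreover have "(\<lambda>n. J (x n) + ((norm (B u))\<^sup>2 + 2 * Re (cinner (B (x n)) (B u)) - 2 * Re (g u)))
        \<longlonglongrightarrow> m + ((norm (B u))\<^sup>2 + 2 * Re (cinner w (B u)) - 2 * Re (g u))"
      by (intro tendsto_intros Jlim tendsto_cinner w)
    ultimately have "m \<le> m + ((norm (B u))\<^sup>2 + 2 * Re (cinner w (B u)) - 2 * Re (g u))"
      by (intro LIMSEQ_le_const) auto
    then show ?thesis by simp
  qed
  have eq: "g u = cinner (B u) w" if u: "u \<in> V" for u
  proof -
    define d where "d = cinner (B u) w - g u"
    define N where "N = (norm (B u))\<^sup>2"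
    have k: "0 \<le> s\<^sup>2 * (cmod d)\<^sup>2 * N - 2 * s * (cmod d)\<^sup>2" for s :: real
    proof -
      \<comment> \<open>This phase makes the linear term equal to -2 s |d|^2, which beats the
        quadratic term for small positive s unless d = 0.\<close>
      define c where "c = - of_real s * cnj d"
      have cm: "Re (cinner w (B v)) = Re (cinner (B v) w)" for v
        by (subst cinner_commute) simp
      have "0 \<le> (norm (B (c *\<^sub>C u)))\<^sup>2 + 2 * Re (cinner w (B (c *\<^sub>C u))) - 2 * Re (g (c *\<^sub>C u))"
        by (rule key[OF Vsc[OF u]])
      also have "\<dots> = (cmod c)\<^sup>2 * N + 2 * Re (c * d)"
        unfolding cm d_def N_def
        by (simp add: Bsc gsc norm_scaleC power_mult_distrib cinner_scaleC_left right_diff_distrib)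
      also have "(cmod c)\<^sup>2 = s\<^sup>2 * (cmod d)\<^sup>2"
        by (simp add: c_def norm_mult power_mult_distrib)
      also have "Re (c * d) = - s * (cmod d)\<^sup>2"
        by (simp only: c_def cmod_power2) (simp add: power2_eq_square algebra_simps)
      finally show ?thesis by simp
    qed
    have "d = 0"
    proof (rule ccontr)
      assume "d \<noteq> 0"
      then have p: "(cmod d)\<^sup>2 > 0" by simp
      have N0: "N \<ge> 0" by (simp add: N_def)
      \<comment> \<open>The denominator \<open>N + 1\<close> ensures s N < 1 and is nonzero even if
        \<open>B u\<close> vanishes.\<close>
      define s where "s = 1 / (N + 1)"
      have s: "s > 0" "s * N < 1" using N0 by (auto simp: s_def field_simps)
      have "0 \<le> (s * (cmod d)\<^sup>2) * (s * N - 2)"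
        using k[of s] by (simp add: power2_eq_square algebra_simps)
      then show False using s p by (smt (verit) mult_pos_neg mult_pos_pos)
    qed
    then show ?thesis by (simp add: d_def)
  qed
  have "norm w \<le> \<bar>C\<bar>"
  proof -
    have "(\<lambda>n. cmod (cinner (B (x n)) w)) \<longlonglongrightarrow> cmod (cinner w w)"
      by (intro tendsto_intros tendsto_cinner w)
    moreover have "(\<lambda>n. \<bar>C\<bar> * norm (B (x n))) \<longlonglongrightarrow> \<bar>C\<bar> * norm w"
      by (intro tendsto_intros w)
    moreover have "cmod (cinner (B (x n)) w) \<le> \<bar>C\<bar> * norm (B (x n))" for n
      using bd[OF xV, of n] eq[OF xV, of n] by (smt (verit) mult_right_mono norm_ge_zero)
    ultimately have "cmod (cinner w w) \<le> \<bar>C\<bar> * norm w"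
      by (intro LIMSEQ_le) auto
    then have "norm w * norm w \<le> \<bar>C\<bar> * norm w"
      by (simp add: cinner_self power2_eq_square norm_mult)
    then show ?thesis
      by (cases "norm w = 0") (auto simp: mult_le_cancel_right)
  qed
  with wcl eq show thesis using that by blast
qed

subsection \<open>Operators\<close>

lemma clinear_opD: "clinear_op A \<Longrightarrow> A (c *\<^sub>C x) = c *\<^sub>C A x"
  by (simp add: clinear_op_def)

lemma clinear_op_simps [simp]:
  "clinear_op (0 :: 'a::complex_inner \<Rightarrow>\<^sub>L 'b::complex_inner)"
  "clinear_op (id_blinfun :: 'a \<Rightarrow>\<^sub>L 'a)"
  by (auto simp: clinear_op_def)

lemma clinear_op_add [intro]: "clinear_op A \<Longrightarrow> clinear_op B \<Longrightarrow> clinear_op (A + B)"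
  and clinear_op_diff [intro]: "clinear_op A \<Longrightarrow> clinear_op B \<Longrightarrow> clinear_op (A - B)"
  and clinear_op_scaleR [intro]: "clinear_op A \<Longrightarrow> clinear_op (r *\<^sub>R A)"
  and clinear_op_scaleC [intro]: "clinear_op A \<Longrightarrow> clinear_op (c *\<^sub>C A)"
  by (auto simp: clinear_op_def blinfun.bilinear_simps scaleC_blinfun.rep_eq scaleC_add_right
      cvec.scale_right_diff_distrib scaleR_scaleC scaleC_scaleC mult.commute)

lemma clinear_op_compose [intro]: "clinear_op A \<Longrightarrow> clinear_op B \<Longrightarrow> clinear_op (A o\<^sub>L B)"
  by (simp add: clinear_op_def)

lemma clinear_op_rank_one [simp]: "clinear_op (rank_one x y)"
  by (simp add: clinear_op_def rank_one.rep_eq cinner_simps scaleC_scaleC)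

lemma clinear_op_lim: 
  assumes "F \<noteq> bot" "(A \<longlongrightarrow> L) F" "\<And>n. clinear_op (A n)"
  shows "clinear_op L"
proof -
  have "L (c *\<^sub>C x) = c *\<^sub>C L x" for c x
  proof (rule tendsto_unique[OF assms(1)])
    show "((\<lambda>n. A n (c *\<^sub>C x)) \<longlongrightarrow> L (c *\<^sub>C x)) F"
      by (intro tendsto_intros assms)
    have "((\<lambda>n. c *\<^sub>C A n x) \<longlongrightarrow> c *\<^sub>C L x) F"
      by (intro bounded_linear.tendsto[OF bounded_linear_scaleC] tendsto_intros assms)
    then show "((\<lambda>n. A n (c *\<^sub>C x)) \<longlongrightarrow> c *\<^sub>C L x) F"
      using assms(3) by (simp add: clinear_op_def)
  qed
  then show ?thesis by (simp add: clinear_op_def)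
qed

text \<open>The adjoint, the Douglas factor, the partial trace and the product coupling are all
  obtained from their forms by this lemma.\<close>

lemma riesz_form:
  fixes h :: "'a::complex_inner \<Rightarrow> 'b::chilbert_space \<Rightarrow> complex"
  assumes "\<And>x x' y. h (x + x') y = h x y + h x' y" "\<And>c x y. h (c *\<^sub>C x) y = c * h x y"
    and "\<And>x y y'. h x (y + y') = h x y + h x y'" "\<And>c x y. h x (c *\<^sub>C y) = cnj c * h x y"
    and bd: "\<And>x y. cmod (h x y) \<le> K * norm x * norm y"
  obtains A where "clinear_op A" "\<And>x y. h x y = cinner (A x) y"
proof -
  \<comment> \<open>Riesz represents linear functionals, whereas \<open>h x\<close> is conjugate
    linear, hence the conjugate in the next line. The absolute value appears because no sign is
    assumed for \<open>K\<close>.\<close>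
  have "\<exists>w. (\<forall>y. h x y = cinner w y) \<and> norm w \<le> \<bar>K * norm x\<bar>" for x
  proof (rule riesz_on_subspace[of UNIV "\<lambda>y. y" "\<lambda>y. cnj (h x y)" "K * norm x"])
    fix w assume w: "\<And>y. y \<in> UNIV \<Longrightarrow> cnj (h x y) = cinner y w" "norm w \<le> \<bar>K * norm x\<bar>"
    have "h x y = cinner w y" for y
      using w(1)[of y] cinner_commute[of w y] by (metis UNIV_I complex_cnj_cnj)
    then show ?thesis using w by blast
  qed (use assms in auto)
  then obtain f where f: "\<And>x y. h x y = cinner (f x) y" "\<And>x. norm (f x) \<le> \<bar>K * norm x\<bar>"
    by metis
  have sc: "f (c *\<^sub>C x) = c *\<^sub>C f x" for c x
    by (rule cinner_ext_left) (simp add: cinner_simps assms flip: f)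
  have "bounded_linear f"
  proof (rule bounded_linear_intro[where K = "\<bar>K\<bar>"])
    show "f (x + y) = f x + f y" for x y
      by (rule cinner_ext_left) (simp add: cinner_simps assms flip: f)
    show "norm (f x) \<le> norm x * \<bar>K\<bar>" for x
      using f(2)[of x] by (simp add: abs_mult mult.commute)
  qed (simp add: scaleR_scaleC sc)
  then have "blinfun_apply (Blinfun f) = f" by (rule bounded_linear_Blinfun_apply)
  then show thesis using that[of "Blinfun f"] sc f(1) by (simp add: clinear_op_def)
qed

lemma adjoint_exists:
  fixes A :: "'a::chilbert_space \<Rightarrow>\<^sub>L 'b::complex_inner"
  assumes "clinear_op A"
  obtains A' where "clinear_op A'" "\<And>x y. cinner (A x) y = cinner x (A' y)"
    "\<And>x y. cinner x (A y) = cinner (A' x) y"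
proof -
  obtain A' where A': "clinear_op A'" "\<And>x y. cinner x (A y) = cinner (A' x) y"
  proof (rule riesz_form[of "\<lambda>x y. cinner x (A y)" "norm A"])
    fix x y 
    have "cmod (cinner x (A y)) \<le> norm x * norm (A y)" by (rule cmod_cinner_le)
    also have "\<dots> \<le> norm x * (norm A * norm y)"
      by (intro mult_left_mono norm_blinfun) simp
    finally show "cmod (cinner x (A y)) \<le> norm A * norm x * norm y" by (simp add: mult_ac)
  qed (auto simp: blinfun.bilinear_simps cinner_simps clinear_opD[OF assms])
  moreover have "cinner (A x) y = cinner x (A' y)" for x y
    by (metis A'(2) cinner_commute)
  ultimately show thesis using that by blast
qed

lemma blinfun_ext_cinner: "(\<And>x y. cinner (A x) y = cinner (B x) y) \<Longrightarrow> A = B"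
  for A B :: "'a::real_normed_vector \<Rightarrow>\<^sub>L 'b::complex_inner"
  by (rule blinfun_eqI) (rule cinner_ext_left)

lemma cadjoint_works:
  fixes A :: "'a::chilbert_space \<Rightarrow>\<^sub>L 'b::chilbert_space"
  assumes "clinear_op A"
  shows "clinear_op (cadjoint A)" "cinner (A x) y = cinner x (cadjoint A y)"
    "cinner z (A x) = cinner (cadjoint A z) x"
proof -
  obtain A' where A': "clinear_op A'" "\<And>x y. cinner (A x) y = cinner x (A' y)"
    "\<And>x y. cinner x (A y) = cinner (A' x) y"
    using adjoint_exists[OF assms] by metis
  have "cadjoint A = A'"
    unfolding cadjoint_def
  proof (rule the_equality)
    fix B :: "'b \<Rightarrow>\<^sub>L 'a" assume "\<forall>x y. cinner (A x) y = cinner x (B y)"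
    then show "B = A'" using A'(2) by (metis blinfun_eqI cinner_ext_right)
  qed (use A' in auto)
  then show "clinear_op (cadjoint A)" "cinner (A x) y = cinner x (cadjoint A y)"
    "cinner z (A x) = cinner (cadjoint A z) x" using A' by auto
qed

lemma norm_blinfun_le_cinner:
  fixes A :: "'a::real_normed_vector \<Rightarrow>\<^sub>L 'b::complex_inner"
  assumes "K \<ge> 0" "\<And>x y. cmod (cinner (A x) y) \<le> K * norm x * norm y"
  shows "norm A \<le> K"
proof (rule norm_blinfun_bound[OF assms(1)])
  fix x
  have "norm (A x) * norm (A x) \<le> (K * norm x) * norm (A x)"
    using assms(2)[of x "A x"] by (simp add: cinner_self power2_eq_square norm_mult)
  then show "norm (A x) \<le> K * norm x"
    using assms(1) by (cases "norm (A x) = 0") (auto simp: mult_le_cancel_right)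
qed

lemma norm_contraction_le: "norm A \<le> 1 \<Longrightarrow> norm (A x) \<le> norm x"
  for A :: "'a::real_normed_vector \<Rightarrow>\<^sub>L 'b::real_normed_vector"
  using norm_blinfun[of A x] mult_right_mono[of "norm A" 1 "norm x"] by simp

lemma closure_orthogonal:
  fixes S :: "'a::complex_inner set"
  assumes "\<And>s. s \<in> S \<Longrightarrow> cinner s d = 0" "x \<in> closure S"
  shows "cinner x d = 0"
proof -
  obtain f where f: "\<And>n. f n \<in> S" "f \<longlonglongrightarrow> x" using assms(2) closure_sequential by blast
  have "(\<lambda>n. cinner (f n) d) \<longlonglongrightarrow> cinner x d" by (intro tendsto_cinner f tendsto_const)
  then show ?thesis using assms(1) f(1) by (simp add: LIMSEQ_const_iff)
qed

text \<open>For fixed y, the functional A x |-> <B x, y> is well defined and bounded on the range of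
  \<open>A\<close>; its Riesz vector is the value at y of the adjoint of \<open>C\<close>. Since
  \<open>A\<close> and its modulus have equal norms pointwise, this gives contractions U and V with
  A = U |A| and |A| = V A, which replace the partial isometry of the polar decomposition.\<close>

lemma douglas_factorization:
  fixes A :: "'a::complex_inner \<Rightarrow>\<^sub>L 'b::chilbert_space" and B :: "'a \<Rightarrow>\<^sub>L 'c::chilbert_space"
  assumes A: "clinear_op A" and B: "clinear_op B" and le: "\<And>x. norm (B x) \<le> norm (A x)"
  obtains C where "clinear_op C" "norm C \<le> 1" "B = C o\<^sub>L A"
proof -
  have "\<exists>w. w \<in> closure (range A) \<and> (\<forall>x. cinner (B x) y = cinner (A x) w) \<and> norm w \<le> norm y" for y
  proof (rule riesz_on_subspace[of UNIV A "\<lambda>x. cinner (B x) y" "norm y"])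
    fix x
    have "cmod (cinner (B x) y) \<le> norm (B x) * norm y" by (rule cmod_cinner_le)
    also have "\<dots> \<le> norm (A x) * norm y" by (intro mult_right_mono le) simp
    finally show "cmod (cinner (B x) y) \<le> norm y * norm (A x)" by (simp add: mult.commute)
  qed (auto simp: blinfun.bilinear_simps cinner_simps clinear_opD[OF A] clinear_opD[OF B])
  then obtain v where vcl: "\<And>y. v y \<in> closure (range A)"
    and v: "\<And>x y. cinner (B x) y = cinner (A x) (v y)" and vn: "\<And>y. norm (v y) \<le> norm y"
    by metis
  \<comment> \<open>All \<open>v y\<close> lie in the closed range of \<open>A\<close>. The defects
    of additivity and homogeneity of \<open>v\<close> are orthogonal to that range and are
    combinations of values of \<open>v\<close>, so they are orthogonal to themselves.\<close>
  have orth: "cinner (v y) d = 0" if "\<And>x. cinner (A x) d = 0" for y d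
    by (rule closure_orthogonal[of "range A"]) (use that vcl in auto)
  have vadd: "v (x + y) = v x + v y" for x y
  proof -
    define d where "d = v (x + y) - v x - v y"
    have "cinner (A u) d = 0" for u
      by (simp add: d_def cinner_simps flip: v)
    then have "cinner d d = 0"
      using orth[of d] by (subst (1) d_def) (simp add: cinner_simps)
    then show ?thesis by (simp add: cinner_self_eq_0 d_def diff_eq_eq add.commute)
  qed
  have vsc: "v (c *\<^sub>C x) = c *\<^sub>C v x" for c x
  proof -
    define d where "d = v (c *\<^sub>C x) - c *\<^sub>C v x"
    have "cinner (A u) d = 0" for u
      by (simp add: d_def cinner_simps flip: v)
    then have "cinner d d = 0"
      using orth[of d] by (subst (1) d_def) (simp add: cinner_simps)
    then show ?thesis by (simp add: cinner_self_eq_0 d_def)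
  qed
  have bdd: "cmod (cinner x (v y)) \<le> 1 * norm x * norm y" for x y
    using order_trans[OF cmod_cinner_le[of x "v y"] mult_left_mono[OF vn[of y], of "norm x"]] by simp
  obtain C where C: "clinear_op C" "\<And>x y. cinner x (v y) = cinner (C x) y"
    by (rule riesz_form[of "\<lambda>x y. cinner x (v y)" 1])
      (use bdd in \<open>auto simp: cinner_simps vadd vsc\<close>)
  have "norm C \<le> 1"
    by (rule norm_blinfun_le_cinner) (use bdd in \<open>auto simp flip: C(2)\<close>)
  moreover have "B = C o\<^sub>L A"
    by (rule blinfun_ext_cinner) (simp add: v C(2))
  ultimately show thesis using that C(1) by blast
qed

subsection \<open>Orthonormal bases\<close>

definition orthonormal :: "'a::complex_inner set \<Rightarrow> bool" where
  "orthonormal E \<longleftrightarrow> (\<forall>e\<in>E. norm e = 1) \<and> pairwise (\<lambda>e f. cinner e f = 0) E"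

lemma orthonormal_cinner:
  "orthonormal E \<Longrightarrow> e \<in> E \<Longrightarrow> f \<in> E \<Longrightarrow> cinner e f = (if e = f then 1 else 0)"
  by (auto simp: orthonormal_def pairwise_def cinner_self)

lemma orthonormal_subset: "orthonormal E \<Longrightarrow> F \<subseteq> E \<Longrightarrow> orthonormal F"
  by (auto simp: orthonormal_def intro: pairwise_subset)

lemma cspan_orthogonal:
  assumes "\<And>s. s \<in> S \<Longrightarrow> cinner s z = 0" "x \<in> cspan S"
  shows "cinner x z = 0"
  using assms(2) unfolding cspan_def
  by (induction rule: cvec.span_induct_alt) (auto simp: cinner_simps assms(1))

text \<open>If only zero is orthogonal to \<open>S\<close>, apply Riesz on the span of
  \<open>S\<close> to <v, x>: the representing vector w lies in the closure of the span, and x - w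
  is orthogonal to \<open>S\<close>, so x = w.\<close>

lemma dense_cspan_iff:
  fixes S :: "'a::chilbert_space set"
  shows "closure (cspan S) = UNIV \<longleftrightarrow> (\<forall>z. (\<forall>s\<in>S. cinner s z = 0) \<longrightarrow> z = 0)"
proof safe
  fix z assume "closure (cspan S) = UNIV" and "\<forall>s\<in>S. cinner s z = 0"
  then have "cinner s z = 0" if "s \<in> cspan S" for s
    using that by (intro cspan_orthogonal[of S z s]) auto
  then have "cinner z z = 0"
    using \<open>closure (cspan S) = UNIV\<close> closure_orthogonal[of "cspan S" z z] by auto
  then show "z = 0" by (simp add: cinner_self_eq_0)
next
  fix x assume H: "\<forall>z. (\<forall>s\<in>S. cinner s z = 0) \<longrightarrow> z = 0"
  show "x \<in> closure (cspan S)"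
  proof (rule riesz_on_subspace[of "cspan S" "\<lambda>v. v" "\<lambda>v. cinner v x" "norm x"])
    fix w assume w: "w \<in> closure ((\<lambda>v. v) ` cspan S)" "\<And>v. v \<in> cspan S \<Longrightarrow> cinner v x = cinner v w"
    have "s \<in> cspan S" if "s \<in> S" for s using that by (simp add: cspan_def cvec.span_base)
    then have "\<forall>s\<in>S. cinner s (x - w) = 0" using w(2) by (simp add: cinner_simps)
    then have "x - w = 0" using H by blast
    then show ?thesis using w(1) by simp
  qed (auto simp: cspan_def cvec.span_zero cvec.span_add cvec.span_scale cinner_simps
        intro!: order_trans[OF cmod_cinner_le] eq_refl[OF mult.commute])
qed auto

lemma is_onb_iff: "is_onb E \<longleftrightarrow> orthonormal E \<and> (\<forall>z. (\<forall>e\<in>E. cinner e z = 0) \<longrightarrow> z = 0)"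
  by (simp add: is_onb_def orthonormal_def dense_cspan_iff)

text \<open>A choice by \<open>SOME\<close> says nothing until a basis is known to exist. Zorn gives
  a maximal orthonormal set; a nonzero vector orthogonal to it could be normalised and
  added.\<close>

lemma is_onb_some_onb: "is_onb (some_onb :: 'a::chilbert_space set)"
proof -
  have "\<exists>M\<in>{E::'a set. orthonormal E}. \<forall>X\<in>{E. orthonormal E}. M \<subseteq> X \<longrightarrow> X = M"
  proof (rule subset_Zorn')
    fix C :: "'a set set" assume C: "subset.chain {E. orthonormal E} C"
    then have "orthonormal E" if "E \<in> C" for E using that by (auto simp: subset.chain_def)
    moreover have "pairwise (\<lambda>e f. cinner e f = 0) (\<Union>C)"
      unfolding pairwise_def
    proof safe
      fix e f E F assume "e \<in> E" "E \<in> C" "f \<in> F" "F \<in> C" "e \<noteq> f"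
      moreover have "E \<subseteq> F \<or> F \<subseteq> E" using C calculation by (auto simp: subset.chain_def)
      ultimately show "cinner e f = 0"
        using \<open>\<And>E. E \<in> C \<Longrightarrow> orthonormal E\<close> by (auto simp: orthonormal_def pairwise_def)
    qed
    ultimately show "\<Union>C \<in> {E. orthonormal E}" by (auto simp: orthonormal_def)
  qed
  then obtain M :: "'a set" where M: "orthonormal M" "\<And>X. orthonormal X \<Longrightarrow> M \<subseteq> X \<Longrightarrow> X = M"
    by blast
  have "is_onb M" unfolding is_onb_iff
  proof (intro conjI allI impI M(1))
    fix z assume z: "\<forall>e\<in>M. cinner e z = 0"
    show "z = 0"
    proof (rule ccontr)
      assume z0: "z \<noteq> 0"
      define u where "u = (1 / norm z) *\<^sub>R z"
      have u: "norm u = 1" "\<forall>e\<in>M. cinner e u = 0"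
        using z z0 by (auto simp: u_def cinner_simps)
      moreover have "\<forall>e\<in>M. cinner u e = 0"
        using u(2) by (metis cinner_commute complex_cnj_zero)
      ultimately have "orthonormal (insert u M)"
        using M(1) by (auto simp: orthonormal_def pairwise_insert)
      then have "u \<in> M" using M(2) by blast
      then have "cinner u u = 0" using u by blast
      then show False using u(1) by (simp add: cinner_self_eq_0)
    qed
  qed
  then show ?thesis unfolding some_onb_def by (rule someI)
qed

lemma bessel_finite:
  assumes E: "orthonormal E" "finite E"
  shows "(\<Sum>e\<in>E. (cmod (cinner x e))\<^sup>2) \<le> (norm x)\<^sup>2"
    and "e \<in> E \<Longrightarrow> cinner (x - (\<Sum>f\<in>E. cinner x f *\<^sub>C f)) e = 0"
proof -
  define p where "p = (\<Sum>f\<in>E. cinner x f *\<^sub>C f)"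
  have pe: "cinner p e = cinner x e" if "e \<in> E" for e
  proof -
    have "cinner p e = (\<Sum>f\<in>E. if f = e then cinner x f else 0)"
      unfolding p_def cinner_sum_left
      by (rule sum.cong) (use that in \<open>auto simp: cinner_simps orthonormal_cinner[OF E(1)]\<close>)
    then show ?thesis using that E(2) by simp
  qed
  then show *: "e \<in> E \<Longrightarrow> cinner (x - (\<Sum>f\<in>E. cinner x f *\<^sub>C f)) e = 0"
    by (simp add: cinner_simps p_def)
  have d: "cinner (x - p) p = 0"
    by (subst (2) p_def) (simp add: cinner_sum_right cinner_simps pe)
  have xp: "(norm x)\<^sup>2 = (norm (x - p))\<^sup>2 + (norm p)\<^sup>2"
    using norm_add_sq[of "x - p" p] d by simp
  have "cinner p p = (\<Sum>e\<in>E. cnj (cinner x e) * cinner p e)"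
    by (subst (2) p_def) (simp add: cinner_sum_right cinner_simps)
  also have "\<dots> = of_real (\<Sum>e\<in>E. (cmod (cinner x e))\<^sup>2)"
    by (simp only: of_real_sum complex_norm_square)
      (intro sum.cong, auto simp: pe mult.commute)
  finally have "(norm p)\<^sup>2 = (\<Sum>e\<in>E. (cmod (cinner x e))\<^sup>2)"
    by (simp add: norm_sq_cinner)
  then show "(\<Sum>e\<in>E. (cmod (cinner x e))\<^sup>2) \<le> (norm x)\<^sup>2" using xp by simp
qed

text \<open>The finite Fourier sum over F is the best approximation to x from the span of F. So it
  is at least as good as a given approximant s as soon as F contains the basis vectors occurring in
  s.\<close>

lemma fourier_has_sum:
  assumes E: "is_onb E"
  shows "((\<lambda>e. cinner x e *\<^sub>C e) has_sum x) E"
  unfolding has_sum_def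
proof (rule tendstoI)
  fix r :: real assume r: "r > 0"
  have on: "orthonormal E" using E by (simp add: is_onb_iff)
  have "x \<in> closure (cspan E)" using E by (simp add: is_onb_def)
  then obtain s where s: "s \<in> cspan E" "dist s x < r"
    using r by (auto simp: closure_approachable)
  then obtain T c where T: "finite T" "T \<subseteq> E" "s = (\<Sum>a\<in>T. c a *\<^sub>C a)"
    unfolding cspan_def cvec.span_explicit by blast
  have "dist (\<Sum>e\<in>F. cinner x e *\<^sub>C e) x < r" if F: "finite F" "T \<subseteq> F" "F \<subseteq> E" for F
  proof -
    define p where "p = (\<Sum>e\<in>F. cinner x e *\<^sub>C e)"
    have orth: "cinner (x - p) e = 0" if "e \<in> F" for e
      using bessel_finite(2)[of F e x] F on that by (auto simp: p_def intro: orthonormal_subset)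
    have "cinner (x - p) p = 0"
      by (subst (2) p_def) (simp add: cinner_sum_right cinner_simps(6) orth)
    moreover have "cinner (x - p) s = 0"
      unfolding T(3) by (subst cinner_sum_right, intro sum.neutral ballI)
        (use F orth in \<open>auto simp: cinner_simps(6)\<close>)
    ultimately have "(norm (x - s))\<^sup>2 = (norm (x - p))\<^sup>2 + (norm (p - s))\<^sup>2"
      using norm_add_sq[of "x - p" "p - s"] by (simp add: cinner_simps(4))
    then have "(norm (x - p))\<^sup>2 \<le> (norm (x - s))\<^sup>2"
      using zero_le_power2[of "norm (p - s)"] by linarith
    then have "norm (x - p) \<le> norm (x - s)" by (rule power2_le_imp_le) simp
    then show ?thesis using s(2) by (simp add: dist_norm norm_minus_commute p_def)
  qed
  then show "\<forall>\<^sub>F F in finite_subsets_at_top E. dist (\<Sum>e\<in>F. cinner x e *\<^sub>C e) x < r"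
    unfolding eventually_finite_subsets_at_top using T by blast
qed

lemma parseval:
  assumes E: "is_onb E"
  shows "((\<lambda>e. cinner x e * cinner e y) has_sum cinner x y) E"
  using has_sum_bounded_linear[OF bounded_linear_cinner_left fourier_has_sum[OF E, of x], of y]
  by (simp add: cinner_simps)

lemma cmod_cinner_sq: "of_real ((cmod (cinner x e))\<^sup>2) = cinner x e * cinner e x"
  unfolding complex_norm_square by (subst (3) cinner_commute) simp

lemma cmod_cinner_commute: "cmod (cinner x y) = cmod (cinner y x)"
  by (metis cinner_commute complex_mod_cnj)

lemma parseval_norm:
  assumes E: "is_onb E"
  shows "((\<lambda>e. (cmod (cinner x e))\<^sup>2) has_sum (norm x)\<^sup>2) E"
proof -
  have "((\<lambda>e. complex_of_real ((cmod (cinner x e))\<^sup>2)) has_sum of_real ((norm x)\<^sup>2)) E"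
    using parseval[OF E, of x x] by (simp only: cmod_cinner_sq cinner_self)
  then show ?thesis by (simp only: has_sum_of_real_iff)
qed

lemma has_sum_finite_sum:
  fixes f :: "'i \<Rightarrow> 'j \<Rightarrow> 'a::{topological_comm_monoid_add, t2_space}"
  assumes "\<And>i. i \<in> I \<Longrightarrow> (f i has_sum s i) A"
  shows "((\<lambda>j. \<Sum>i\<in>I. f i j) has_sum (\<Sum>i\<in>I. s i)) A"
  using assms by (induction I rule: infinite_finite_induct) (auto intro!: has_sum_add)

text \<open>Both sides are the double sum of |<X e, f>|^2. Bessel over finite parts of
  \<open>F\<close> gives one inequality; the other is the same inequality for the adjoint, whose
  adjoint is \<open>X\<close>. The two bases are unrelated, so for a self-adjoint \<open>X\<close>
  this is independence of the basis.\<close>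

lemma hilbert_schmidt_adjoint:
  fixes X :: "'a::chilbert_space \<Rightarrow>\<^sub>L 'b::chilbert_space"
  assumes X: "clinear_op X" and E: "is_onb E" and F: "is_onb F"
    and K: "((\<lambda>e. (norm (X e))\<^sup>2) has_sum K) E"
  shows "((\<lambda>f. (norm (cadjoint X f))\<^sup>2) has_sum K) F"
proof -
  have le: "(\<lambda>f. (norm (cadjoint X f))\<^sup>2) summable_on F \<and> (\<Sum>\<^sub>\<infinity>f\<in>F. (norm (cadjoint X f))\<^sup>2) \<le> K"
    if X: "clinear_op X" and E: "is_onb E" and F: "is_onb F"
      and K: "((\<lambda>e. (norm (X e))\<^sup>2) has_sum K) E"
    for X :: "'c::chilbert_space \<Rightarrow>\<^sub>L 'd::chilbert_space" and E F K
  proof -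
    have fin: "(\<Sum>f\<in>G. (norm (cadjoint X f))\<^sup>2) \<le> K" if G: "finite G" "G \<subseteq> F" for G
    proof (rule has_sum_mono[OF _ K])
      show "((\<lambda>e. \<Sum>f\<in>G. (cmod (cinner (cadjoint X f) e))\<^sup>2) has_sum
          (\<Sum>f\<in>G. (norm (cadjoint X f))\<^sup>2)) E"
        by (intro has_sum_finite_sum parseval_norm E)
      have "orthonormal G" using F G by (auto simp: is_onb_iff intro: orthonormal_subset)
      then show "(\<Sum>f\<in>G. (cmod (cinner (cadjoint X f) e))\<^sup>2) \<le> (norm (X e))\<^sup>2" for e
        using bessel_finite(1)[of G "X e"] G
        by (simp add: cadjoint_works(3)[OF X, symmetric] cmod_cinner_commute)
    qed
    have "(\<lambda>f. (norm (cadjoint X f))\<^sup>2) summable_on F"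
      by (rule nonneg_bdd_above_summable_on) (auto intro!: bdd_aboveI[of _ K] fin)
    moreover have "(\<Sum>\<^sub>\<infinity>f\<in>F. (norm (cadjoint X f))\<^sup>2) \<le> K"
      using calculation fin by (rule infsum_le_finite_sums)
    ultimately show ?thesis by blast
  qed
  note 1 = le[OF X E F K]
  define L where "L = (\<Sum>\<^sub>\<infinity>f\<in>F. (norm (cadjoint X f))\<^sup>2)"
  have L: "((\<lambda>f. (norm (cadjoint X f))\<^sup>2) has_sum L) F"
    using 1 by (simp add: L_def)
  have XX: "cadjoint (cadjoint X) = X"
    by (intro blinfun_ext_cinner)
      (simp add: cadjoint_works(3)[OF cadjoint_works(1)[OF X], symmetric] cadjoint_works(2)[OF X])
  have "K \<le> L"
    using le[OF cadjoint_works(1)[OF X] F E L] K by (simp add: XX infsumI)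
  then show ?thesis using 1 L by (simp add: L_def)
qed

subsection \<open>Positive operators and square roots\<close>

lemma psd_opD:
  assumes "psd_op A"
  shows "clinear_op A" "Re (cinner (A x) x) \<ge> 0" "Im (cinner (A x) x) = 0"
    "cinner (A x) x = of_real (Re (cinner (A x) x))"
proof -
  have "cinner (A x) x \<in> \<real>\<^sub>\<ge>\<^sub>0" using assms by (simp add: psd_op_def)
  then show "Re (cinner (A x) x) \<ge> 0" "Im (cinner (A x) x) = 0"
    by (simp_all add: complex_nonneg_Reals_iff)
  then show "cinner (A x) x = of_real (Re (cinner (A x) x))" by (simp add: complex_eq_iff)
qed (use assms in \<open>simp add: psd_op_def\<close>)

lemma psd_opI:
  assumes "clinear_op A" "\<And>x. Re (cinner (A x) x) \<ge> 0" "\<And>x. Im (cinner (A x) x) = 0"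
  shows "psd_op A"
  using assms by (simp add: psd_op_def complex_nonneg_Reals_iff)

text \<open>Polarisation: the vanishing of the imaginary part of the form at x + y and at x + i y
  yields the imaginary and the real part of <A x, y> = conj <A y, x>.\<close>

lemma psd_op_selfadjoint:
  assumes A: "psd_op A"
  shows "cinner (A x) y = cinner x (A y)"
proof -
  note lin = clinear_opD[OF psd_opD(1)[OF A]]
  have 1: "Im (cinner (A (x + y)) (x + y)) = 0" and 2: "Im (cinner (A (x + \<i> *\<^sub>C y)) (x + \<i> *\<^sub>C y)) = 0"
    by (rule psd_opD(3)[OF A])+
  have "Im (cinner (A x) y) + Im (cinner (A y) x) = 0"
    using 1 psd_opD(3)[OF A, of x] psd_opD(3)[OF A, of y] by (simp add: blinfun.bilinear_simps cinner_simps)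
  moreover have "Re (cinner (A y) x) - Re (cinner (A x) y) = 0"
    using 2 psd_opD(3)[OF A, of x] psd_opD(3)[OF A, of y]
    by (simp add: blinfun.bilinear_simps cinner_simps lin)
  ultimately have "cinner (A x) y = cnj (cinner (A y) x)"
    by (simp add: complex_eq_iff)
  then show ?thesis by (metis cinner_commute)
qed

lemma selfadjoint_psdI:
  assumes "clinear_op A" "\<And>x y. cinner (A x) y = cinner x (A y)" "\<And>x. Re (cinner (A x) x) \<ge> 0"
  shows "psd_op A"
proof (rule psd_opI[OF assms(1,3)])
  show "Im (cinner (A x) x) = 0" for x
    using assms(2)[of x x] cinner_commute[of x "A x"] by (metis complex_cnj_cancel_iff
      Im_complex_of_real Reals_cnj_iff Reals_cases)
qed

lemma psd_op_cadjoint: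
  assumes "psd_op A"
  shows "cadjoint A = A"
  by (rule blinfun_ext_cinner)
    (simp add: cadjoint_works(3)[OF psd_opD(1)[OF assms], symmetric] psd_op_selfadjoint[OF assms])

text \<open>The discriminant argument for a form that may be degenerate. If <A y, y> = 0 there is no
  quadratic term, and p - 2 s |a|^2 would become negative for large s. The degenerate case matters
  later: <A y, y> = 0 forces A y = 0.\<close>

lemma psd_op_cauchy_schwarz:
  assumes A: "psd_op A"
  shows "(cmod (cinner (A x) y))\<^sup>2 \<le> Re (cinner (A x) x) * Re (cinner (A y) y)"
proof -
  note lin = clinear_opD[OF psd_opD(1)[OF A]]
  define a where "a = cinner (A x) y"
  define p where "p = Re (cinner (A x) x)"
  define q where "q = Re (cinner (A y) y)"
  have yx: "cinner (A y) x = cnj a"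
    unfolding a_def using psd_op_selfadjoint[OF A, of x y] by (metis cinner_commute)
  have pq: "p \<ge> 0" "q \<ge> 0" using psd_opD(2)[OF A] by (auto simp: p_def q_def)
  have key: "0 \<le> p + s\<^sup>2 * (cmod a)\<^sup>2 * q - 2 * s * (cmod a)\<^sup>2" for s :: real
  proof -
    have qy: "cinner (A y) y = of_real q"
      unfolding q_def by (rule psd_opD(4)[OF A])
    define c where "c = - of_real s * a"
    have "0 \<le> Re (cinner (A (x + c *\<^sub>C y)) (x + c *\<^sub>C y))"
      by (rule psd_opD(2)[OF A])
    also have "\<dots> = Re (cinner (A x) x + cnj c * a + c * cnj a + c * (cnj c * cinner (A y) y))"
      by (simp only: blinfun.add_right cinner_simps lin yx a_def[symmetric] distrib_left add.assoc)
        (simp only: ac_simps)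
    also have "c * (cnj c * cinner (A y) y) = of_real ((cmod c)\<^sup>2 * q)"
      unfolding of_real_mult complex_norm_square qy by (simp only: mult.assoc)
    also have "(cmod c)\<^sup>2 = s\<^sup>2 * (cmod a)\<^sup>2"
      by (simp add: c_def norm_mult power_mult_distrib)
    also have "cnj c * a = - of_real (s * (cmod a)\<^sup>2)"
      unfolding of_real_mult complex_norm_square by (simp add: c_def)
    also have "c * cnj a = - of_real (s * (cmod a)\<^sup>2)"
      unfolding of_real_mult complex_norm_square by (simp add: c_def)
    also have "Re (cinner (A x) x + - of_real (s * (cmod a)\<^sup>2) + - of_real (s * (cmod a)\<^sup>2)
        + of_real (s\<^sup>2 * (cmod a)\<^sup>2 * q)) = p + s\<^sup>2 * (cmod a)\<^sup>2 * q - 2 * s * (cmod a)\<^sup>2"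
      by (simp add: p_def)
    finally show ?thesis .
  qed
  show ?thesis
  proof (cases "q = 0")
    case True
    have "a = 0"
    proof (rule ccontr)
      assume "a \<noteq> 0"
      then have c: "(cmod a)\<^sup>2 > 0" by simp
      have "2 * ((p + 1) / (cmod a)\<^sup>2) * (cmod a)\<^sup>2 = 2 * (p + 1)" using c by simp
      then show False using key[of "(p + 1) / (cmod a)\<^sup>2"] True pq by simp
    qed
    then show ?thesis using pq by (simp flip: a_def p_def q_def)
  next
    case False
    then have q: "q > 0" using pq by simp
    have "0 \<le> p - (cmod a)\<^sup>2 / q"
      using key[of "1 / q"] q by (simp add: power2_eq_square field_simps)
    then show ?thesis using q by (simp add: a_def p_def q_def field_simps)
  qed
qed

lemma psd_op_norm_le:
  assumes A: "psd_op A" and "K \<ge> 0" and le: "\<And>x. Re (cinner (A x) x) \<le> K * (norm x)\<^sup>2"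
  shows "norm A \<le> K"
proof (rule norm_blinfun_le_cinner[OF assms(2)])
  fix x y
  have "(cmod (cinner (A x) y))\<^sup>2 \<le> Re (cinner (A x) x) * Re (cinner (A y) y)"
    by (rule psd_op_cauchy_schwarz[OF A])
  also have "\<dots> \<le> (K * (norm x)\<^sup>2) * (K * (norm y)\<^sup>2)"
    by (intro mult_mono le psd_opD(2)[OF A]) (use assms(2) in auto)
  also have "\<dots> = (K * norm x * norm y)\<^sup>2" by (simp add: power2_eq_square)
  finally show "cmod (cinner (A x) y) \<le> K * norm x * norm y"
    by (rule power2_le_imp_le) (use assms(2) in simp)
qed

text \<open>For \<open>R = 1 - T\<close> the iteration \<open>Y \<mapsto> (R + Y\<^sup>2) / 2\<close> has a limit with \<open>(1 - Y)\<^sup>2 = T\<close>. Its increments are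
  dominated in norm by those of the convergent scalar iteration for \<open>R = 1\<close>.\<close>

primrec sqrt_iter :: "('a::real_normed_vector \<Rightarrow>\<^sub>L 'a) \<Rightarrow> nat \<Rightarrow> ('a \<Rightarrow>\<^sub>L 'a)" where
  "sqrt_iter R 0 = 0"
| "sqrt_iter R (Suc n) = (1/2) *\<^sub>R (R + (sqrt_iter R n o\<^sub>L sqrt_iter R n))"

primrec sqrt_bound :: "nat \<Rightarrow> real" where
  "sqrt_bound 0 = 0"
| "sqrt_bound (Suc n) = (1 + (sqrt_bound n)\<^sup>2) / 2"

lemmas blinfun_compose_simps = bounded_bilinear.add_left[OF bounded_bilinear_blinfun_compose]
  bounded_bilinear.add_right[OF bounded_bilinear_blinfun_compose]
  bounded_bilinear.diff_left[OF bounded_bilinear_blinfun_compose]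
  bounded_bilinear.diff_right[OF bounded_bilinear_blinfun_compose]
  bounded_bilinear.scaleR_left[OF bounded_bilinear_blinfun_compose]
  bounded_bilinear.scaleR_right[OF bounded_bilinear_blinfun_compose]

lemma blinfun_compose_assoc: "(A o\<^sub>L B) o\<^sub>L C = A o\<^sub>L (B o\<^sub>L C)"
  by (rule blinfun_eqI) simp

text \<open>Each iterate is a polynomial in \<open>R\<close>. Hence the iterates commute with one
  another, as the factorisation of differences of squares requires, and the limit commutes with
  everything that commutes with \<open>R\<close>.\<close>

lemma sqrt_iter_commute:
  assumes "X o\<^sub>L R = R o\<^sub>L X"
  shows "X o\<^sub>L sqrt_iter R n = sqrt_iter R n o\<^sub>L X"
proof (induction n)
  case (Suc n)
  have "X o\<^sub>L (sqrt_iter R n o\<^sub>L sqrt_iter R n) = (sqrt_iter R n o\<^sub>L sqrt_iter R n) o\<^sub>L X"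
    by (metis Suc blinfun_compose_assoc)
  then show ?case by (simp add: blinfun_compose_simps assms)
qed simp

lemma sqrt_bound_props: "0 \<le> sqrt_bound n" "sqrt_bound n \<le> 1" "sqrt_bound n \<le> sqrt_bound (Suc n)"
proof -
  show 0: "0 \<le> sqrt_bound n" by (cases n) auto
  show 1: "sqrt_bound n \<le> 1"
  proof (induction n)
    case (Suc n)
    moreover have "0 \<le> sqrt_bound n" by (cases n) auto
    ultimately have "(sqrt_bound n)\<^sup>2 \<le> 1" by (simp add: power_le_one)
    then show ?case by simp
  qed simp
  have "0 \<le> (1 - sqrt_bound n)\<^sup>2" by simp
  then show "sqrt_bound n \<le> sqrt_bound (Suc n)" by (simp add: power2_diff)
qed

lemma norm_sqrt_iter:
  assumes "norm R \<le> 1"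
  shows "norm (sqrt_iter R n) \<le> sqrt_bound n"
proof (induction n)
  case (Suc n)
  have "norm (sqrt_iter R n o\<^sub>L sqrt_iter R n) \<le> sqrt_bound n * sqrt_bound n"
    by (rule order_trans[OF norm_blinfun_compose])
      (intro mult_mono Suc sqrt_bound_props norm_ge_zero)
  then have "norm (R + (sqrt_iter R n o\<^sub>L sqrt_iter R n)) \<le> 1 + sqrt_bound n * sqrt_bound n"
    using assms norm_triangle_ineq[of R "sqrt_iter R n o\<^sub>L sqrt_iter R n"] by simp
  then show ?case by (simp add: power2_eq_square)
qed simp

text \<open>With consecutive iterates Y and Z, the next increment is (Z^2 - Y^2) / 2 = (Z + Y) (Z -
  Y) / 2, because they commute. The scalar iteration obeys the same identity, so the bound
  propagates.\<close>

lemma norm_sqrt_iter_diff: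
  assumes "norm R \<le> 1"
  shows "norm (sqrt_iter R (Suc n) - sqrt_iter R n) \<le> sqrt_bound (Suc n) - sqrt_bound n"
proof (induction n)
  case 0
  then show ?case using assms by simp
next
  case (Suc n)
  let ?Y = "sqrt_iter R n" and ?Z = "sqrt_iter R (Suc n)"
  let ?y = "sqrt_bound n" and ?z = "sqrt_bound (Suc n)"
  have c: "?Z o\<^sub>L ?Y = ?Y o\<^sub>L ?Z"
    by (rule sqrt_iter_commute) (rule sqrt_iter_commute[symmetric], simp)
  have "sqrt_iter R (Suc (Suc n)) - ?Z = (1/2) *\<^sub>R ((?Z o\<^sub>L ?Z) - (?Y o\<^sub>L ?Y))"
  proof -
    have "(1/2) *\<^sub>R (R + (Z o\<^sub>L Z)) - Z = (1/2) *\<^sub>R ((Z o\<^sub>L Z) - (Y o\<^sub>L Y))"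
      if "Z = (1/2) *\<^sub>R (R + (Y o\<^sub>L Y))" for Y Z :: "'a \<Rightarrow>\<^sub>L 'a"
      by (subst (3) that) (simp add: scaleR_add_right scaleR_diff_right)
    from this[of ?Z ?Y] show ?thesis unfolding sqrt_iter.simps(2)[of R "Suc n"] by simp
  qed
  also have "(?Z o\<^sub>L ?Z) - (?Y o\<^sub>L ?Y) = (?Z + ?Y) o\<^sub>L (?Z - ?Y)"
    by (simp only: blinfun_compose_simps c) simp
  finally have "norm (sqrt_iter R (Suc (Suc n)) - ?Z) = norm ((?Z + ?Y) o\<^sub>L (?Z - ?Y)) / 2" by simp
  also have "\<dots> \<le> (norm (?Z + ?Y) * norm (?Z - ?Y)) / 2"
    by (intro divide_right_mono norm_blinfun_compose) simp
  also have "\<dots> \<le> ((?z + ?y) * (?z - ?y)) / 2"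
  proof (intro divide_right_mono mult_mono Suc)
    show "norm (?Z + ?Y) \<le> ?z + ?y"
      by (rule order_trans[OF norm_triangle_ineq]) (intro add_mono norm_sqrt_iter assms)
    show "0 \<le> ?z + ?y" using sqrt_bound_props by (metis add_nonneg_nonneg)
  qed simp_all
  also have "\<dots> = sqrt_bound (Suc (Suc n)) - ?z"
  proof -
    have "(z + y) * (z - y) / 2 = (1 + z\<^sup>2) / 2 - z" if "2 * z = 1 + y\<^sup>2" for y z :: real
      using that by (simp add: square_diff_square_factored[symmetric] power2_eq_square field_simps)
    from this[of ?z ?y] show ?thesis unfolding sqrt_bound.simps(2)[of "Suc n"] by simp
  qed
  finally show ?case .
qed

lemma sqrt_iter_convergent:
  fixes R :: "'a::chilbert_space \<Rightarrow>\<^sub>L 'a"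
  assumes R: "norm R \<le> 1"
  obtains Y where "sqrt_iter R \<longlonglongrightarrow> Y" "Y = (1/2) *\<^sub>R (R + (Y o\<^sub>L Y))"
proof -
  have "incseq sqrt_bound" by (rule incseq_SucI) (rule sqrt_bound_props)
  then obtain l where "sqrt_bound \<longlonglongrightarrow> l"
    using incseq_convergent[of sqrt_bound 1] sqrt_bound_props(2) by blast
  then have "summable (\<lambda>n. sqrt_bound (Suc n) - sqrt_bound n)"
    using telescope_summable by blast
  then have "summable (\<lambda>n. sqrt_iter R (Suc n) - sqrt_iter R n)"
    by (rule summable_comparison_test'[where N = 0]) (rule norm_sqrt_iter_diff[OF R])
  then have "convergent (\<lambda>n. \<Sum>i<n. sqrt_iter R (Suc i) - sqrt_iter R i)"
    by (simp add: summable_iff_convergent)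
  then have "convergent (sqrt_iter R)"
    by (subst (asm) sum_lessThan_telescope) simp
  then obtain Y where Y: "sqrt_iter R \<longlonglongrightarrow> Y" by (auto simp: convergent_def)
  have "(\<lambda>n. sqrt_iter R (Suc n)) \<longlonglongrightarrow> (1/2) *\<^sub>R (R + (Y o\<^sub>L Y))"
    unfolding sqrt_iter.simps
    by (intro tendsto_intros Y bounded_bilinear.tendsto[OF bounded_bilinear_blinfun_compose])
  moreover have "(\<lambda>n. sqrt_iter R (Suc n)) \<longlonglongrightarrow> Y" using Y by (rule LIMSEQ_Suc)
  ultimately show thesis using that Y LIMSEQ_unique by blast
qed

text \<open>The commutation clause comes from the root being a norm limit of polynomials in
  \<open>T\<close>; the proof of uniqueness depends on it.\<close>

lemma psd_sqrt_exists:
  fixes T :: "'a::chilbert_space \<Rightarrow>\<^sub>L 'a"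
  assumes T: "psd_op T"
  obtains S where "psd_op S" "S o\<^sub>L S = T" "\<And>X. X o\<^sub>L T = T o\<^sub>L X \<Longrightarrow> X o\<^sub>L S = S o\<^sub>L X"
proof -
  \<comment> \<open>Dividing by \<open>k\<close> puts \<open>T\<close> between 0 and 1, so that
    \<open>R\<close> is positive of norm at most 1. The added 1 keeps \<open>k\<close> positive for
    \<open>T\<close> = 0.\<close>
  define k where "k = norm T + 1"
  have k: "k > 0" by (simp add: k_def add_nonneg_pos)
  define R where "R = id_blinfun - (1/k) *\<^sub>R T"
  have Rsa: "cinner (R x) y = cinner x (R y)" for x y
    by (simp add: R_def blinfun.bilinear_simps cinner_simps psd_op_selfadjoint[OF T])
  have Rcl: "clinear_op R" unfolding R_def using psd_opD(1)[OF T] by auto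
  have Rq: "Re (cinner (R x) x) = (norm x)\<^sup>2 - Re (cinner (T x) x) / k" for x
    by (simp add: R_def blinfun.bilinear_simps cinner_simps cinner_self)
  have Tq: "Re (cinner (T x) x) \<le> k * (norm x)\<^sup>2" for x
  proof -
    have "Re (cinner (T x) x) \<le> norm (T x) * norm x"
      using complex_Re_le_cmod cmod_cinner_le order_trans by blast
    also have "\<dots> \<le> (norm T * norm x) * norm x"
      by (intro mult_right_mono norm_blinfun) simp
    also have "\<dots> \<le> k * (norm x)\<^sup>2"
      by (simp add: k_def power2_eq_square algebra_simps)
    finally show ?thesis .
  qed
  have Rpsd: "psd_op R"
    by (rule selfadjoint_psdI[OF Rcl Rsa]) (use Tq k in \<open>simp add: Rq field_simps\<close>)
  have Rn: "norm R \<le> 1"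
    by (rule psd_op_norm_le[OF Rpsd]) (use psd_opD(2)[OF T] k in \<open>auto simp: Rq\<close>)
  obtain Y where Y: "sqrt_iter R \<longlonglongrightarrow> Y" "Y = (1/2) *\<^sub>R (R + (Y o\<^sub>L Y))"
    using sqrt_iter_convergent[OF Rn] by blast
  have ncl: "clinear_op (sqrt_iter R n)" for n
    by (induction n) (auto intro!: clinear_op_scaleR clinear_op_add clinear_op_compose Rcl)
  have Ycl: "clinear_op Y" using clinear_op_lim[OF _ Y(1) ncl] by simp
  have nsa: "cinner (sqrt_iter R n x) y = cinner x (sqrt_iter R n y)" for n x y
    by (induction n arbitrary: x y) (auto simp: blinfun.bilinear_simps cinner_simps Rsa)
  have lim: "(\<lambda>n. sqrt_iter R n x) \<longlonglongrightarrow> Y x" for x by (intro tendsto_intros Y)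
  have Ysa: "cinner (Y x) y = cinner x (Y y)" for x y
    by (rule LIMSEQ_unique[of "\<lambda>n. cinner (sqrt_iter R n x) y"], intro tendsto_cinner lim tendsto_const)
      (unfold nsa, intro tendsto_cinner lim tendsto_const)
  have Yn: "norm Y \<le> 1"
  proof (rule LIMSEQ_le_const2[OF tendsto_norm[OF Y(1)]])
    show "\<exists>N. \<forall>n\<ge>N. norm (sqrt_iter R n) \<le> 1"
      using order_trans[OF norm_sqrt_iter[OF Rn] sqrt_bound_props(2)] by blast
  qed
  \<comment> \<open>From 2 Y = R + Y^2 follows (1 - Y)^2 = 1 - R = T / k, so the factor sqrt k
    undoes the scaling.\<close>
  define S where "S = sqrt k *\<^sub>R (id_blinfun - Y)"
  have YY: "R + (Y o\<^sub>L Y) = 2 *\<^sub>R Y" by (subst (3) Y(2)) simp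
  have "psd_op S"
  proof (rule selfadjoint_psdI)
    show "clinear_op S" unfolding S_def by (intro clinear_op_scaleR clinear_op_diff Ycl clinear_op_simps)
    show "cinner (S x) y = cinner x (S y)" for x y
      by (simp add: S_def blinfun.bilinear_simps cinner_simps Ysa)
    show "0 \<le> Re (cinner (S x) x)" for x
    proof -
      have "Re (cinner (Y x) x) \<le> norm (Y x) * norm x"
        using complex_Re_le_cmod cmod_cinner_le order_trans by blast
      also have "\<dots> \<le> norm x * norm x"
        by (intro mult_right_mono norm_contraction_le Yn) simp
      finally have "Re (cinner (Y x) x) \<le> (norm x)\<^sup>2" by (simp add: power2_eq_square)
      then show ?thesis using k by (simp add: S_def blinfun.bilinear_simps cinner_simps cinner_self)
    qed
  qed
  moreover have "S o\<^sub>L S = T"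
  proof -
    have [simp]: "id_blinfun o\<^sub>L X = X" "X o\<^sub>L id_blinfun = X" for X :: "'a \<Rightarrow>\<^sub>L 'a"
      by (auto intro: blinfun_eqI)
    have "S o\<^sub>L S = k *\<^sub>R (id_blinfun - 2 *\<^sub>R Y + (Y o\<^sub>L Y))"
      using k by (simp add: S_def blinfun_compose_simps algebra_simps scaleR_2)
    also have "id_blinfun - 2 *\<^sub>R Y + (Y o\<^sub>L Y) = id_blinfun - R"
      by (simp flip: YY)
    also have "k *\<^sub>R (id_blinfun - R) = T" using k by (simp add: R_def)
    finally show ?thesis .
  qed
  moreover have "X o\<^sub>L S = S o\<^sub>L X" if X: "X o\<^sub>L T = T o\<^sub>L X" for X
  proof -
    have "X o\<^sub>L id_blinfun = id_blinfun o\<^sub>L X" by (auto intro: blinfun_eqI)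
    then have XR: "X o\<^sub>L R = R o\<^sub>L X" by (simp add: R_def blinfun_compose_simps X)
    have "X o\<^sub>L Y = Y o\<^sub>L X"
      by (rule LIMSEQ_unique[of "\<lambda>n. X o\<^sub>L sqrt_iter R n"],
        intro bounded_bilinear.tendsto[OF bounded_bilinear_blinfun_compose] Y(1) tendsto_const)
       (unfold sqrt_iter_commute[OF XR],
        intro bounded_bilinear.tendsto[OF bounded_bilinear_blinfun_compose] Y(1) tendsto_const)
    then show ?thesis using \<open>X o\<^sub>L id_blinfun = id_blinfun o\<^sub>L X\<close>
      by (simp add: S_def blinfun_compose_simps)
  qed
  ultimately show thesis using that by blast
qed

text \<open>Suppose first that B and C commute. Then y = B x - C x satisfies B y + C y = 0, so the
  nonnegative numbers <B y, y> and <C y, y> vanish, whence B y = C y = 0 and <y, y> = <x, B y - C y>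
  = 0. In general, both are compared with the constructed root, which commutes with each of
  them.\<close>

lemma psd_sqrt_unique:
  fixes B C :: "'a::chilbert_space \<Rightarrow>\<^sub>L 'a"
  assumes B: "psd_op B" and C: "psd_op C" and eq: "B o\<^sub>L B = C o\<^sub>L C"
  shows "B = C"
proof -
  have main: "B = C" if B: "psd_op B" and C: "psd_op C" and eq: "B o\<^sub>L B = C o\<^sub>L C"
    and com: "B o\<^sub>L C = C o\<^sub>L B" for B C :: "'a \<Rightarrow>\<^sub>L 'a"
  proof (rule blinfun_eqI)
    fix x
    have ptw: "B (B z) = C (C z)" "B (C z) = C (B z)" for z
      using eq com by (metis blinfun_apply_blinfun_compose)+
    define y where "y = B x - C x"
    have "B y + C y = 0" by (simp add: y_def blinfun.bilinear_simps ptw)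
    then have "cinner (B y) y + cinner (C y) y = 0" by (simp flip: cinner_add_left)
    then have "Re (cinner (B y) y) + Re (cinner (C y) y) = 0" by (metis plus_complex.simps(1) zero_complex.simps(1))
    then have z: "Re (cinner (B y) y) = 0" "Re (cinner (C y) y) = 0"
      using psd_opD(2)[OF B, of y] psd_opD(2)[OF C, of y] by linarith+
    have "B y = 0"
      using psd_op_cauchy_schwarz[OF B, of y "B y"] z by (simp add: cinner_self_eq_0)
    moreover have "C y = 0"
      using psd_op_cauchy_schwarz[OF C, of y "C y"] z by (simp add: cinner_self_eq_0)
    moreover have "cinner y y = cinner x (B y - C y)"
      by (subst (1) y_def) (simp add: cinner_simps psd_op_selfadjoint[OF B] psd_op_selfadjoint[OF C])
    ultimately show "B x = C x" by (simp add: cinner_self_eq_0 y_def)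
  qed
  have "psd_op (B o\<^sub>L B)"
    by (rule selfadjoint_psdI) (use psd_opD(1)[OF B] in \<open>auto simp: psd_op_selfadjoint[OF B] cinner_self\<close>)
  then obtain S where S: "psd_op S" "S o\<^sub>L S = B o\<^sub>L B"
    "\<And>X. X o\<^sub>L (B o\<^sub>L B) = (B o\<^sub>L B) o\<^sub>L X \<Longrightarrow> X o\<^sub>L S = S o\<^sub>L X"
    using psd_sqrt_exists by metis
  have "B = S" by (rule main[OF B S(1)]) (auto simp: S blinfun_compose_assoc)
  moreover have "C = S" by (rule main[OF C S(1)]) (auto simp: S eq blinfun_compose_assoc)
  ultimately show ?thesis by simp
qed

text \<open>The modulus is the unique positive root of A* A. The equality of norms is the hypothesis
  of the Douglas factorisation in both directions.\<close>

lemma abs_op_works: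
  assumes A: "clinear_op A"
  shows "psd_op (abs_op A)" "abs_op A o\<^sub>L abs_op A = cadjoint A o\<^sub>L A"
    "norm (abs_op A x) = norm (A x)"
proof -
  have q: "cinner ((cadjoint A o\<^sub>L A) x) y = cinner (A x) (A y)" for x y
    by (simp flip: cadjoint_works(3)[OF A])
  have "psd_op (cadjoint A o\<^sub>L A)"
  proof (rule selfadjoint_psdI)
    show "clinear_op (cadjoint A o\<^sub>L A)" using A cadjoint_works(1)[OF A] by auto
    show "cinner ((cadjoint A o\<^sub>L A) x) y = cinner x ((cadjoint A o\<^sub>L A) y)" for x y
      by (metis q cinner_commute)
  qed (simp add: q cinner_self del: blinfun_apply_blinfun_compose)
  then obtain S where S: "psd_op S" "S o\<^sub>L S = cadjoint A o\<^sub>L A" by (rule psd_sqrt_exists)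
  have "\<exists>!B. psd_op B \<and> B o\<^sub>L B = cadjoint A o\<^sub>L A"
  proof (rule ex1I[of _ S])
    fix B assume B: "psd_op B \<and> B o\<^sub>L B = cadjoint A o\<^sub>L A"
    then show "B = S" using S by (metis psd_sqrt_unique)
  qed (use S in simp)
  then have "psd_op (abs_op A) \<and> abs_op A o\<^sub>L abs_op A = cadjoint A o\<^sub>L A"
    unfolding abs_op_def by (rule theI')
  then show 1: "psd_op (abs_op A)" "abs_op A o\<^sub>L abs_op A = cadjoint A o\<^sub>L A" by auto
  have "cinner (abs_op A x) (abs_op A x) = cinner ((abs_op A o\<^sub>L abs_op A) x) x"
    by (simp add: psd_op_selfadjoint[OF 1(1)])
  also have "\<dots> = cinner (A x) (A x)" by (simp only: 1(2) q)
  finally have "(norm (abs_op A x))\<^sup>2 = (norm (A x))\<^sup>2" by (simp add: norm_sq_cinner)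
  then show "norm (abs_op A x) = norm (A x)" by simp
qed

lemma abs_op_psd:
  assumes "psd_op A"
  shows "abs_op A = A"
  by (rule psd_sqrt_unique) (use abs_op_works[OF psd_opD(1)[OF assms]] assms in \<open>auto simp: psd_op_cadjoint\<close>)

subsection \<open>Trace norm bounds by duality\<close>

text \<open>\<open>family_bound I x y C\<close> says that the finite rank operator \<open>\<Sum>\<^sub>i x\<^sub>i y\<^sub>i\<^sup>\<or>\<close> has norm at most \<open>C\<close>.
  Testing \<open>A\<close> against all such operators characterises \<open>\<parallel>A\<parallel>\<^sub>1 \<le> K\<close>.\<close>

definition family_bound :: "'i set \<Rightarrow> ('i \<Rightarrow> 'a::complex_inner) \<Rightarrow> ('i \<Rightarrow> 'a) \<Rightarrow> real \<Rightarrow> bool" where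
  "family_bound I x y C \<longleftrightarrow> C \<ge> 0 \<and>
    (\<forall>z w. cmod (\<Sum>i\<in>I. cinner z (y i) * cinner (x i) w) \<le> C * norm z * norm w)"

definition nuc_le :: "('a::complex_inner \<Rightarrow>\<^sub>L 'a) \<Rightarrow> real \<Rightarrow> bool" where
  "nuc_le A K \<longleftrightarrow> (\<forall>(n::nat) x y C. family_bound {..<n} x y C \<longrightarrow>
    cmod (\<Sum>i<n. cinner (A (x i)) (y i)) \<le> C * K)"

text \<open>A definition cannot quantify over the type of an index, so \<open>nuc_le\<close> uses
  initial segments of the naturals. Enumeration carries the bound over to families indexed by basis
  vectors or by pairs.\<close>

lemma nuc_leD:
  assumes "nuc_le A K" "finite I" "family_bound I x y C"
  shows "cmod (\<Sum>i\<in>I. cinner (A (x i)) (y i)) \<le> C * K"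
proof -
  obtain h where h: "bij_betw h {..<card I} I"
    using ex_bij_betw_nat_finite[OF assms(2)] by (auto simp: lessThan_atLeast0)
  note r = sum.reindex_bij_betw[OF h, symmetric]
  have "family_bound {..<card I} (x \<circ> h) (y \<circ> h) C"
    using assms(3) unfolding family_bound_def by (simp add: r)
  then show ?thesis
    using assms(1) unfolding nuc_le_def r by fastforce
qed

lemma family_bound_single: "family_bound {i} x y (norm (x i) * norm (y i))"
  unfolding family_bound_def
proof safe
  fix z w
  have "cmod (cinner z (y i)) * cmod (cinner (x i) w) \<le> (norm z * norm (y i)) * (norm (x i) * norm w)"
    by (intro mult_mono cmod_cinner_le) auto
  then show "cmod (\<Sum>i\<in>{i}. cinner z (y i) * cinner (x i) w) \<le> norm (x i) * norm (y i) * norm z * norm w"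
    by (simp add: norm_mult mult_ac)
qed auto

lemma nuc_le_nonneg: "nuc_le A K \<Longrightarrow> 0 \<le> K"
  using nuc_leD[of A K "{}" "\<lambda>_. 0" "\<lambda>_. 0" 1] by (simp add: family_bound_def)

lemma nuc_le_norm:
  fixes A :: "'a::complex_inner \<Rightarrow>\<^sub>L 'a"
  assumes "nuc_le A K"
  shows "norm A \<le> K"
proof (rule norm_blinfun_le_cinner[OF nuc_le_nonneg[OF assms]])
  show "cmod (cinner (A x) y) \<le> K * norm x * norm y" for x y
    using nuc_leD[OF assms _ family_bound_single[of "()" "\<lambda>_. x" "\<lambda>_. y"]] by (simp add: mult_ac)
qed

lemma nuc_le_add:
  fixes A :: "'a::complex_inner \<Rightarrow>\<^sub>L 'a"
  assumes "nuc_le A K" "nuc_le B L"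
  shows "nuc_le (A + B) (K + L)"
  unfolding nuc_le_def
proof safe
  fix n :: nat and x y :: "nat \<Rightarrow> 'a" and C assume f: "family_bound {..<n} x y C"
  from f have "cmod (\<Sum>i<n. cinner (A (x i)) (y i)) \<le> C * K" "cmod (\<Sum>i<n. cinner (B (x i)) (y i)) \<le> C * L"
    using assms by (auto simp: nuc_le_def)
  moreover have "cmod (\<Sum>i<n. cinner ((A + B) (x i)) (y i)) \<le>
      cmod (\<Sum>i<n. cinner (A (x i)) (y i)) + cmod (\<Sum>i<n. cinner (B (x i)) (y i))"
    by (simp add: blinfun.add_left cinner_add_left sum.distrib norm_triangle_ineq)
  ultimately show "cmod (\<Sum>i<n. cinner ((A + B) (x i)) (y i)) \<le> C * (K + L)"
    by (simp add: distrib_left)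
qed

lemma nuc_le_scaleC:
  fixes A :: "'a::complex_inner \<Rightarrow>\<^sub>L 'a"
  assumes "nuc_le A K"
  shows "nuc_le (c *\<^sub>C A) (cmod c * K)"
  unfolding nuc_le_def
proof safe
  fix n :: nat and x y :: "nat \<Rightarrow> 'a" and C assume f: "family_bound {..<n} x y C"
  then have "cmod (\<Sum>i<n. cinner (A (x i)) (y i)) \<le> C * K"
    using assms by (auto simp: nuc_le_def)
  then have "cmod c * cmod (\<Sum>i<n. cinner (A (x i)) (y i)) \<le> cmod c * (C * K)"
    by (intro mult_left_mono) auto
  then show "cmod (\<Sum>i<n. cinner ((c *\<^sub>C A) (x i)) (y i)) \<le> C * (cmod c * K)"
    by (simp add: scaleC_blinfun.rep_eq cinner_scaleC_left norm_mult mult_ac flip: sum_distrib_left)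
qed

lemma nuc_le_zero: "nuc_le 0 0"
  by (simp add: nuc_le_def)

lemma nuc_le_sum:
  assumes "\<And>i. i \<in> I \<Longrightarrow> nuc_le (A i) (K i)"
  shows "nuc_le (\<Sum>i\<in>I. A i) (\<Sum>i\<in>I. K i)"
  using assms by (induction I rule: infinite_finite_induct) (auto intro: nuc_le_zero nuc_le_add)

text \<open>Summing over the test family first, the contribution of one term of the expansion is the
  form in \<open>family_bound\<close> at z = a g, w = b g, hence at most \<open>C\<close> times the
  product of the norms of a g and b g.\<close>

lemma nuc_le_nuclear:
  fixes A :: "'a::complex_inner \<Rightarrow>\<^sub>L 'a"
  assumes ex: "\<And>x y. ((\<lambda>g. cinner x (b g) * cinner (a g) y) has_sum cinner (A x) y) G"
    and K: "((\<lambda>g. norm (a g) * norm (b g)) has_sum K) G"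
  shows "nuc_le A K"
  unfolding nuc_le_def
proof safe
  fix n :: nat and x y :: "nat \<Rightarrow> 'a" and C assume f: "family_bound {..<n} x y C"
  show "cmod (\<Sum>i<n. cinner (A (x i)) (y i)) \<le> C * K"
  proof (rule norm_infsum_le)
    show "((\<lambda>g. \<Sum>i<n. cinner (x i) (b g) * cinner (a g) (y i)) has_sum (\<Sum>i<n. cinner (A (x i)) (y i))) G"
      by (intro has_sum_finite_sum ex)
    show "((\<lambda>g. C * (norm (a g) * norm (b g))) has_sum C * K) G"
      by (intro has_sum_cmult_right K)
    show "cmod (\<Sum>i<n. cinner (x i) (b g) * cinner (a g) (y i)) \<le> C * (norm (a g) * norm (b g))" for g
      using f[unfolded family_bound_def, THEN conjunct2, rule_format, of "a g" "b g"]
      by (simp add: mult_ac)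
  qed
qed

lemma nuc_le_rank_one: "nuc_le (rank_one x y) (norm x * norm y)"
  by (rule nuc_le_nuclear[where G = "{()}" and a = "\<lambda>_. x" and b = "\<lambda>_. y"])
    (auto simp: has_sum_finite_iff rank_one.rep_eq cinner_scaleC_left)

lemma sum_mult_le_l2:
  fixes u v :: "'i \<Rightarrow> real"
  assumes "(\<Sum>i\<in>I. (u i)\<^sup>2) \<le> U\<^sup>2" "(\<Sum>i\<in>I. (v i)\<^sup>2) \<le> V\<^sup>2" "U \<ge> 0" "V \<ge> 0"
  shows "(\<Sum>i\<in>I. \<bar>u i\<bar> * \<bar>v i\<bar>) \<le> U * V"
proof -
  have "L2_set u I \<le> U" "L2_set v I \<le> V"
    using assms by (auto simp: L2_set_def intro: real_le_lsqrt)
  then show ?thesis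
    using L2_set_mult_ineq[of u v I] mult_mono[of "L2_set u I" U "L2_set v I" V] assms(3)
    by (simp add: L2_set_nonneg)
qed

subsection \<open>Trace class operators\<close>

text \<open>With the root S of \<open>B\<close>, <B e, e> is the squared norm of S e. So the trace
  is the Hilbert-Schmidt sum of S, which does not depend on the basis.\<close>

lemma psd_trace_has_sum:
  assumes B: "psd_op B" and E: "is_onb E" and F: "is_onb F"
    and K: "((\<lambda>e. Re (cinner (B e) e)) has_sum K) E"
  shows "((\<lambda>e. Re (cinner (B e) e)) has_sum K) F"
proof -
  obtain S where S: "psd_op S" "S o\<^sub>L S = B" using psd_sqrt_exists[OF B] by metis
  have n: "Re (cinner (B e) e) = (norm (S e))\<^sup>2" for e
    unfolding S(2)[symmetric] by (simp add: psd_op_selfadjoint[OF S(1)] norm_sq_cinner)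
  show ?thesis
    using hilbert_schmidt_adjoint[OF psd_opD(1)[OF S(1)] E F] K
    by (simp add: n psd_op_cadjoint[OF S(1)])
qed

lemma trace_class_has_sum:
  assumes A: "A \<in> trace_class" and E: "is_onb E"
  shows "((\<lambda>e. Re (cinner (abs_op A e) e)) has_sum trace_norm A) E"
proof -
  have B: "psd_op (abs_op A)" using A by (intro abs_op_works) (simp add: trace_class_def)
  have "((\<lambda>e. cinner (abs_op A e) e) has_sum trace_op (abs_op A)) some_onb"
    using A unfolding trace_op_def trace_class_def by (intro has_sum_infsum) simp
  then have "((\<lambda>e. Re (cinner (abs_op A e) e)) has_sum trace_norm A) some_onb"
    unfolding trace_norm_def using A by (auto dest: has_sum_Re)
  then show ?thesis using psd_trace_has_sum[OF B is_onb_some_onb E] by blast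
qed

lemma psd_trace_class_has_sum:
  assumes A: "A \<in> psd_trace_class" and E: "is_onb E"
  shows "((\<lambda>e. Re (cinner (A e) e)) has_sum trace_norm A) E" "trace_op A = of_real (trace_norm A)"
proof -
  have t: "A \<in> trace_class" "psd_op A" using A by (auto simp: psd_trace_class_def)
  have *: "((\<lambda>e. Re (cinner (A e) e)) has_sum trace_norm A) E" if E: "is_onb E" for E
    using trace_class_has_sum[OF t(1) E] by (simp add: abs_op_psd[OF t(2)])
  then show "((\<lambda>e. Re (cinner (A e) e)) has_sum trace_norm A) E" using E by blast
  have "((\<lambda>e. cinner (A e) e) has_sum of_real (trace_norm A)) some_onb"
    using has_sum_of_real[OF *[OF is_onb_some_onb], where 'a = complex]
    by (simp flip: psd_opD(4)[OF t(2)])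
  then show "trace_op A = of_real (trace_norm A)"
    unfolding trace_op_def by (rule infsumI)
qed

text \<open>With \<open>S = |A|\<^sup>1\<^sup>/\<^sup>2\<close> and a polar decomposition \<open>A = U |A|\<close>, take \<open>a\<^sub>g = U S g\<close> and \<open>b\<^sub>g = S g\<close>.\<close>

lemma trace_class_nuclear:
  fixes A :: "'a::chilbert_space \<Rightarrow>\<^sub>L 'a"
  assumes A: "A \<in> trace_class"
  obtains a b :: "'a \<Rightarrow> 'a" and K where "\<And>x y. ((\<lambda>g. cinner x (b g) * cinner (a g) y) has_sum cinner (A x) y) some_onb"
    "((\<lambda>g. norm (a g) * norm (b g)) has_sum K) some_onb" "K \<le> trace_norm A"
proof -
  have Acl: "clinear_op A" using A by (simp add: trace_class_def)
  note ab = abs_op_works[OF Acl]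
  obtain S where S: "psd_op S" "S o\<^sub>L S = abs_op A" using psd_sqrt_exists[OF ab(1)] by metis
  obtain U where U: "clinear_op U" "norm U \<le> 1" "A = U o\<^sub>L abs_op A"
    using douglas_factorization[OF psd_opD(1)[OF ab(1)] Acl] ab(3) by (metis order_refl)
  have n: "Re (cinner (abs_op A e) e) = (norm (S e))\<^sup>2" for e
    unfolding S(2)[symmetric] by (simp add: psd_op_selfadjoint[OF S(1)] norm_sq_cinner)
  have sum: "((\<lambda>g. (norm (S g))\<^sup>2) has_sum trace_norm A) some_onb"
    using trace_class_has_sum[OF A is_onb_some_onb] by (simp add: n)
  have le: "norm (U (S g)) * norm (S g) \<le> (norm (S g))\<^sup>2" for g
    using norm_contraction_le[OF U(2), of "S g"] by (simp add: power2_eq_square mult_right_mono)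
  have "(\<lambda>g. norm (U (S g)) * norm (S g)) summable_on some_onb"
    by (rule summable_on_comparison_test[of "\<lambda>g. (norm (S g))\<^sup>2"])
      (use sum le in \<open>auto simp: has_sum_imp_summable\<close>)
  then obtain K where K: "((\<lambda>g. norm (U (S g)) * norm (S g)) has_sum K) some_onb"
    by (auto simp: summable_on_def)
  have "K \<le> trace_norm A" by (rule has_sum_mono[OF K sum]) (rule le)
  moreover have "((\<lambda>g. cinner x (S g) * cinner (U (S g)) y) has_sum cinner (A x) y) some_onb" for x y
  proof -
    have "A x = U (S (S x))" by (metis U(3) S(2) blinfun_apply_blinfun_compose)
    then have "cinner (A x) y = cinner (S x) (S (cadjoint U y))"
      by (simp add: cadjoint_works(2)[OF U(1)] psd_op_selfadjoint[OF S(1)])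
    then show ?thesis
      using parseval[OF is_onb_some_onb, of "S x" "S (cadjoint U y)"]
      by (simp add: cadjoint_works(2)[OF U(1)] psd_op_selfadjoint[OF S(1)])
  qed
  ultimately show thesis using that[of "\<lambda>g. S g" "\<lambda>g. U (S g)"] K by blast
qed

lemma nuc_le_mono: "nuc_le A K \<Longrightarrow> K \<le> L \<Longrightarrow> nuc_le A L"
  unfolding nuc_le_def family_bound_def by (meson mult_left_mono order_trans)

lemma nuc_le_trace_norm:
  fixes A :: "'a::chilbert_space \<Rightarrow>\<^sub>L 'a"
  assumes A: "A \<in> trace_class"
  shows "nuc_le A (trace_norm A)"
proof (rule trace_class_nuclear[OF A])
  fix a b :: "'a \<Rightarrow> 'a" and K
  assume ab: "\<And>x y. ((\<lambda>g. cinner x (b g) * cinner (a g) y) has_sum cinner (A x) y) some_onb"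
    "((\<lambda>g. norm (a g) * norm (b g)) has_sum K) some_onb" and K: "K \<le> trace_norm A"
  from nuc_le_nuclear[OF ab] show ?thesis using K by (rule nuc_le_mono)
qed

text \<open>Converse half of the duality. Write |A| = V A with a contraction V. For a finite
  orthonormal F, the sum of <|A| e, e> is the test of \<open>A\<close> on the family of pairs e, V*
  e, whose operator is V followed by the projection onto the span of F, again a contraction. So
  every finite part of the trace of |A| is at most \<open>K\<close>.\<close>

lemma nuc_le_trace_class:
  assumes A: "clinear_op A" and K: "nuc_le A K"
  shows "A \<in> trace_class" "trace_norm A \<le> K"
proof -
  note ab = abs_op_works[OF A]
  define B where "B = abs_op A"
  obtain V where V: "clinear_op V" "norm V \<le> 1" "B = V o\<^sub>L A"
    using douglas_factorization[OF A psd_opD(1)[OF ab(1)]] ab(3) unfolding B_def by (metis order_refl)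
  have psd: "psd_op B" using ab(1) by (simp add: B_def)
  have fin: "(\<Sum>e\<in>F. Re (cinner (B e) e)) \<le> K" if F: "finite F" "F \<subseteq> some_onb" for F
  proof -
    have on: "orthonormal F"
      using is_onb_some_onb F by (auto simp: is_onb_iff intro: orthonormal_subset)
    have "family_bound F (\<lambda>e. e) (cadjoint V) 1"
      unfolding family_bound_def
    proof safe
      fix z w
      have "cmod (\<Sum>e\<in>F. cinner z (cadjoint V e) * cinner e w)
          \<le> (\<Sum>e\<in>F. \<bar>cmod (cinner (V z) e)\<bar> * \<bar>cmod (cinner w e)\<bar>)"
        by (rule sum_norm_le)
          (simp add: norm_mult cadjoint_works(2)[OF V(1)] cmod_cinner_commute)
      also have "\<dots> \<le> norm (V z) * norm w"
        by (rule sum_mult_le_l2) (use bessel_finite(1)[OF on F(1)] in auto)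
      also have "\<dots> \<le> norm z * norm w"
        by (intro mult_right_mono norm_contraction_le V) simp
      finally show "cmod (\<Sum>e\<in>F. cinner z (cadjoint V e) * cinner e w) \<le> 1 * norm z * norm w"
        by simp
    qed simp
    from nuc_leD[OF K F(1) this] have "cmod (\<Sum>e\<in>F. cinner (B e) e) \<le> K"
      by (simp add: V(3) cadjoint_works(2)[OF V(1)])
    then show ?thesis
      using complex_Re_le_cmod[of "\<Sum>e\<in>F. cinner (B e) e"] by simp
  qed
  have "(\<lambda>e. Re (cinner (B e) e)) summable_on some_onb"
    by (rule nonneg_bdd_above_summable_on) (auto intro!: bdd_aboveI[of _ K] fin psd_opD(2)[OF psd])
  then have "(\<lambda>e. complex_of_real (Re (cinner (B e) e))) summable_on some_onb"
    by (rule summable_on_of_real)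
  then have "(\<lambda>e. cinner (B e) e) summable_on some_onb"
    by (simp flip: psd_opD(4)[OF psd])
  then show t: "A \<in> trace_class" using A by (simp add: trace_class_def B_def)
  show "trace_norm A \<le> K"
    using has_sum_le_finite_sums[OF trace_class_has_sum[OF t is_onb_some_onb]] fin
    by (simp add: B_def)
qed

lemma trace_class_clinear: "A \<in> trace_class \<Longrightarrow> clinear_op A"
  by (simp add: trace_class_def)

lemma trace_norm_nonneg: "0 \<le> trace_norm A"
  using nuc_le_nonneg[OF nuc_le_trace_norm, of A] by (cases "A \<in> trace_class") (auto simp: trace_norm_def)

lemma trace_class_add:
  assumes "A \<in> trace_class" "B \<in> trace_class"
  shows "A + B \<in> trace_class" "trace_norm (A + B) \<le> trace_norm A + trace_norm B"
  using nuc_le_trace_class[of "A + B"] nuc_le_add nuc_le_trace_norm assms trace_class_clinear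
    clinear_op_add by metis+

lemma trace_class_scaleC:
  assumes "A \<in> trace_class"
  shows "c *\<^sub>C A \<in> trace_class" "trace_norm (c *\<^sub>C A) \<le> cmod c * trace_norm A"
  using nuc_le_trace_class[of "c *\<^sub>C A"] nuc_le_scaleC nuc_le_trace_norm assms trace_class_clinear
    clinear_op_scaleC by metis+

lemma scaleR_blinfun_scaleC: "r *\<^sub>R A = of_real r *\<^sub>C A" for A :: "'a::real_normed_vector \<Rightarrow>\<^sub>L 'b::complex_inner"
  by (rule scaleR_scaleC)

lemma trace_class_scaleR:
  assumes "A \<in> trace_class"
  shows "r *\<^sub>R A \<in> trace_class"
  using trace_class_scaleC(1)[OF assms] by (simp add: scaleR_scaleC)

lemma trace_class_uminus:
  assumes "A \<in> trace_class"
  shows "- A \<in> trace_class" "trace_norm (- A) \<le> trace_norm A"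
  using trace_class_scaleC[OF assms, of "-1"] scaleR_scaleC[of "-1" A] by auto

lemma trace_class_diff:
  assumes "A \<in> trace_class" "B \<in> trace_class"
  shows "A - B \<in> trace_class" "trace_norm (A - B) \<le> trace_norm A + trace_norm B"
  using trace_class_add[OF assms(1) trace_class_uminus(1)[OF assms(2)]] trace_class_uminus(2)[OF assms(2)]
  by auto

lemma trace_class_zero: "0 \<in> trace_class" "trace_norm 0 = 0"
  using nuc_le_trace_class[OF _ nuc_le_zero] trace_norm_nonneg[of 0] by (auto intro: antisym)

lemma trace_class_sum:
  "(\<And>i. i \<in> I \<Longrightarrow> A i \<in> trace_class) \<Longrightarrow> (\<Sum>i\<in>I. A i) \<in> trace_class"
  by (induction I rule: infinite_finite_induct) (auto intro: trace_class_zero trace_class_add)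

lemma norm_le_trace_norm: "A \<in> trace_class \<Longrightarrow> norm A \<le> trace_norm A"
  by (rule nuc_le_norm[OF nuc_le_trace_norm])

lemma trace_class_rank_one: "rank_one x y \<in> trace_class" "trace_norm (rank_one x y) \<le> norm x * norm y"
  using nuc_le_trace_class[OF clinear_op_rank_one nuc_le_rank_one] by auto

text \<open>What remains is a nuclear expansion over \<open>G - F\<close> whose mass is the tail of
  \<open>K\<close>. This makes finite sums of rank one operators dense and justifies applying
  partial traces term by term.\<close>

lemma nuc_le_nuclear_remainder:
  fixes A :: "'a::complex_inner \<Rightarrow>\<^sub>L 'a"
  assumes ex: "\<And>x y. ((\<lambda>g. cinner x (b g) * cinner (a g) y) has_sum cinner (A x) y) G"
    and K: "((\<lambda>g. norm (a g) * norm (b g)) has_sum K) G" and F: "finite F" "F \<subseteq> G"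
  shows "nuc_le (A - (\<Sum>g\<in>F. rank_one (a g) (b g))) (K - (\<Sum>g\<in>F. norm (a g) * norm (b g)))"
proof (rule nuc_le_nuclear)
  show "((\<lambda>g. norm (a g) * norm (b g)) has_sum K - (\<Sum>g\<in>F. norm (a g) * norm (b g))) (G - F)"
    by (intro has_sum_Diff K F has_sum_finite)
  show "((\<lambda>g. cinner x (b g) * cinner (a g) y) has_sum
      cinner ((A - (\<Sum>g\<in>F. rank_one (a g) (b g))) x) y) (G - F)" for x y
    using has_sum_Diff[OF ex has_sum_finite[OF F(1)] F(2), of x y]
    by (simp add: blinfun.diff_left blinfun.sum_left cinner_diff_left cinner_sum_left
        rank_one.rep_eq cinner_scaleC_left)
qed

lemma trace_class_approx_rank_one:
  fixes A :: "'a::chilbert_space \<Rightarrow>\<^sub>L 'a"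
  assumes A: "A \<in> trace_class" and r: "r > 0"
  obtains a b :: "'a \<Rightarrow> 'a" and F where "finite F" "trace_norm (A - (\<Sum>g\<in>F. rank_one (a g) (b g))) < r"
proof (rule trace_class_nuclear[OF A])
  fix a b :: "'a \<Rightarrow> 'a" and K
  assume ex: "\<And>x y. ((\<lambda>g. cinner x (b g) * cinner (a g) y) has_sum cinner (A x) y) some_onb"
    and K: "((\<lambda>g. norm (a g) * norm (b g)) has_sum K) some_onb"
  have r2: "0 < r / 2" using r by simp
  obtain F where F: "finite F" "F \<subseteq> some_onb" "dist (\<Sum>g\<in>F. norm (a g) * norm (b g)) K \<le> r / 2"
    using has_sum_finite_approximation[OF K r2] by blast
  have "nuc_le (A - (\<Sum>g\<in>F. rank_one (a g) (b g))) (K - (\<Sum>g\<in>F. norm (a g) * norm (b g)))"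
    by (rule nuc_le_nuclear_remainder[OF ex K F(1,2)])
  moreover have "clinear_op (A - (\<Sum>g\<in>F. rank_one (a g) (b g)))"
    by (intro trace_class_clinear trace_class_diff A trace_class_sum trace_class_rank_one)
  ultimately have "trace_norm (A - (\<Sum>g\<in>F. rank_one (a g) (b g))) \<le> K - (\<Sum>g\<in>F. norm (a g) * norm (b g))"
    by (intro nuc_le_trace_class)
  also have "\<dots> \<le> r / 2" using F(3) unfolding dist_real_def by arith
  also have "\<dots> < r" using r by simp
  finally show thesis using that F(1) by blast
qed

text \<open>Lower semicontinuity of the trace norm turns Cauchy sequences into convergent ones.\<close>

lemma trace_norm_Cauchy_convergent:
  fixes A :: "nat \<Rightarrow> 'a::chilbert_space \<Rightarrow>\<^sub>L 'a"
  assumes tc: "\<And>n. A n \<in> trace_class"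
    and cau: "\<And>r. r > 0 \<Longrightarrow> \<exists>N. \<forall>m\<ge>N. \<forall>n\<ge>N. trace_norm (A m - A n) < r"
  obtains L where "L \<in> trace_class" "A \<longlonglongrightarrow> L" "(\<lambda>n. trace_norm (A n - L)) \<longlonglongrightarrow> 0"
proof -
  have "Cauchy A"
    using cau norm_le_trace_norm[OF trace_class_diff(1)[OF tc tc]]
    unfolding Cauchy_def dist_norm by (meson order_le_less_trans)
  then obtain L where L: "A \<longlonglongrightarrow> L" using Cauchy_convergent_iff convergent_def by blast
  have cl: "clinear_op L" by (rule clinear_op_lim[OF _ L]) (auto intro: trace_class_clinear tc)
  \<comment> \<open>Fix \<open>m\<close> and a test family and let n tend to infinity. Convergence
    in operator norm is enough here, because a test family is finite.\<close>
  have dl: "A m - L \<in> trace_class \<and> trace_norm (A m - L) \<le> r"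
    if N: "\<forall>m\<ge>N. \<forall>n\<ge>N. trace_norm (A m - A n) < r" and m: "m \<ge> N" for r N m
  proof -
    have "nuc_le (A m - L) r"
      unfolding nuc_le_def
    proof safe
      fix k :: nat and x y :: "nat \<Rightarrow> 'a" and C assume f: "family_bound {..<k} x y C"
      have "(\<lambda>n. cmod (\<Sum>i<k. cinner ((A m - A n) (x i)) (y i)))
          \<longlonglongrightarrow> cmod (\<Sum>i<k. cinner ((A m - L) (x i)) (y i))"
        by (intro tendsto_norm tendsto_sum tendsto_cinner tendsto_intros L)
      moreover have "cmod (\<Sum>i<k. cinner ((A m - A n) (x i)) (y i)) \<le> C * r" if "n \<ge> N" for n
      proof -
        have "nuc_le (A m - A n) r"
          by (rule nuc_le_mono[OF nuc_le_trace_norm[OF trace_class_diff(1)[OF tc tc]]])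
            (use N m that in \<open>auto intro: less_imp_le\<close>)
        then show ?thesis using f by (simp add: nuc_le_def)
      qed
      ultimately show "cmod (\<Sum>i<k. cinner ((A m - L) (x i)) (y i)) \<le> C * r"
        by (intro LIMSEQ_le_const2) auto
    qed
    moreover have "clinear_op (A m - L)" by (intro clinear_op_diff cl trace_class_clinear tc)
    ultimately show ?thesis using nuc_le_trace_class by blast
  qed
  obtain N where "\<forall>m\<ge>N. \<forall>n\<ge>N. trace_norm (A m - A n) < 1" using cau[of 1] by auto
  then have "A N - L \<in> trace_class" using dl by blast
  then have "L \<in> trace_class" using trace_class_diff(1)[OF tc[of N]] by fastforce
  moreover have "(\<lambda>n. trace_norm (A n - L)) \<longlonglongrightarrow> 0"
  proof (rule LIMSEQ_I)
    fix r :: real assume r: "r > 0"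
    obtain N where N: "\<forall>m\<ge>N. \<forall>n\<ge>N. trace_norm (A m - A n) < r / 2" using cau[of "r / 2"] r by auto
    have "norm (trace_norm (A n - L) - 0) < r" if "n \<ge> N" for n
      using dl[OF N that] r trace_norm_nonneg[of "A n - L"] by auto
    then show "\<exists>N. \<forall>n\<ge>N. norm (trace_norm (A n - L) - 0) < r" by blast
  qed
  ultimately show thesis using that L by blast
qed

subsection \<open>Slices of the tensor product\<close>

lemma hilbert_tensor_productD:
  assumes "is_hilbert_tensor_product t"
  shows "t (x + x') y = t x y + t x' y" "t x (y + y') = t x y + t x y'"
    "t (c *\<^sub>C x) y = c *\<^sub>C t x y" "t x (c *\<^sub>C y) = c *\<^sub>C t x y"
    "cinner (t x y) (t u v) = cinner x u * cinner y v" "closure (cspan {t x y | x y. True}) = UNIV"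
  using assms unfolding is_hilbert_tensor_product_def by blast+

lemma hilbert_tensor_product_swap:
  assumes "is_hilbert_tensor_product t"
  shows "is_hilbert_tensor_product (\<lambda>y x. t x y)"
proof -
  have "{t x y |y x. True} = {t x y |x y. True}" by blast
  then show ?thesis
    using hilbert_tensor_productD[OF assms] unfolding is_hilbert_tensor_product_def
    by (simp add: mult.commute)
qed

lemma norm_tensor:
  assumes "is_hilbert_tensor_product t"
  shows "norm (t x y) = norm x * norm y"
proof -
  have "complex_of_real ((norm (t x y))\<^sup>2) = of_real ((norm x * norm y)\<^sup>2)"
    by (simp only: cinner_self[symmetric] hilbert_tensor_productD(5)[OF assms] power_mult_distrib of_real_mult)
  then have "(norm (t x y))\<^sup>2 = (norm x * norm y)\<^sup>2" by (simp only: of_real_eq_iff)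
  then show ?thesis by simp
qed

text \<open>The adjoint of this operator sends z to its slice along \<open>x\<close>, that is, the
  partial inner product of z with \<open>x\<close>.\<close>

definition tensor_op :: "('a::chilbert_space \<Rightarrow> 'b::chilbert_space \<Rightarrow> 'c::chilbert_space) \<Rightarrow> 'a \<Rightarrow> 'b \<Rightarrow>\<^sub>L 'c" where
  "tensor_op t x = Blinfun (t x)"

lemma tensor_op:
  assumes T: "is_hilbert_tensor_product t"
  shows "tensor_op t x y = t x y" "clinear_op (tensor_op t x)"
proof -
  note D = hilbert_tensor_productD[OF T]
  have "bounded_linear (t x)"
    by (rule bounded_linear_intro[where K = "norm x"])
      (simp_all add: D scaleR_scaleC norm_tensor[OF T] mult.commute)
  then have *: "blinfun_apply (tensor_op t x) = t x"
    unfolding tensor_op_def by (rule bounded_linear_Blinfun_apply)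
  show "tensor_op t x y = t x y" "clinear_op (tensor_op t x)"
    by (simp_all add: * clinear_op_def D)
qed

lemma cinner_slice:
  assumes T: "is_hilbert_tensor_product t"
  shows "cinner z (t x y) = cinner (cadjoint (tensor_op t x) z) y"
    "cinner (t x y) z = cinner y (cadjoint (tensor_op t x) z)"
  using cadjoint_works(2,3)[OF tensor_op(2)[OF T, of x]] by (simp_all add: tensor_op(1)[OF T])

text \<open>The vector s is the projection of \<open>z\<close> onto span E tensor the second space.
  Both <z, s> and <s, s> equal the sum of squares, so Cauchy-Schwarz bounds the norm of s by that of
  \<open>z\<close>.\<close>

lemma slice_bessel:
  assumes T: "is_hilbert_tensor_product t" and E: "orthonormal E" "finite E"
  shows "(\<Sum>e\<in>E. (norm (cadjoint (tensor_op t e) z))\<^sup>2) \<le> (norm z)\<^sup>2"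
proof -
  let ?k = "\<lambda>e. cadjoint (tensor_op t e) z"
  define s where "s = (\<Sum>e\<in>E. t e (?k e))"
  define q where "q = (\<Sum>e\<in>E. (norm (?k e))\<^sup>2)"
  have "cinner z s = (\<Sum>e\<in>E. cinner (?k e) (?k e))"
    by (simp add: s_def cinner_sum_right cinner_slice(1)[OF T])
  then have zs: "cinner z s = of_real q" by (simp add: q_def cinner_self)
  have "cinner s s = (\<Sum>e\<in>E. \<Sum>f\<in>E. cinner f e * cinner (?k f) (?k e))"
    by (simp add: s_def cinner_sum_right cinner_sum_left hilbert_tensor_productD(5)[OF T])
  also have "\<dots> = (\<Sum>e\<in>E. \<Sum>f\<in>E. if f = e then cinner (?k e) (?k e) else 0)"
    by (intro sum.cong refl) (auto simp: orthonormal_cinner[OF E(1)])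
  also have "\<dots> = of_real q" using E(2) by (simp add: q_def cinner_self)
  finally have ss: "(norm s)\<^sup>2 = q" by (simp add: norm_sq_cinner)
  have "(norm s)\<^sup>2 \<le> norm z * norm s"
    using cmod_cinner_le[of z s] by (simp add: zs ss)
  then have "norm s \<le> norm z"
    by (cases "norm s = 0") (auto simp: power2_eq_square mult_le_cancel_right)
  then have "(norm s)\<^sup>2 \<le> (norm z)\<^sup>2" by (rule power_mono) simp
  then show ?thesis by (simp only: ss q_def)
qed

text \<open>The operator of the new family is the tensor product of the diagonal contraction with
  entries \<open>c e\<close> on span E and the operator of the old family. Slicing reduces the
  estimate to the old bound for each e, and \<open>slice_bessel\<close> adds up the slices.\<close>

lemma family_bound_slice:
  assumes T: "is_hilbert_tensor_product t" and E: "orthonormal E" "finite E"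
    and f: "family_bound I x y C" and c: "\<And>e. cmod (c e) \<le> 1"
  shows "family_bound (E \<times> I) (\<lambda>(e, i). c e *\<^sub>C t e (x i)) (\<lambda>(e, i). t e (y i)) C"
  unfolding family_bound_def
proof safe
  show C: "C \<ge> 0" using f by (simp add: family_bound_def)
  fix z w
  let ?k = "\<lambda>e. cadjoint (tensor_op t e)"
  have "cmod (\<Sum>p\<in>E \<times> I. cinner z (case p of (e, i) \<Rightarrow> t e (y i)) *
      cinner (case p of (e, i) \<Rightarrow> c e *\<^sub>C t e (x i)) w) =
    cmod (\<Sum>e\<in>E. c e * (\<Sum>i\<in>I. cinner (?k e z) (y i) * cinner (x i) (?k e w)))"
    by (subst sum.cartesian_product')
      (simp add: cinner_scaleC_left cinner_slice[OF T] sum_distrib_left mult_ac)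
  also have "\<dots> \<le> (\<Sum>e\<in>E. C * (\<bar>norm (?k e z)\<bar> * \<bar>norm (?k e w)\<bar>))"
  proof (rule sum_norm_le)
    fix e
    have "cmod (\<Sum>i\<in>I. cinner (?k e z) (y i) * cinner (x i) (?k e w)) \<le> C * norm (?k e z) * norm (?k e w)"
      using f by (simp add: family_bound_def)
    then have "cmod (c e) * cmod (\<Sum>i\<in>I. cinner (?k e z) (y i) * cinner (x i) (?k e w))
        \<le> 1 * (C * norm (?k e z) * norm (?k e w))"
      by (intro mult_mono c) auto
    then show "cmod (c e * (\<Sum>i\<in>I. cinner (?k e z) (y i) * cinner (x i) (?k e w)))
        \<le> C * (\<bar>norm (?k e z)\<bar> * \<bar>norm (?k e w)\<bar>)"
      by (simp add: norm_mult mult.assoc)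
  qed
  also have "\<dots> = C * (\<Sum>e\<in>E. \<bar>norm (?k e z)\<bar> * \<bar>norm (?k e w)\<bar>)"
    by (simp add: sum_distrib_left)
  also have "\<dots> \<le> C * (norm z * norm w)"
    by (intro mult_left_mono C sum_mult_le_l2 slice_bessel[OF T E]) auto
  finally show "cmod (\<Sum>p\<in>E \<times> I. cinner z (case p of (e, i) \<Rightarrow> t e (y i)) *
      cinner (case p of (e, i) \<Rightarrow> c e *\<^sub>C t e (x i)) w) \<le> C * norm z * norm w"
    by (simp add: mult.assoc)
qed

text \<open>Weighting each slice by the conjugate phase of its value turns the test sum into a sum
  of absolute values. One-element families then give absolute convergence of the series for the
  partial trace, general families its trace norm bound.\<close>

lemma slice_sum_bound:
  fixes t :: "'a::chilbert_space \<Rightarrow> 'b::chilbert_space \<Rightarrow> 'c::chilbert_space"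
  assumes T: "is_hilbert_tensor_product t" and E: "orthonormal E" "finite E"
    and A: "clinear_op A" "nuc_le A K" and f: "finite I" "family_bound I x y C"
  shows "(\<Sum>e\<in>E. cmod (\<Sum>i\<in>I. cinner (A (t e (x i))) (t e (y i)))) \<le> C * K"
proof -
  define S where "S e = (\<Sum>i\<in>I. cinner (A (t e (x i))) (t e (y i)))" for e
  define c where "c e = cnj (sgn (S e))" for e
  have c1: "cmod (c e) \<le> 1" for e by (simp add: c_def norm_sgn)
  have cS: "c e * S e = of_real (cmod (S e))" for e
  proof (cases "S e = 0")
    case False
    have "c e * S e = (S e * cnj (S e)) / of_real (cmod (S e))"
      by (simp add: c_def sgn_eq)
    also have "\<dots> = of_real (cmod (S e))"
      using False by (simp add: complex_norm_square[symmetric] power2_eq_square)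
    finally show ?thesis .
  qed simp
  have "(\<Sum>p\<in>E \<times> I. cinner (A (case p of (e, i) \<Rightarrow> c e *\<^sub>C t e (x i))) (case p of (e, i) \<Rightarrow> t e (y i)))
      = (\<Sum>e\<in>E. c e * S e)"
    unfolding S_def
    by (subst sum.cartesian_product') (simp add: clinear_opD[OF A(1)] cinner_scaleC_left sum_distrib_left)
  also have "\<dots> = of_real (\<Sum>e\<in>E. cmod (S e))" by (simp add: cS)
  finally have eq: "(\<Sum>p\<in>E \<times> I. cinner (A (case p of (e, i) \<Rightarrow> c e *\<^sub>C t e (x i)))
      (case p of (e, i) \<Rightarrow> t e (y i))) = complex_of_real (\<Sum>e\<in>E. cmod (S e))" .
  have "cmod (complex_of_real (\<Sum>e\<in>E. cmod (S e))) \<le> C * K"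
    unfolding eq[symmetric] by (rule nuc_leD[OF A(2) _ family_bound_slice[OF T E f(2) c1]]) (use E f in simp)
  then show ?thesis unfolding S_def[symmetric] norm_of_real by linarith
qed

subsection \<open>The partial trace\<close>

text \<open>The series defines a bounded sesquilinear form, hence an operator by Riesz. A test of
  this operator is a limit of sums of slice tests of \<open>A\<close>, so contractivity in the trace
  norm is inherited from \<open>slice_sum_bound\<close>.\<close>

lemma slice_form:
  fixes t :: "'a::chilbert_space \<Rightarrow> 'b::chilbert_space \<Rightarrow> 'c::chilbert_space"
  assumes T: "is_hilbert_tensor_product t" and E: "is_onb E" and A: "A \<in> trace_class"
  obtains P where "P \<in> trace_class" "trace_norm P \<le> trace_norm A"
    "\<And>y v. ((\<lambda>e. cinner (A (t e y)) (t e v)) has_sum cinner (P y) v) E"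
proof -
  note D = hilbert_tensor_productD[OF T]
  have Acl: "clinear_op A" and K: "nuc_le A (trace_norm A)"
    using A by (auto intro: trace_class_clinear nuc_le_trace_norm)
  have on: "orthonormal F" if "F \<subseteq> E" for F
    using E that by (auto simp: is_onb_iff intro: orthonormal_subset)
  define h where "h y v = (\<Sum>\<^sub>\<infinity>e\<in>E. cinner (A (t e y)) (t e v))" for y v
  have fin: "(\<Sum>e\<in>F. cmod (cinner (A (t e y)) (t e v))) \<le> norm y * norm v * trace_norm A"
    if "finite F" "F \<subseteq> E" for F y v
    using slice_sum_bound[OF T on[OF that(2)] that(1) Acl K _ family_bound_single[of "()" "\<lambda>_. y" "\<lambda>_. v"]]
    by simp
  have asum: "(\<lambda>e. cmod (cinner (A (t e y)) (t e v))) summable_on E" for y v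
    by (rule nonneg_bdd_above_summable_on)
      (auto intro!: bdd_aboveI[of _ "norm y * norm v * trace_norm A"] fin)
  have hs: "((\<lambda>e. cinner (A (t e y)) (t e v)) has_sum h y v) E" for y v
    unfolding h_def by (rule has_sum_infsum[OF abs_summable_summable[OF asum]])
  have hb: "cmod (h y v) \<le> trace_norm A * norm y * norm v" for y v
  proof -
    have "cmod (h y v) \<le> (\<Sum>\<^sub>\<infinity>e\<in>E. cmod (cinner (A (t e y)) (t e v)))"
      by (rule norm_infsum_le[OF hs]) (use asum in auto)
    also have "\<dots> \<le> norm y * norm v * trace_norm A"
      by (rule infsum_le_finite_sums[OF asum]) (rule fin)
    finally show ?thesis by (simp add: mult_ac)
  qed
  obtain P where P: "clinear_op P" "\<And>y v. h y v = cinner (P y) v"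
  proof (rule riesz_form[of h, OF _ _ _ _ hb])
    show "h (y + y') v = h y v + h y' v" for y y' v
      by (rule has_sum_unique[OF hs]) (use has_sum_add[OF hs[of y v] hs[of y' v]] in
        \<open>simp add: D blinfun.add_right cinner_add_left\<close>)
    show "h y (v + v') = h y v + h y v'" for y v v'
      by (rule has_sum_unique[OF hs]) (use has_sum_add[OF hs[of y v] hs[of y v']] in
        \<open>simp add: D cinner_add_right\<close>)
    show "h (c *\<^sub>C y) v = c * h y v" for c y v
      by (rule has_sum_unique[OF hs]) (use has_sum_cmult_right[OF hs[of y v], of c] in
        \<open>simp add: D clinear_opD[OF Acl] cinner_scaleC_left\<close>)
    show "h y (c *\<^sub>C v) = cnj c * h y v" for c y v
      by (rule has_sum_unique[OF hs]) (use has_sum_cmult_right[OF hs[of y v], of "cnj c"] in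
        \<open>simp add: D cinner_scaleC_right\<close>)
  qed auto
  have hs': "((\<lambda>e. cinner (A (t e y)) (t e v)) has_sum cinner (P y) v) E" for y v
    using hs P(2) by simp
  have "nuc_le P (trace_norm A)"
    unfolding nuc_le_def
  proof safe
    fix n :: nat and x y :: "nat \<Rightarrow> 'b" and C assume f: "family_bound {..<n} x y C"
    have "((\<lambda>e. \<Sum>i<n. cinner (A (t e (x i))) (t e (y i))) has_sum (\<Sum>i<n. cinner (P (x i)) (y i))) E"
      by (intro has_sum_finite_sum hs')
    then have lim: "((\<lambda>F. cmod (\<Sum>e\<in>F. \<Sum>i<n. cinner (A (t e (x i))) (t e (y i)))) \<longlongrightarrow>
        cmod (\<Sum>i<n. cinner (P (x i)) (y i))) (finite_subsets_at_top E)"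
      unfolding has_sum_def by (rule tendsto_norm)
    show "cmod (\<Sum>i<n. cinner (P (x i)) (y i)) \<le> C * trace_norm A"
    proof (rule tendsto_upperbound[OF lim])
      show "\<forall>\<^sub>F F in finite_subsets_at_top E.
          cmod (\<Sum>e\<in>F. \<Sum>i<n. cinner (A (t e (x i))) (t e (y i))) \<le> C * trace_norm A"
      proof (rule eventually_finite_subsets_at_top_weakI)
        fix F assume F: "finite F" "F \<subseteq> E"
        show "cmod (\<Sum>e\<in>F. \<Sum>i<n. cinner (A (t e (x i))) (t e (y i))) \<le> C * trace_norm A"
          using norm_sum[of "\<lambda>e. \<Sum>i<n. cinner (A (t e (x i))) (t e (y i))" F]
            slice_sum_bound[OF T on[OF F(2)] F(1) Acl K _ f] by simp
      qed
    qed simp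
  qed
  with P(1) have "P \<in> trace_class" "trace_norm P \<le> trace_norm A"
    by (auto intro: nuc_le_trace_class)
  then show thesis using that hs' by blast
qed

text \<open>\<open>Tr\<^sub>1 A = \<Sum>\<^sub>e (e \<otimes> \<cdot>)\<^sup>* A (e \<otimes> \<cdot>)\<close> over an orthonormal basis.\<close>

definition slice_trace ::
    "('a::chilbert_space \<Rightarrow> 'b::chilbert_space \<Rightarrow> 'c::chilbert_space) \<Rightarrow> ('c \<Rightarrow>\<^sub>L 'c) \<Rightarrow> ('b \<Rightarrow>\<^sub>L 'b)" where
  "slice_trace t = (\<lambda>A\<in>trace_class. THE P. P \<in> trace_class \<and> trace_norm P \<le> trace_norm A \<and>
    (\<forall>y v. ((\<lambda>e. cinner (A (t e y)) (t e v)) has_sum cinner (P y) v) some_onb))"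

lemma slice_trace_unique:
  fixes t :: "'a \<Rightarrow> 'b::chilbert_space \<Rightarrow> 'c::chilbert_space" and P Q :: "'b \<Rightarrow>\<^sub>L 'b"
  assumes "\<And>y v. ((\<lambda>e. cinner (A (t e y)) (t e v)) has_sum cinner (P y) v) E"
    "\<And>y v. ((\<lambda>e. cinner (A (t e y)) (t e v)) has_sum cinner (Q y) v) E"
  shows "P = Q"
  by (rule blinfun_ext_cinner) (rule has_sum_unique[OF assms])

lemma slice_trace_works:
  fixes t :: "'a::chilbert_space \<Rightarrow> 'b::chilbert_space \<Rightarrow> 'c::chilbert_space"
  assumes T: "is_hilbert_tensor_product t" and A: "A \<in> trace_class"
  shows "slice_trace t A \<in> trace_class" "trace_norm (slice_trace t A) \<le> trace_norm A"
    "((\<lambda>e. cinner (A (t e y)) (t e v)) has_sum cinner (slice_trace t A y) v) some_onb"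
proof -
  let ?P = "\<lambda>P. P \<in> trace_class \<and> trace_norm P \<le> trace_norm A \<and>
    (\<forall>y v. ((\<lambda>e. cinner (A (t e y)) (t e v)) has_sum cinner (P y) v) some_onb)"
  have "\<exists>P. ?P P"
    by (rule slice_form[OF T is_onb_some_onb A]) blast
  then have "\<exists>!P. ?P P"
  proof (rule ex_ex1I)
    fix P Q assume "?P P" "?P Q"
    then show "P = Q" by (intro slice_trace_unique[where E = some_onb]) auto
  qed
  then have "?P (THE P. ?P P)" by (rule theI')
  then have "?P (slice_trace t A)" using A by (simp add: slice_trace_def)
  then show "slice_trace t A \<in> trace_class" "trace_norm (slice_trace t A) \<le> trace_norm A"
    "((\<lambda>e. cinner (A (t e y)) (t e v)) has_sum cinner (slice_trace t A y) v) some_onb" by auto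
qed

lemma slice_trace_add:
  assumes T: "is_hilbert_tensor_product t" and A: "A \<in> trace_class" and B: "B \<in> trace_class"
  shows "slice_trace t (A + B) = slice_trace t A + slice_trace t B"
proof (rule slice_trace_unique[OF slice_trace_works(3)[OF T trace_class_add(1)[OF A B]]])
  show "((\<lambda>e. cinner ((A + B) (t e y)) (t e v)) has_sum
      cinner ((slice_trace t A + slice_trace t B) y) v) some_onb" for y v
    using has_sum_add[OF slice_trace_works(3)[OF T A] slice_trace_works(3)[OF T B]]
    by (simp add: blinfun.add_left cinner_add_left)
qed

lemma slice_trace_scaleC:
  assumes T: "is_hilbert_tensor_product t" and A: "A \<in> trace_class"
  shows "slice_trace t (c *\<^sub>C A) = c *\<^sub>C slice_trace t A"
proof (rule slice_trace_unique[OF slice_trace_works(3)[OF T trace_class_scaleC(1)[OF A]]])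
  show "((\<lambda>e. cinner ((c *\<^sub>C A) (t e y)) (t e v)) has_sum
      cinner ((c *\<^sub>C slice_trace t A) y) v) some_onb" for y v
    using has_sum_cmult_right[OF slice_trace_works(3)[OF T A], of c]
    by (simp add: scaleC_blinfun.rep_eq cinner_scaleC_left)
qed

lemma slice_trace_rank_one:
  assumes T: "is_hilbert_tensor_product t"
  shows "slice_trace t (rank_one (t x y) (t u v)) = cinner x u *\<^sub>C rank_one y v"
proof (rule slice_trace_unique[OF slice_trace_works(3)[OF T trace_class_rank_one(1)]])
  show "((\<lambda>e. cinner (rank_one (t x y) (t u v) (t e y')) (t e v')) has_sum
      cinner ((cinner x u *\<^sub>C rank_one y v) y') v') some_onb" for y' v'
    using has_sum_cmult_right[OF parseval[OF is_onb_some_onb, of x u], of "cinner y' v * cinner y v'"]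
    by (simp add: scaleC_blinfun.rep_eq cinner_scaleC_left rank_one.rep_eq hilbert_tensor_productD(5)[OF T] mult_ac)
qed

section \<open>Uniqueness of the partial traces\<close>

lemma rank_one_simps:
  "rank_one (x + x') y = rank_one x y + rank_one x' y" "rank_one x (y + y') = rank_one x y + rank_one x y'"
  "rank_one (x - x') y = rank_one x y - rank_one x' y" "rank_one x (y - y') = rank_one x y - rank_one x y'"
  "rank_one (c *\<^sub>C x) y = c *\<^sub>C rank_one x y" "rank_one x (c *\<^sub>C y) = cnj c *\<^sub>C rank_one x y"
  "rank_one 0 y = 0" "rank_one x 0 = 0"
  by (rule blinfun_eqI; simp add: rank_one.rep_eq scaleC_blinfun.rep_eq blinfun.bilinear_simps
      cinner_simps scaleC_add_left scaleC_add_right scaleC_scaleC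
      cvec.scale_right_diff_distrib cvec.scale_left_diff_distrib mult.commute)+

text \<open>Operators on which two bounded maps agree form a closed subspace of the trace class, so it
  suffices to reach the rank one operators.\<close>

lemma bounded_clinear_eqI:
  fixes P Q :: "('c::chilbert_space \<Rightarrow>\<^sub>L 'c) \<Rightarrow> ('b::chilbert_space \<Rightarrow>\<^sub>L 'b)"
  assumes P: "P \<in> trace_class \<rightarrow> trace_class" "trace_class_bounded_clinear P"
    and Q: "Q \<in> trace_class \<rightarrow> trace_class" "trace_class_bounded_clinear Q"
    and S: "closure (cspan S) = UNIV"
    and eq: "\<And>a b. a \<in> S \<Longrightarrow> b \<in> S \<Longrightarrow> P (rank_one a b) = Q (rank_one a b)"
    and A: "A \<in> trace_class"
  shows "P A = Q A"
proof -
  obtain KP where KP: "\<And>A. A \<in> trace_class \<Longrightarrow> trace_norm (P A) \<le> KP * trace_norm A"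
    using P(2) unfolding trace_class_bounded_clinear_def by blast
  obtain KQ where KQ: "\<And>A. A \<in> trace_class \<Longrightarrow> trace_norm (Q A) \<le> KQ * trace_norm A"
    using Q(2) unfolding trace_class_bounded_clinear_def by blast
  \<comment> \<open>The added 1 makes \<open>K\<close> positive, as the division e / K requires;
    \<open>KP\<close> and \<open>KQ\<close> may be zero or negative.\<close>
  define K where "K = \<bar>KP\<bar> + \<bar>KQ\<bar> + 1"
  define R where "R = {A \<in> trace_class. P A = Q A}"
  have add: "A + B \<in> R" if "A \<in> R" "B \<in> R" for A B
    using that P(2) Q(2) by (simp add: R_def trace_class_bounded_clinear_def trace_class_add)
  have sc: "c *\<^sub>C A \<in> R" if "A \<in> R" for c A
    using that P(2) Q(2) by (simp add: R_def trace_class_bounded_clinear_def trace_class_scaleC)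
  have zero: "0 \<in> R"
  proof -
    have "P (0 *\<^sub>C 0) = 0 *\<^sub>C P 0" "Q (0 *\<^sub>C 0) = 0 *\<^sub>C Q 0"
      using P(2) Q(2) trace_class_zero(1) unfolding trace_class_bounded_clinear_def by blast+
    then show ?thesis using trace_class_zero(1) by (simp add: R_def)
  qed
  have sum: "(\<Sum>i\<in>I. B i) \<in> R" if "\<And>i. i \<in> I \<Longrightarrow> B i \<in> R" for I :: "'c set" and B
    using that by (induction I rule: infinite_finite_induct) (auto intro: zero add)
  have lim: "A \<in> R" if A: "A \<in> trace_class" and ap: "\<And>r. r > 0 \<Longrightarrow> \<exists>B\<in>R. trace_norm (A - B) < r" for A
  proof -
    have "norm (P A - Q A) \<le> e" if e: "e > 0" for e
    proof -
      have K: "K > 0" by (simp add: K_def add_nonneg_pos)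
      then obtain B where B: "B \<in> R" "trace_norm (A - B) < e / K" using ap e by (meson divide_pos_pos)
      have Bt: "B \<in> trace_class" "P B = Q B" using B by (auto simp: R_def)
      have d: "A - B \<in> trace_class" by (rule trace_class_diff(1)[OF A Bt(1)])
      have "P A = P (B + (A - B))" "Q A = Q (B + (A - B))" by simp_all
      then have "P A = P B + P (A - B)" "Q A = Q B + Q (A - B)"
        using P(2) Q(2) Bt d unfolding trace_class_bounded_clinear_def by metis+
      then have "norm (P A - Q A) = norm (P (A - B) - Q (A - B))" by (simp add: Bt)
      also have "\<dots> \<le> norm (P (A - B)) + norm (Q (A - B))" by (rule norm_triangle_ineq4)
      also have "\<dots> \<le> trace_norm (P (A - B)) + trace_norm (Q (A - B))"
        by (intro add_mono norm_le_trace_norm) (use P(1) Q(1) d in auto)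
      also have "\<dots> \<le> KP * trace_norm (A - B) + KQ * trace_norm (A - B)"
        by (intro add_mono KP KQ d)
      also have "\<dots> = (KP + KQ) * trace_norm (A - B)" by (simp add: distrib_right)
      also have "\<dots> \<le> K * trace_norm (A - B)"
        by (intro mult_right_mono trace_norm_nonneg) (simp add: K_def)
      also have "\<dots> \<le> K * (e / K)" using B(2) K by (intro mult_left_mono) auto
      finally show ?thesis using K by simp
    qed
    then have "norm (P A - Q A) \<le> 0" by (rule field_le_epsilon[of _ 0, simplified])
    then show ?thesis using A by (simp add: R_def)
  qed
  \<comment> \<open>Here f is \<open>rank_one\<close> as a function of one argument. It is linear in
    the first and conjugate linear in the second, hence the disjunction in \<open>fsc\<close>.
    Agreement on \<open>S\<close> extends to the span algebraically and to the whole space by the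
    bound with M.\<close>
  have step: "f x \<in> R" if S': "\<And>s. s \<in> S \<Longrightarrow> f s \<in> R" and f0: "f 0 = 0"
    and fadd: "\<And>x y. f (x + y) = f x + f y" and fd: "\<And>x y. f (x - y) = f x - f y"
    and fsc: "\<And>c x. f (c *\<^sub>C x) = c *\<^sub>C f x \<or> f (c *\<^sub>C x) = cnj c *\<^sub>C f x"
    and fb: "\<And>x. f x \<in> trace_class" "\<And>x. trace_norm (f x) \<le> M * norm x" for f :: "'c \<Rightarrow> 'c \<Rightarrow>\<^sub>L 'c" and M x
  proof (rule lim[OF fb(1)])
    have sp: "f s \<in> R" if "s \<in> cspan S" for s
      using that unfolding cspan_def
    proof (induction rule: cvec.span_induct_alt)
      case base then show ?case by (simp add: f0 zero)
    next
      case (step c s z)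
      have "f (c *\<^sub>C s) \<in> R" using fsc[of c s] sc[OF S'[OF step(1)]] by auto
      then show ?case unfolding fadd by (rule add[OF _ step(2)])
    qed
    fix r :: real assume r: "r > 0"
    have M: "\<bar>M\<bar> + 1 > 0" by simp
    obtain s where s: "s \<in> cspan S" "dist s x < r / (\<bar>M\<bar> + 1)"
      using S closure_approachable[of x "cspan S"] divide_pos_pos[OF r M] by auto
    have "trace_norm (f x - f s) \<le> M * norm (x - s)"
      using fb(2)[of "x - s"] by (simp add: fd)
    also have "\<dots> \<le> (\<bar>M\<bar> + 1) * norm (x - s)" by (intro mult_right_mono) auto
    also have "\<dots> < r" using s(2) M by (simp add: dist_norm norm_minus_commute field_simps)
    finally show "\<exists>B\<in>R. trace_norm (f x - B) < r" using sp[OF s(1)] by blast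
  qed
  have r1: "rank_one a b \<in> R" if "a \<in> S" for a b
    by (rule step[of "\<lambda>b. rank_one a b" "norm a"])
      (use that eq in \<open>auto simp: rank_one_simps trace_class_rank_one R_def\<close>)
  have r2: "rank_one a b \<in> R" for a b
    by (rule step[of "\<lambda>a. rank_one a b" "norm b"])
      (use r1 trace_class_rank_one in \<open>auto simp: rank_one_simps mult.commute[of "norm b"]\<close>)
  have "A \<in> R"
  proof (rule lim[OF A])
    fix r :: real assume "r > 0"
    then show "\<exists>B\<in>R. trace_norm (A - B) < r"
      by (rule trace_class_approx_rank_one[OF A]) (use sum[OF r2] in blast)
  qed
  then show ?thesis by (simp add: R_def)
qed

text \<open>The slice series has the defining properties, and two maps with these properties agree
  on rank one operators of elementary tensors, whose span is dense. Extensionality settles operators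
  outside the trace class.\<close>

lemma partial_trace1_eq:
  fixes t :: "'a::chilbert_space \<Rightarrow> 'b::chilbert_space \<Rightarrow> 'c::chilbert_space"
  assumes T: "is_hilbert_tensor_product t"
  shows "partial_trace1 t = slice_trace t"
  unfolding partial_trace1_def
proof (rule the_equality)
  have bl: "trace_class_bounded_clinear (slice_trace t)"
    unfolding trace_class_bounded_clinear_def
    by (auto simp: slice_trace_add[OF T] slice_trace_scaleC[OF T] intro!: exI[of _ 1] slice_trace_works(2)[OF T])
  have PiE: "slice_trace t \<in> trace_class \<rightarrow>\<^sub>E trace_class"
    using slice_trace_works(1)[OF T] by (auto simp: slice_trace_def)
  show "slice_trace t \<in> trace_class \<rightarrow>\<^sub>E trace_class \<and> trace_class_bounded_clinear (slice_trace t) \<and>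
    (\<forall>x y u v. slice_trace t (rank_one (t x y) (t u v)) = cinner x u *\<^sub>C rank_one y v)"
    using bl PiE slice_trace_rank_one[OF T] by blast
  fix P assume P: "P \<in> trace_class \<rightarrow>\<^sub>E trace_class \<and> trace_class_bounded_clinear P \<and>
    (\<forall>x y u v. P (rank_one (t x y) (t u v)) = cinner x u *\<^sub>C rank_one y v)"
  show "P = slice_trace t"
  proof (rule PiE_ext)
    show "P \<in> trace_class \<rightarrow>\<^sub>E trace_class" using P by blast
    show "slice_trace t \<in> trace_class \<rightarrow>\<^sub>E trace_class" by (rule PiE)
    fix A :: "'c \<Rightarrow>\<^sub>L 'c" assume A: "A \<in> trace_class"
    show "P A = slice_trace t A"
    proof (rule bounded_clinear_eqI[OF _ _ _ bl hilbert_tensor_productD(6)[OF T] _ A])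
      show "P \<in> trace_class \<rightarrow> trace_class" "trace_class_bounded_clinear P"
        using P by (blast intro: PiE_mem)+
      show "slice_trace t \<in> trace_class \<rightarrow> trace_class"
        using PiE by (blast intro: PiE_mem)
      fix a b assume "a \<in> {t x y | x y. True}" "b \<in> {t x y | x y. True}"
      then show "P (rank_one a b) = slice_trace t (rank_one a b)"
        using P slice_trace_rank_one[OF T] by auto
    qed
  qed
qed

text \<open>Exchanging the factors lets every fact on the first partial trace serve for the
  second.\<close>

lemma partial_trace2_swap: "partial_trace2 t = partial_trace1 (\<lambda>y x. t x y)"
  unfolding partial_trace1_def partial_trace2_def by (rule arg_cong[where f = The]) blast

lemma partial_trace1_has_sum:
  assumes "is_hilbert_tensor_product t" "A \<in> trace_class"
  shows "((\<lambda>e. cinner (A (t e y)) (t e v)) has_sum cinner (partial_trace1 t A y) v) some_onb"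
  using slice_trace_works(3)[OF assms] by (simp add: partial_trace1_eq[OF assms(1)])

lemma partial_trace2_has_sum:
  assumes "is_hilbert_tensor_product t" "A \<in> trace_class"
  shows "((\<lambda>f. cinner (A (t x f)) (t u f)) has_sum cinner (partial_trace2 t A x) u) some_onb"
  using partial_trace1_has_sum[OF hilbert_tensor_product_swap[OF assms(1)] assms(2)]
  by (simp add: partial_trace2_swap)

subsection \<open>Bounds for partial traces\<close>

lemma partial_trace1_diff:
  fixes t :: "'a::chilbert_space \<Rightarrow> 'b::chilbert_space \<Rightarrow> 'c::chilbert_space"
  assumes T: "is_hilbert_tensor_product t" and A: "A \<in> trace_class" and B: "B \<in> trace_class"
  shows "norm (partial_trace1 t A - partial_trace1 t B) \<le> trace_norm (A - B)"
proof -
  have d: "A - B \<in> trace_class" by (rule trace_class_diff(1)[OF A B])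
  have "slice_trace t A = slice_trace t ((A - B) + B)" by simp
  also have "\<dots> = slice_trace t (A - B) + slice_trace t B" by (rule slice_trace_add[OF T d B])
  finally have "norm (slice_trace t A - slice_trace t B) = norm (slice_trace t (A - B))" by simp
  also have "\<dots> \<le> trace_norm (A - B)"
    using norm_le_trace_norm[OF slice_trace_works(1)[OF T d]] slice_trace_works(2)[OF T d] by linarith
  finally show ?thesis by (simp add: partial_trace1_eq[OF T])
qed

lemma partial_trace2_diff:
  fixes t :: "'a::chilbert_space \<Rightarrow> 'b::chilbert_space \<Rightarrow> 'c::chilbert_space"
  assumes T: "is_hilbert_tensor_product t" and A: "A \<in> trace_class" and B: "B \<in> trace_class"
  shows "norm (partial_trace2 t A - partial_trace2 t B) \<le> trace_norm (A - B)"
  unfolding partial_trace2_swap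
  by (rule partial_trace1_diff[OF hilbert_tensor_product_swap[OF T] A B])

lemma partial_trace_linear:
  fixes t :: "'a::chilbert_space \<Rightarrow> 'b::chilbert_space \<Rightarrow> 'c::chilbert_space"
  assumes T: "is_hilbert_tensor_product t" and A: "A \<in> trace_class" and B: "B \<in> trace_class"
  shows "partial_trace1 t (r *\<^sub>R A + s *\<^sub>R B) = r *\<^sub>R partial_trace1 t A + s *\<^sub>R partial_trace1 t B"
    "partial_trace2 t (r *\<^sub>R A + s *\<^sub>R B) = r *\<^sub>R partial_trace2 t A + s *\<^sub>R partial_trace2 t B"
proof -
  have *: "partial_trace1 u (r *\<^sub>R A + s *\<^sub>R B) = r *\<^sub>R partial_trace1 u A + s *\<^sub>R partial_trace1 u B"
    if u: "is_hilbert_tensor_product u"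
    for u :: "'d::chilbert_space \<Rightarrow> 'e::chilbert_space \<Rightarrow> 'c"
    by (simp add: partial_trace1_eq[OF u] slice_trace_add[OF u] slice_trace_scaleC[OF u] A B
        trace_class_scaleC scaleR_blinfun_scaleC)
  show "partial_trace1 t (r *\<^sub>R A + s *\<^sub>R B) = r *\<^sub>R partial_trace1 t A + s *\<^sub>R partial_trace1 t B"
    by (rule *[OF T])
  show "partial_trace2 t (r *\<^sub>R A + s *\<^sub>R B) = r *\<^sub>R partial_trace2 t A + s *\<^sub>R partial_trace2 t B"
    unfolding partial_trace2_swap by (rule *[OF hilbert_tensor_product_swap[OF T]])
qed

lemma psd_op_convex_comb:
  assumes "psd_op A" "psd_op B" "r \<ge> 0" "s \<ge> 0"
  shows "psd_op (r *\<^sub>R A + s *\<^sub>R B)"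
  by (rule psd_opI, intro clinear_op_add clinear_op_scaleR psd_opD(1) assms)
    (use assms in \<open>auto simp: blinfun.bilinear_simps cinner_simps psd_opD(2,3)\<close>)

lemma convex_couplings:
  fixes t :: "'a::chilbert_space \<Rightarrow> 'b::chilbert_space \<Rightarrow> 'c::chilbert_space"
  assumes T: "is_hilbert_tensor_product t"
  shows "convex (couplings t \<rho>\<^sub>1 \<rho>\<^sub>2)"
proof (rule convexI)
  fix A B :: "'c \<Rightarrow>\<^sub>L 'c" and r s :: real
  assume A: "A \<in> couplings t \<rho>\<^sub>1 \<rho>\<^sub>2" and B: "B \<in> couplings t \<rho>\<^sub>1 \<rho>\<^sub>2" and rs: "0 \<le> r" "0 \<le> s" "r + s = 1"
  have tc: "A \<in> trace_class" "B \<in> trace_class" "psd_op A" "psd_op B"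
    using A B by (auto simp: couplings_def psd_trace_class_def)
  have "r *\<^sub>R A + s *\<^sub>R B \<in> psd_trace_class"
    unfolding psd_trace_class_def
    using trace_class_add(1)[OF trace_class_scaleR[OF tc(1)] trace_class_scaleR[OF tc(2)]]
      psd_op_convex_comb[OF tc(3,4) rs(1,2)] by blast
  then show "r *\<^sub>R A + s *\<^sub>R B \<in> couplings t \<rho>\<^sub>1 \<rho>\<^sub>2"
    using A B by (simp add: couplings_def partial_trace_linear[OF T tc(1,2)] rs(3) flip: scaleR_add_left)
qed

subsection \<open>The product coupling\<close>

text \<open>A substitute for diagonalisation: with the square root S, \<open>B\<close> is the sum of
  the rank one operators of the pairs S e, S e. The vectors S e need not be orthogonal; what matters
  is that their squared norms sum to the trace.\<close>

lemma psd_trace_class_expansion: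
  fixes B :: "'a::chilbert_space \<Rightarrow>\<^sub>L 'a"
  assumes B: "B \<in> psd_trace_class" and E: "is_onb E"
  obtains S where "psd_op S" "S o\<^sub>L S = B" "\<And>x y. cinner (B x) y = cinner (S x) (S y)"
    "\<And>x. Re (cinner (B x) x) = (norm (S x))\<^sup>2"
    "((\<lambda>e. (norm (S e))\<^sup>2) has_sum trace_norm B) E"
    "\<And>x y. ((\<lambda>e. cinner x (S e) * cinner (S e) y) has_sum cinner (B x) y) E"
proof -
  have "psd_op B" using B by (simp add: psd_trace_class_def)
  then obtain S where S: "psd_op S" "S o\<^sub>L S = B" using psd_sqrt_exists by metis
  have q: "cinner (B x) y = cinner (S x) (S y)" for x y
    by (simp add: psd_op_selfadjoint[OF S(1)] flip: S(2))
  have n: "Re (cinner (B x) x) = (norm (S x))\<^sup>2" for x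
    by (simp add: q norm_sq_cinner)
  have "((\<lambda>e. (norm (S e))\<^sup>2) has_sum trace_norm B) E"
    using psd_trace_class_has_sum(1)[OF B E] by (simp add: n)
  moreover have "((\<lambda>e. cinner x (S e) * cinner (S e) y) has_sum cinner (B x) y) E" for x y
    using parseval[OF E, of "S x" "S y"] by (simp add: q psd_op_selfadjoint[OF S(1)])
  ultimately show thesis using that S q n by blast
qed

lemma nuclear_sum_exists:
  fixes a b :: "'i \<Rightarrow> 'a::chilbert_space"
  assumes K: "((\<lambda>g. norm (a g) * norm (b g)) has_sum K) G"
  obtains A where "A \<in> trace_class"
    "\<And>x y. ((\<lambda>g. cinner x (b g) * cinner (a g) y) has_sum cinner (A x) y) G"
proof -
  define h where "h x y = (\<Sum>\<^sub>\<infinity>g\<in>G. cinner x (b g) * cinner (a g) y)" for x y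
  have le: "cmod (cinner x (b g) * cinner (a g) y) \<le> (norm x * norm y) * (norm (a g) * norm (b g))" for x y g
  proof -
    have "cmod (cinner x (b g)) * cmod (cinner (a g) y) \<le> (norm x * norm (b g)) * (norm (a g) * norm y)"
      by (intro mult_mono cmod_cinner_le) auto
    then show ?thesis by (simp add: norm_mult mult_ac)
  qed
  have Ks: "((\<lambda>g. (norm x * norm y) * (norm (a g) * norm (b g))) has_sum (norm x * norm y) * K) G"
    for x y :: 'a
    by (rule has_sum_cmult_right[OF K])
  have hs: "((\<lambda>g. cinner x (b g) * cinner (a g) y) has_sum h x y) G" for x y
    unfolding h_def
  proof (rule has_sum_infsum[OF abs_summable_summable])
    show "(\<lambda>g. cmod (cinner x (b g) * cinner (a g) y)) summable_on G"
      by (rule summable_on_comparison_test[OF has_sum_imp_summable[OF Ks[of x y]]])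
        (use le in auto)
  qed
  have hb: "cmod (h x y) \<le> K * norm x * norm y" for x y
    using norm_infsum_le[OF hs Ks le, of x y] by (simp add: mult_ac)
  obtain A where A: "clinear_op A" "\<And>x y. h x y = cinner (A x) y"
  proof (rule riesz_form[of h, OF _ _ _ _ hb])
    show "h (y + y') v = h y v + h y' v" for y y' v
      by (rule has_sum_unique[OF hs]) (use has_sum_add[OF hs[of y v] hs[of y' v]] in
        \<open>simp add: cinner_add_left distrib_right\<close>)
    show "h y (v + v') = h y v + h y v'" for y v v'
      by (rule has_sum_unique[OF hs]) (use has_sum_add[OF hs[of y v] hs[of y v']] in
        \<open>simp add: cinner_add_right distrib_left\<close>)
    show "h (c *\<^sub>C y) v = c * h y v" for c y v
      by (rule has_sum_unique[OF hs]) (use has_sum_cmult_right[OF hs[of y v], of c] in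
        \<open>simp add: cinner_scaleC_left mult.assoc\<close>)
    show "h y (c *\<^sub>C v) = cnj c * h y v" for c y v
      by (rule has_sum_unique[OF hs]) (use has_sum_cmult_right[OF hs[of y v], of "cnj c"] in
        \<open>simp add: cinner_scaleC_right mult.left_commute\<close>)
  qed auto
  have ex: "((\<lambda>g. cinner x (b g) * cinner (a g) y) has_sum cinner (A x) y) G" for x y
    using hs A(2) by simp
  have "A \<in> trace_class" by (rule nuc_le_trace_class(1)[OF A(1) nuc_le_nuclear[OF ex K]])
  then show thesis using that ex by blast
qed

text \<open>The expansion alone converges only weakly. The finite mass \<open>K\<close> makes its
  finite sums converge in trace norm, for which the partial trace is continuous.\<close>

lemma partial_trace1_nuclear:
  fixes t :: "'a::chilbert_space \<Rightarrow> 'b::chilbert_space \<Rightarrow> 'c::chilbert_space"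
  assumes T: "is_hilbert_tensor_product t" and A: "A \<in> trace_class"
    and ex: "\<And>x y. ((\<lambda>g. cinner x (b g) * cinner (a g) y) has_sum cinner (A x) y) G"
    and K: "((\<lambda>g. norm (a g) * norm (b g)) has_sum K) G"
  shows "((\<lambda>g. cinner (partial_trace1 t (rank_one (a g) (b g)) y) v) has_sum cinner (partial_trace1 t A y) v) G"
proof -
  let ?R = "\<lambda>F. \<Sum>g\<in>F. rank_one (a g) (b g)"
  have tr: "?R F \<in> trace_class" for F
    by (intro trace_class_sum trace_class_rank_one)
  have sum: "partial_trace1 t (?R F) = (\<Sum>g\<in>F. partial_trace1 t (rank_one (a g) (b g)))" for F
  proof (induction F rule: infinite_finite_induct)
    case (insert x F)
    then show ?case
      using partial_trace_linear(1)[OF T trace_class_rank_one(1) tr, of 1 "a x" "b x" 1 F] by simp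
  qed (use partial_trace_linear(1)[OF T trace_class_zero(1) trace_class_zero(1), of 0 0] in auto)
  have bd: "norm (partial_trace1 t (?R F) - partial_trace1 t A) \<le> norm (K - (\<Sum>g\<in>F. norm (a g) * norm (b g)))"
    if F: "finite F" "F \<subseteq> G" for F
  proof -
    have "norm (partial_trace1 t (?R F) - partial_trace1 t A) \<le> trace_norm (A - ?R F)"
      using partial_trace1_diff[OF T A tr] by (simp add: norm_minus_commute)
    also have "\<dots> \<le> K - (\<Sum>g\<in>F. norm (a g) * norm (b g))"
      by (rule nuc_le_trace_class(2)[OF _ nuc_le_nuclear_remainder[OF ex K F]])
        (intro trace_class_clinear trace_class_diff(1) A tr)
    finally show ?thesis by simp
  qed
  have "((\<lambda>F. K - (\<Sum>g\<in>F. norm (a g) * norm (b g))) \<longlongrightarrow> K - K) (finite_subsets_at_top G)"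
    using K unfolding has_sum_def by (intro tendsto_intros)
  then have z: "((\<lambda>F. norm (K - (\<Sum>g\<in>F. norm (a g) * norm (b g)))) \<longlongrightarrow> 0) (finite_subsets_at_top G)"
    by (intro tendsto_norm_zero) simp
  have "((\<lambda>F. partial_trace1 t (?R F) - partial_trace1 t A) \<longlongrightarrow> 0) (finite_subsets_at_top G)"
    by (rule Lim_null_comparison[OF _ z]) (rule eventually_finite_subsets_at_top_weakI, rule bd)
  then have "((\<lambda>F. partial_trace1 t (?R F)) \<longlongrightarrow> partial_trace1 t A) (finite_subsets_at_top G)"
    by (simp add: Lim_null[symmetric])
  then have "((\<lambda>F. cinner (partial_trace1 t (?R F) y) v) \<longlongrightarrow> cinner (partial_trace1 t A y) v) (finite_subsets_at_top G)"
    by (intro tendsto_cinner tendsto_intros)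
  then show ?thesis
    unfolding has_sum_def sum by (simp add: blinfun.sum_left cinner_sum_left)
qed

text \<open>On the rank one operator of a tensor b with itself, the partial trace gives the squared
  norm of a times that of b with itself. Summing over \<open>F\<close> first produces the operator,
  then summing over \<open>E\<close> its scalar factor.\<close>

lemma partial_trace1_product:
  fixes t :: "'a::chilbert_space \<Rightarrow> 'b::chilbert_space \<Rightarrow> 'c::chilbert_space" and \<rho> :: "'b \<Rightarrow>\<^sub>L 'b"
  assumes T: "is_hilbert_tensor_product t" and \<gamma>: "\<gamma> \<in> trace_class"
    and ex: "\<And>x y. ((\<lambda>(e, f). cinner x (t (a e) (b f)) * cinner (t (a e) (b f)) y) has_sum cinner (\<gamma> x) y) (E \<times> F)"
    and K: "((\<lambda>(e, f). (norm (a e))\<^sup>2 * (norm (b f))\<^sup>2) has_sum K) (E \<times> F)"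
    and a: "((\<lambda>e. (norm (a e))\<^sup>2) has_sum \<tau>) E"
    and b: "\<And>y v. ((\<lambda>f. cinner y (b f) * cinner (b f) v) has_sum cinner (\<rho> y) v) F"
  shows "partial_trace1 t \<gamma> = \<tau> *\<^sub>R \<rho>"
proof (rule blinfun_ext_cinner)
  fix y v
  let ?c = "\<lambda>(e, f). t (a e) (b f)"
  have "((\<lambda>g. cinner (partial_trace1 t (rank_one (?c g) (?c g)) y) v) has_sum cinner (partial_trace1 t \<gamma> y) v) (E \<times> F)"
  proof (rule partial_trace1_nuclear[OF T \<gamma>])
    show "((\<lambda>g. cinner x (?c g) * cinner (?c g) y) has_sum cinner (\<gamma> x) y) (E \<times> F)" for x y
      using ex[of x y] by (simp add: case_prod_unfold)
    show "((\<lambda>g. norm (?c g) * norm (?c g)) has_sum K) (E \<times> F)"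
      using K by (simp add: case_prod_unfold norm_tensor[OF T] power2_eq_square mult_ac)
  qed
  then have sum: "((\<lambda>(e, f). of_real ((norm (a e))\<^sup>2) * (cinner y (b f) * cinner (b f) v)) has_sum
      cinner (partial_trace1 t \<gamma> y) v) (E \<times> F)"
    by (simp only: case_prod_unfold partial_trace1_eq[OF T] slice_trace_rank_one[OF T]
        scaleC_blinfun.rep_eq rank_one.rep_eq cinner_scaleC_left cinner_self)
  have "((\<lambda>e. of_real ((norm (a e))\<^sup>2) * cinner (\<rho> y) v) has_sum cinner (partial_trace1 t \<gamma> y) v) E"
    by (rule has_sum_SigmaD[OF sum]) (use has_sum_cmult_right[OF b[of y v]] in simp)
  moreover have "((\<lambda>e. of_real ((norm (a e))\<^sup>2) * cinner (\<rho> y) v) has_sum of_real \<tau> * cinner (\<rho> y) v) E"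
    by (intro has_sum_cmult_left has_sum_of_real a)
  ultimately show "cinner (partial_trace1 t \<gamma> y) v = cinner ((\<tau> *\<^sub>R \<rho>) y) v"
    by (simp add: has_sum_unique blinfun.scaleR_left cinner_scaleR_left)
qed

lemma trace_norm_eq_0: "A \<in> trace_class \<Longrightarrow> trace_norm A = 0 \<Longrightarrow> A = 0"
  using norm_le_trace_norm[of A] by simp

lemma couplings_nonempty:
  fixes t :: "'a::chilbert_space \<Rightarrow> 'b::chilbert_space \<Rightarrow> 'c::chilbert_space"
  assumes T: "is_hilbert_tensor_product t"
    and \<rho>1: "\<rho>\<^sub>1 \<in> psd_trace_class" and \<rho>2: "\<rho>\<^sub>2 \<in> psd_trace_class"
    and tr: "trace_norm \<rho>\<^sub>1 = trace_norm \<rho>\<^sub>2"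
  shows "couplings t \<rho>\<^sub>1 \<rho>\<^sub>2 \<noteq> {}"
proof -
  define \<tau> where "\<tau> = trace_norm \<rho>\<^sub>1"
  have tc: "\<rho>\<^sub>1 \<in> trace_class" "\<rho>\<^sub>2 \<in> trace_class" using \<rho>1 \<rho>2 by (auto simp: psd_trace_class_def)
  show ?thesis
  proof (cases "\<tau> = 0")
    \<comment> \<open>Normalising by the trace is impossible here, but then both marginals vanish
      and the zero operator is a coupling.\<close>
    case True
    then have "\<rho>\<^sub>1 = 0" "\<rho>\<^sub>2 = 0" using tc tr by (auto simp: \<tau>_def intro: trace_norm_eq_0)
    moreover have "psd_op (0 :: 'c \<Rightarrow>\<^sub>L 'c)" by (rule psd_opI) auto
    moreover have "partial_trace1 t 0 = 0" "partial_trace2 t 0 = 0"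
      using partial_trace_linear[OF T trace_class_zero(1) trace_class_zero(1), of 0 0] by auto
    ultimately have "0 \<in> couplings t \<rho>\<^sub>1 \<rho>\<^sub>2"
      by (simp add: couplings_def psd_trace_class_def trace_class_zero)
    then show ?thesis by blast
  next
    case False
    then have \<tau>: "\<tau> > 0" using trace_norm_nonneg[of \<rho>\<^sub>1] by (simp add: \<tau>_def)
    let ?E = "some_onb :: 'a set" and ?F = "some_onb :: 'b set"
    obtain S1 where S1: "((\<lambda>e. (norm (S1 e))\<^sup>2) has_sum \<tau>) ?E"
      "\<And>x y. ((\<lambda>e. cinner x (S1 e) * cinner (S1 e) y) has_sum cinner (\<rho>\<^sub>1 x) y) ?E"
      unfolding \<tau>_def by (rule psd_trace_class_expansion[OF \<rho>1 is_onb_some_onb]) blast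
    obtain S2 where S2: "((\<lambda>f. (norm (S2 f))\<^sup>2) has_sum \<tau>) ?F"
      "\<And>x y. ((\<lambda>f. cinner x (S2 f) * cinner (S2 f) y) has_sum cinner (\<rho>\<^sub>2 x) y) ?F"
      unfolding \<tau>_def tr by (rule psd_trace_class_expansion[OF \<rho>2 is_onb_some_onb]) blast
    define c where "c g = t (S1 (fst g)) (S2 (snd g))" for g
    define k where "k g = (norm (S1 (fst g)))\<^sup>2 * (norm (S2 (snd g)))\<^sup>2" for g
    have kc: "norm (c g) * norm (c g) = k g" for g
      by (simp add: c_def k_def norm_tensor[OF T] power2_eq_square mult_ac)
    have "k summable_on ?E \<times> ?F"
    proof (rule nonneg_bdd_above_summable_on)
      have "sum k H \<le> \<tau> * \<tau>" if H: "finite H" "H \<subseteq> ?E \<times> ?F" for H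
      proof -
        \<comment> \<open>A finite set of pairs need not be a rectangle; over the product of its two
          projections the sum factors.\<close>
        have "sum k H \<le> sum k (fst ` H \<times> snd ` H)"
          by (rule sum_mono2) (use H in \<open>force simp: k_def\<close>)+
        also have "\<dots> = (\<Sum>e\<in>fst ` H. (norm (S1 e))\<^sup>2) * (\<Sum>f\<in>snd ` H. (norm (S2 f))\<^sup>2)"
          by (simp add: k_def sum_product sum.cartesian_product case_prod_unfold)
        also have "\<dots> \<le> \<tau> * \<tau>"
        proof (rule mult_mono)
          show "(\<Sum>e\<in>fst ` H. (norm (S1 e))\<^sup>2) \<le> \<tau>"
            by (rule finite_sum_le_has_sum[OF S1(1)]) (use H in auto)
          show "(\<Sum>f\<in>snd ` H. (norm (S2 f))\<^sup>2) \<le> \<tau>"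
            by (rule finite_sum_le_has_sum[OF S2(1)]) (use H in auto)
        qed (use \<tau> in \<open>auto intro: sum_nonneg\<close>)
        finally show ?thesis .
      qed
      then show "bdd_above (sum k ` {F. F \<subseteq> ?E \<times> ?F \<and> finite F})"
        by (auto intro!: bdd_aboveI[of _ "\<tau> * \<tau>"])
    qed (simp add: k_def)
    then obtain K where K: "(k has_sum K) (?E \<times> ?F)" by (auto simp: summable_on_def)
    obtain \<gamma> where \<gamma>: "\<gamma> \<in> trace_class"
      "\<And>x y. ((\<lambda>g. cinner x (c g) * cinner (c g) y) has_sum cinner (\<gamma> x) y) (?E \<times> ?F)"
      by (rule nuclear_sum_exists[where a = c and b = c and K = K and G = "?E \<times> ?F"]) (use K in \<open>auto simp: kc\<close>)
    have 1: "partial_trace1 t \<gamma> = \<tau> *\<^sub>R \<rho>\<^sub>2"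
      by (rule partial_trace1_product[OF T \<gamma>(1) _ _ S1(1) S2(2)])
        (use \<gamma>(2) K in \<open>simp_all add: c_def[abs_def] k_def[abs_def] case_prod_unfold\<close>)
    have 2: "partial_trace2 t \<gamma> = \<tau> *\<^sub>R \<rho>\<^sub>1"
      unfolding partial_trace2_swap
    proof (rule partial_trace1_product[OF hilbert_tensor_product_swap[OF T] \<gamma>(1) _ _ S2(1) S1(2)])
      show "((\<lambda>(f, e). cinner x (t (S1 e) (S2 f)) * cinner (t (S1 e) (S2 f)) y) has_sum cinner (\<gamma> x) y) (?F \<times> ?E)"
        for x y
        using \<gamma>(2)[of x y] by (subst (asm) has_sum_swap) (simp add: c_def)
      show "((\<lambda>(f, e). (norm (S2 f))\<^sup>2 * (norm (S1 e))\<^sup>2) has_sum K) (?F \<times> ?E)"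
        using K by (subst (asm) has_sum_swap) (simp add: k_def mult.commute)
    qed
    have "psd_op \<gamma>"
    proof (rule psd_opI)
      show "clinear_op \<gamma>" using \<gamma>(1) by (rule trace_class_clinear)
      fix x
      have s: "((\<lambda>g. complex_of_real ((cmod (cinner x (c g)))\<^sup>2)) has_sum cinner (\<gamma> x) x) (?E \<times> ?F)"
        using \<gamma>(2)[of x x] by (simp only: cmod_cinner_sq)
      show "0 \<le> Re (cinner (\<gamma> x) x)"
        using has_sum_Re[OF s] by (rule has_sum_nonneg) simp
      show "Im (cinner (\<gamma> x) x) = 0"
        using has_sum_Im[OF s] by (simp add: has_sum_unique[OF _ has_sum_0_simp])
    qed
    \<comment> \<open>The summand with coefficient 0 lets the facts on combinations of two operators
      serve for one scalar multiple.\<close>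
    then have "psd_op ((1/\<tau>) *\<^sub>R \<gamma> + 0 *\<^sub>R \<gamma>)" using \<tau> by (intro psd_op_convex_comb) auto
    moreover have "(1/\<tau>) *\<^sub>R \<gamma> \<in> trace_class" by (rule trace_class_scaleR[OF \<gamma>(1)])
    ultimately have "(1/\<tau>) *\<^sub>R \<gamma> \<in> couplings t \<rho>\<^sub>1 \<rho>\<^sub>2"
      using partial_trace_linear[OF T \<gamma>(1) \<gamma>(1), of "1/\<tau>" 0] \<tau>
      by (simp add: couplings_def psd_trace_class_def 1 2)
    then show ?thesis by blast
  qed
qed

subsection \<open>Compression to finitely many basis vectors\<close>

definition onb_proj :: "'a::chilbert_space set \<Rightarrow> 'a \<Rightarrow>\<^sub>L 'a" where
  "onb_proj H = (\<Sum>h\<in>H. rank_one h h)"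

lemma onb_proj_apply: "onb_proj H z = (\<Sum>h\<in>H. cinner z h *\<^sub>C h)"
  by (simp add: onb_proj_def blinfun.sum_left rank_one.rep_eq)

lemma onb_proj_selfadjoint: "cinner (onb_proj H x) y = cinner x (onb_proj H y)"
proof -
  have "cnj (cinner y h) = cinner h y" for h by (rule cinner_commute[symmetric])
  then show ?thesis
    by (simp add: onb_proj_apply cinner_sum_left cinner_sum_right cinner_scaleC_left cinner_scaleC_right mult.commute)
qed

lemma onb_proj_clinear: "clinear_op (onb_proj H)"
  unfolding onb_proj_def by (rule trace_class_clinear) (intro trace_class_sum trace_class_rank_one)

lemma onb_proj_basis:
  assumes G: "orthonormal G" and H: "finite H" "H \<subseteq> G" and g: "g \<in> G"
  shows "onb_proj H g = (if g \<in> H then g else 0)"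
proof -
  have "onb_proj H g = (\<Sum>h\<in>H. if h = g then g else 0)"
    unfolding onb_proj_apply
    by (intro sum.cong refl) (use H g in \<open>auto simp: orthonormal_cinner[OF G] subset_iff cvec.scale_one\<close>)
  then show ?thesis using H(1) by simp
qed

lemma norm_onb_proj:
  assumes H: "orthonormal H" "finite H"
  shows "norm (onb_proj H z) \<le> norm z"
proof -
  have "cinner (z - onb_proj H z) (onb_proj H z) = 0"
    unfolding onb_proj_apply by (subst cinner_sum_right)
      (intro sum.neutral ballI, simp only: cinner_scaleC_right bessel_finite(2)[OF H] mult_zero_right)
  then have "(norm z)\<^sup>2 = (norm (z - onb_proj H z))\<^sup>2 + (norm (onb_proj H z))\<^sup>2"
    using norm_add_sq[of "z - onb_proj H z" "onb_proj H z"] by simp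
  then have "(norm (onb_proj H z))\<^sup>2 \<le> (norm z)\<^sup>2"
    using zero_le_power2[of "norm (z - onb_proj H z)"] by linarith
  then show ?thesis by (rule power2_le_imp_le) simp
qed

definition compression :: "'a::chilbert_space set \<Rightarrow> ('a \<Rightarrow>\<^sub>L 'a) \<Rightarrow> 'a \<Rightarrow>\<^sub>L 'a" where
  "compression H A = onb_proj H o\<^sub>L (A o\<^sub>L onb_proj H)"

lemma compression_sum:
  assumes A: "clinear_op A"
  shows "compression H A = (\<Sum>g\<in>H. \<Sum>h\<in>H. cinner (A h) g *\<^sub>C rank_one g h)"
proof (rule blinfun_eqI)
  fix z
  have "compression H A z = onb_proj H (\<Sum>h\<in>H. cinner z h *\<^sub>C A h)"
    unfolding compression_def by (simp add: onb_proj_apply[of H z] blinfun.sum_right clinear_opD[OF A])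
  also have "\<dots> = (\<Sum>g\<in>H. \<Sum>h\<in>H. (cinner z h * cinner (A h) g) *\<^sub>C g)"
    by (simp add: onb_proj_apply cinner_sum_left cinner_scaleC_left cvec.scale_sum_left)
  finally show "compression H A z = (\<Sum>g\<in>H. \<Sum>h\<in>H. cinner (A h) g *\<^sub>C rank_one g h) z"
    by (simp add: blinfun.sum_left scaleC_blinfun.rep_eq rank_one.rep_eq scaleC_scaleC mult.commute)
qed

text \<open>In finite dimension entrywise closeness controls the trace norm: each matrix entry
  multiplies a rank one operator of norm 1. The resulting factor is the number of entries.\<close>

lemma nuc_le_compression_diff:
  assumes A: "clinear_op A" "clinear_op B" and H: "orthonormal H"
    and d: "\<And>g h. g \<in> H \<Longrightarrow> h \<in> H \<Longrightarrow> cmod (cinner (A h) g - cinner (B h) g) \<le> d"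
  shows "nuc_le (compression H A - compression H B) (real (card H) * (real (card H) * d))"
proof -
  have "compression H A - compression H B = compression H (A - B)"
    by (rule blinfun_eqI) (simp add: compression_def blinfun.bilinear_simps)
  also have "\<dots> = (\<Sum>g\<in>H. \<Sum>h\<in>H. cinner ((A - B) h) g *\<^sub>C rank_one g h)"
    by (intro compression_sum clinear_op_diff A)
  finally have eq: "compression H A - compression H B = \<dots>" .
  have "nuc_le (\<Sum>g\<in>H. \<Sum>h\<in>H. cinner ((A - B) h) g *\<^sub>C rank_one g h) (\<Sum>g\<in>H. \<Sum>h\<in>H. d)"
  proof (intro nuc_le_sum)
    fix g h assume gh: "g \<in> H" "h \<in> H"
    then have "norm g * norm h = 1" using H by (simp add: orthonormal_def)
    then have "nuc_le (cinner ((A - B) h) g *\<^sub>C rank_one g h) (cmod (cinner ((A - B) h) g))"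
      using nuc_le_scaleC[OF nuc_le_rank_one[of g h]] by simp
    then show "nuc_le (cinner ((A - B) h) g *\<^sub>C rank_one g h) d"
      by (rule nuc_le_mono) (use d[OF gh] in \<open>simp add: blinfun.diff_left cinner_diff_left\<close>)
  qed
  then show ?thesis by (simp add: eq)
qed

lemma has_sum_mult_l2:
  fixes u v :: "'i \<Rightarrow> real"
  assumes u: "((\<lambda>g. (u g)\<^sup>2) has_sum U) G" and v: "((\<lambda>g. (v g)\<^sup>2) has_sum V) G"
    and pos: "\<And>g. u g \<ge> 0" "\<And>g. v g \<ge> 0"
  obtains K where "((\<lambda>g. u g * v g) has_sum K) G" "K \<le> sqrt U * sqrt V"
proof -
  have UV: "U \<ge> 0" "V \<ge> 0" using has_sum_nonneg[OF u] has_sum_nonneg[OF v] by auto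
  have fin: "(\<Sum>g\<in>F. u g * v g) \<le> sqrt U * sqrt V" if F: "finite F" "F \<subseteq> G" for F
  proof -
    have "(\<Sum>g\<in>F. (u g)\<^sup>2) \<le> U" "(\<Sum>g\<in>F. (v g)\<^sup>2) \<le> V"
      by (rule finite_sum_le_has_sum[OF u] finite_sum_le_has_sum[OF v]; use F in simp)+
    then have "(\<Sum>g\<in>F. \<bar>u g\<bar> * \<bar>v g\<bar>) \<le> sqrt U * sqrt V"
      using UV by (intro sum_mult_le_l2) auto
    then show ?thesis using pos by simp
  qed
  have "(\<lambda>g. u g * v g) summable_on G"
    by (rule nonneg_bdd_above_summable_on)
      (use pos fin in \<open>auto intro!: bdd_aboveI[of _ "sqrt U * sqrt V"]\<close>)
  then obtain K where K: "((\<lambda>g. u g * v g) has_sum K) G" by (auto simp: summable_on_def)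
  show thesis using that[OF K] has_sum_le_finite_sums[OF K] fin by blast
qed

text \<open>\<open>\<gamma> - P \<gamma> P = (1 - P) \<gamma> + P \<gamma> (1 - P)\<close>; with \<open>\<gamma> = S\<^sup>2\<close> both terms are bounded by the product of
  the Hilbert--Schmidt norms of \<open>S (1 - P)\<close> and \<open>S\<close>.\<close>

lemma nuc_le_compression_error:
  fixes \<gamma> :: "'a::chilbert_space \<Rightarrow>\<^sub>L 'a"
  assumes \<gamma>: "\<gamma> \<in> psd_trace_class" and G: "is_onb G" and H: "finite H" "H \<subseteq> G"
    and tail: "\<And>F. finite F \<Longrightarrow> F \<subseteq> G - H \<Longrightarrow> (\<Sum>h\<in>F. Re (cinner (\<gamma> h) h)) \<le> \<epsilon>"
  shows "nuc_le (\<gamma> - compression H \<gamma>) (2 * (sqrt \<epsilon> * sqrt (trace_norm \<gamma>)))"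
proof (rule psd_trace_class_expansion[OF \<gamma> G])
  fix S assume S: "psd_op S" "S o\<^sub>L S = \<gamma>" and q: "\<And>x y. cinner (\<gamma> x) y = cinner (S x) (S y)"
    and n: "\<And>x. Re (cinner (\<gamma> x) x) = (norm (S x))\<^sup>2"
    and hs: "((\<lambda>e. (norm (S e))\<^sup>2) has_sum trace_norm \<gamma>) G"
  have on: "orthonormal G" "orthonormal H"
    using G H by (auto simp: is_onb_iff intro: orthonormal_subset)
  define P where "P = onb_proj H"
  define Q where "Q = id_blinfun - P"
  have Psa: "cinner (P x) y = cinner x (P y)" for x y by (simp add: P_def onb_proj_selfadjoint)
  have Qsa: "cinner (Q x) y = cinner x (Q y)" for x y
    by (simp add: Q_def blinfun.diff_left cinner_diff_left cinner_diff_right Psa)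
  have Qcl: "clinear_op Q" unfolding Q_def P_def by (intro clinear_op_diff clinear_op_simps onb_proj_clinear)
  have Scl: "clinear_op S" by (rule psd_opD(1)[OF S(1)])
  note Ssa = psd_op_selfadjoint[OF S(1)]
  have SQcl: "clinear_op (S o\<^sub>L Q)" by (rule clinear_op_compose[OF Scl Qcl])
  \<comment> \<open>The hypothesis \<open>tail\<close> bounds the squared Hilbert-Schmidt norm of S
    Q, since Q annihilates \<open>H\<close> and fixes the other basis vectors. The expansions below
    involve Q S instead, which as the adjoint has the same Hilbert-Schmidt norm.\<close>
  have adj: "cadjoint (S o\<^sub>L Q) = Q o\<^sub>L S"
    by (rule blinfun_ext_cinner) (simp add: cadjoint_works(3)[OF SQcl, symmetric] Ssa Qsa)
  have Qb: "Q g = (if g \<in> H then 0 else g)" if "g \<in> G" for g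
    using onb_proj_basis[OF on(1) H that] by (simp add: Q_def P_def blinfun.diff_left)
  have fin: "(\<Sum>g\<in>F. (norm ((S o\<^sub>L Q) g))\<^sup>2) \<le> \<epsilon>" if F: "finite F" "F \<subseteq> G" for F
  proof -
    have "(\<Sum>g\<in>F. (norm ((S o\<^sub>L Q) g))\<^sup>2) = (\<Sum>g\<in>F - H. (norm (S g))\<^sup>2)"
      using F by (intro sum.mono_neutral_cong_right) (auto simp: Qb subset_iff)
    also have "\<dots> \<le> \<epsilon>" using tail[of "F - H"] F by (auto simp: n)
    finally show ?thesis .
  qed
  have "(\<lambda>g. (norm ((S o\<^sub>L Q) g))\<^sup>2) summable_on G"
    by (rule nonneg_bdd_above_summable_on) (use fin in \<open>auto intro!: bdd_aboveI[of _ \<epsilon>]\<close>)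
  then obtain L where L: "((\<lambda>g. (norm ((S o\<^sub>L Q) g))\<^sup>2) has_sum L) G" unfolding summable_on_def by blast
  have L\<epsilon>: "L \<le> \<epsilon>" by (rule has_sum_le_finite_sums[OF L fin])
  have QS: "((\<lambda>g. (norm (Q (S g)))\<^sup>2) has_sum L) G"
    using hilbert_schmidt_adjoint[OF SQcl G G L] by (simp add: adj)
  obtain K where K: "((\<lambda>g. norm (Q (S g)) * norm (S g)) has_sum K) G" "K \<le> sqrt L * sqrt (trace_norm \<gamma>)"
    by (rule has_sum_mult_l2[OF QS hs]) auto
  have Ple: "norm (P z) \<le> norm z" for z unfolding P_def by (rule norm_onb_proj[OF on(2) H(1)])
  have le': "norm (P (S g)) * norm (Q (S g)) \<le> norm (Q (S g)) * norm (S g)" for g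
    by (subst mult.commute) (intro mult_left_mono Ple norm_ge_zero)
  have "(\<lambda>g. norm (P (S g)) * norm (Q (S g))) summable_on G"
    by (rule summable_on_comparison_test[OF has_sum_imp_summable[OF K(1)] le']) auto
  then obtain K' where K': "((\<lambda>g. norm (P (S g)) * norm (Q (S g))) has_sum K') G" unfolding summable_on_def by blast
  have K'K: "K' \<le> K" by (rule has_sum_mono[OF K' K(1) le'])
  \<comment> \<open>Here (1 - P) times the operator is the sum over g of the rank one operators of
    the pairs Q S g, S g.\<close>
  have 1: "nuc_le (\<gamma> - (P o\<^sub>L \<gamma>)) K"
  proof (rule nuc_le_nuclear[OF _ K(1)])
    fix x y
    have "cinner ((\<gamma> - (P o\<^sub>L \<gamma>)) x) y = cinner (\<gamma> x) (Q y)"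
      by (simp add: Q_def blinfun.diff_left cinner_diff_left cinner_diff_right Psa)
    then show "((\<lambda>g. cinner x (S g) * cinner (Q (S g)) y) has_sum cinner ((\<gamma> - (P o\<^sub>L \<gamma>)) x) y) G"
      using parseval[OF G, of "S x" "S (Q y)"] by (simp add: q Ssa Qsa)
  qed
  \<comment> \<open>The block with P on the left and 1 - P on the right is the sum over g of the
    rank one operators of the pairs P S g, Q S g. Its mass is at most \<open>K\<close>, because P is
    a contraction.\<close>
  have 2: "nuc_le ((P o\<^sub>L \<gamma>) - compression H \<gamma>) K'"
  proof (rule nuc_le_nuclear[OF _ K'])
    fix x y
    have "cinner (((P o\<^sub>L \<gamma>) - compression H \<gamma>) x) y = cinner (\<gamma> (Q x)) (P y)"
      by (simp add: compression_def P_def[symmetric] Q_def blinfun.diff_left blinfun.diff_right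
          cinner_diff_left cinner_diff_right Psa)
    then show "((\<lambda>g. cinner x (Q (S g)) * cinner (P (S g)) y) has_sum
        cinner (((P o\<^sub>L \<gamma>) - compression H \<gamma>) x) y) G"
      using parseval[OF G, of "S (Q x)" "S (P y)"] by (simp add: q Ssa Qsa Psa)
  qed
  have "K \<le> sqrt \<epsilon> * sqrt (trace_norm \<gamma>)"
    using K(2) L\<epsilon> by (smt (verit) mult_right_mono real_sqrt_ge_zero real_sqrt_le_mono trace_norm_nonneg)
  then have "K + K' \<le> 2 * (sqrt \<epsilon> * sqrt (trace_norm \<gamma>))" using K'K by simp
  moreover have "\<gamma> - compression H \<gamma> = (\<gamma> - (P o\<^sub>L \<gamma>)) + ((P o\<^sub>L \<gamma>) - compression H \<gamma>)" by simp
  ultimately show ?thesis using nuc_le_mono[OF nuc_le_add[OF 1 2]] by metis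
qed

subsection \<open>Tightness of the set of couplings\<close>

text \<open>Completeness is checked one factor at a time. If z is orthogonal to all e tensor f, its
  slice along each e is orthogonal to \<open>F\<close>, hence zero; so z is orthogonal to all e
  tensor y, and slicing along y gives all x tensor y.\<close>

lemma orthonormal_tensor:
  assumes T: "is_hilbert_tensor_product t" and E: "is_onb E" and F: "is_onb F"
  shows "is_onb ((\<lambda>(e, f). t e f) ` (E \<times> F))" "inj_on (\<lambda>(e, f). t e f) (E \<times> F)"
proof -
  note D = hilbert_tensor_productD[OF T]
  have oE: "orthonormal E" and oF: "orthonormal F" using E F by (auto simp: is_onb_iff)
  have ip: "cinner (t e f) (t e' f') = (if e = e' \<and> f = f' then 1 else 0)"
    if "e \<in> E" "f \<in> F" "e' \<in> E" "f' \<in> F" for e f e' f'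
    using that by (auto simp: D orthonormal_cinner[OF oE] orthonormal_cinner[OF oF])
  show "inj_on (\<lambda>(e, f). t e f) (E \<times> F)"
  proof (rule inj_onI, safe)
    fix e f e' f' assume *: "e \<in> E" "f \<in> F" "e' \<in> E" "f' \<in> F" "t e f = t e' f'"
    then have "cinner (t e f) (t e' f') = 1" using ip[of e f e f] by simp
    then show "e = e'" "f = f'" using ip[OF *(1-4)] by (auto split: if_splits)
  qed
  show "is_onb ((\<lambda>(e, f). t e f) ` (E \<times> F))"
    unfolding is_onb_iff
  proof (intro conjI allI impI)
    have "norm e = 1" if "e \<in> E" for e using oE that by (simp add: orthonormal_def)
    moreover have "norm f = 1" if "f \<in> F" for f using oF that by (simp add: orthonormal_def)
    ultimately show "orthonormal ((\<lambda>(e, f). t e f) ` (E \<times> F))"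
      unfolding orthonormal_def pairwise_def using ip by (auto simp: norm_tensor[OF T])
    fix z assume z: "\<forall>g\<in>(\<lambda>(e, f). t e f) ` (E \<times> F). cinner g z = 0"
    have 1: "cinner (t e y) z = 0" if e: "e \<in> E" for e y
    proof -
      let ?w = "cadjoint (tensor_op t e) z"
      have "cinner f ?w = 0" if "f \<in> F" for f
        using z e that cinner_slice(2)[OF T, of e f z] by force
      then have "?w = 0" using F by (simp add: is_onb_iff)
      then show ?thesis by (simp add: cinner_slice(2)[OF T])
    qed
    have T': "is_hilbert_tensor_product (\<lambda>y x. t x y)" by (rule hilbert_tensor_product_swap[OF T])
    have 2: "cinner (t x y) z = 0" for x y
    proof -
      let ?w = "cadjoint (tensor_op (\<lambda>y x. t x y) y) z"
      have "cinner e ?w = 0" if "e \<in> E" for e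
        using 1[OF that] cinner_slice(2)[OF T', of e y z] by simp
      then have "?w = 0" using E by (simp add: is_onb_iff)
      then show ?thesis using cinner_slice(2)[OF T', of x y z] by simp
    qed
    show "z = 0"
      using D(6) 2 unfolding dense_cspan_iff by blast
  qed
qed

lemma coupling_marginal_le:
  fixes t :: "'a::chilbert_space \<Rightarrow> 'b::chilbert_space \<Rightarrow> 'c::chilbert_space"
  assumes T: "is_hilbert_tensor_product t" and \<gamma>: "\<gamma> \<in> couplings t \<rho>\<^sub>1 \<rho>\<^sub>2"
  shows "finite F \<Longrightarrow> F \<subseteq> some_onb \<Longrightarrow> (\<Sum>f\<in>F. Re (cinner (\<gamma> (t x f)) (t x f))) \<le> Re (cinner (\<rho>\<^sub>1 x) x)"
    and "finite E \<Longrightarrow> E \<subseteq> some_onb \<Longrightarrow> (\<Sum>e\<in>E. Re (cinner (\<gamma> (t e y)) (t e y))) \<le> Re (cinner (\<rho>\<^sub>2 y) y)"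
proof -
  have tc: "\<gamma> \<in> trace_class" and psd: "psd_op \<gamma>"
    and p: "partial_trace2 t \<gamma> = \<rho>\<^sub>1" "partial_trace1 t \<gamma> = \<rho>\<^sub>2"
    using \<gamma> by (auto simp: couplings_def psd_trace_class_def)
  show "finite F \<Longrightarrow> F \<subseteq> some_onb \<Longrightarrow> (\<Sum>f\<in>F. Re (cinner (\<gamma> (t x f)) (t x f))) \<le> Re (cinner (\<rho>\<^sub>1 x) x)"
    using finite_sum_le_has_sum[OF has_sum_Re[OF partial_trace2_has_sum[OF T tc, of x x]]]
      psd_opD(2)[OF psd] by (simp add: p)
  show "finite E \<Longrightarrow> E \<subseteq> some_onb \<Longrightarrow> (\<Sum>e\<in>E. Re (cinner (\<gamma> (t e y)) (t e y))) \<le> Re (cinner (\<rho>\<^sub>2 y) y)"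
    using finite_sum_le_has_sum[OF has_sum_Re[OF partial_trace1_has_sum[OF T tc, of y y]]]
      psd_opD(2)[OF psd] by (simp add: p)
qed

text \<open>A pair outside the rectangle has its first entry outside \<open>E0\<close> or its second
  outside \<open>F0\<close>. Summing the diagonal over the free coordinate turns the mass of either
  kind into mass of a marginal, so the two tails add up as in a union bound.\<close>

lemma coupling_tail_le:
  fixes t :: "'a::chilbert_space \<Rightarrow> 'b::chilbert_space \<Rightarrow> 'c::chilbert_space"
  assumes T: "is_hilbert_tensor_product t" and \<gamma>: "\<gamma> \<in> couplings t \<rho>\<^sub>1 \<rho>\<^sub>2"
    and \<rho>1: "\<rho>\<^sub>1 \<in> psd_trace_class" and \<rho>2: "\<rho>\<^sub>2 \<in> psd_trace_class"
    and E0: "finite E0" "E0 \<subseteq> some_onb" "trace_norm \<rho>\<^sub>1 - \<epsilon>\<^sub>1 \<le> (\<Sum>e\<in>E0. Re (cinner (\<rho>\<^sub>1 e) e))"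
    and F0: "finite F0" "F0 \<subseteq> some_onb" "trace_norm \<rho>\<^sub>2 - \<epsilon>\<^sub>2 \<le> (\<Sum>f\<in>F0. Re (cinner (\<rho>\<^sub>2 f) f))"
    and H: "finite H" "H \<subseteq> some_onb \<times> some_onb - E0 \<times> F0"
  shows "(\<Sum>(e, f)\<in>H. Re (cinner (\<gamma> (t e f)) (t e f))) \<le> \<epsilon>\<^sub>1 + \<epsilon>\<^sub>2"
proof -
  define k where "k e f = Re (cinner (\<gamma> (t e f)) (t e f))" for e f
  have k0: "k e f \<ge> 0" for e f
    using \<gamma> by (auto simp: k_def couplings_def psd_trace_class_def intro: psd_opD(2))
  \<comment> \<open>Finite enlargements that contain the coordinates of \<open>H\<close>, so that
    only finite partial sums of the marginals occur.\<close>
  define E1 where "E1 = E0 \<union> fst ` H"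
  define F1 where "F1 = F0 \<union> snd ` H"
  have E1: "finite E1" "E1 \<subseteq> some_onb" "E0 \<subseteq> E1" and F1: "finite F1" "F1 \<subseteq> some_onb" "F0 \<subseteq> F1"
    using E0 F0 H by (auto simp: E1_def F1_def)
  have "H \<subseteq> (E1 - E0) \<times> F1 \<union> E1 \<times> (F1 - F0)"
    using H(2) by (force simp: E1_def F1_def)
  then have "(\<Sum>(e, f)\<in>H. k e f) \<le> (\<Sum>(e, f)\<in>(E1 - E0) \<times> F1 \<union> E1 \<times> (F1 - F0). k e f)"
    using E1 F1 k0 by (intro sum_mono2) auto
  also have "\<dots> \<le> (\<Sum>(e, f)\<in>(E1 - E0) \<times> F1. k e f) + (\<Sum>(e, f)\<in>E1 \<times> (F1 - F0). k e f)"
    using E1 F1 k0 by (subst sum_Un) (auto intro!: sum_nonneg)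
  also have "(\<Sum>(e, f)\<in>(E1 - E0) \<times> F1. k e f) = (\<Sum>e\<in>E1 - E0. \<Sum>f\<in>F1. k e f)"
    by (rule sum.cartesian_product[symmetric])
  also have "\<dots> \<le> (\<Sum>e\<in>E1 - E0. Re (cinner (\<rho>\<^sub>1 e) e))"
    unfolding k_def by (intro sum_mono coupling_marginal_le(1)[OF T \<gamma>] F1)
  also have "\<dots> = (\<Sum>e\<in>E1. Re (cinner (\<rho>\<^sub>1 e) e)) - (\<Sum>e\<in>E0. Re (cinner (\<rho>\<^sub>1 e) e))"
    by (rule sum_diff[OF E1(1,3)])
  also have "(\<Sum>e\<in>E1. Re (cinner (\<rho>\<^sub>1 e) e)) \<le> trace_norm \<rho>\<^sub>1"
    by (rule finite_sum_le_has_sum[OF psd_trace_class_has_sum(1)[OF \<rho>1 is_onb_some_onb] E1(1,2)])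
      (use \<rho>1 in \<open>simp add: psd_trace_class_def psd_opD(2)\<close>)
  also have "trace_norm \<rho>\<^sub>1 - (\<Sum>e\<in>E0. Re (cinner (\<rho>\<^sub>1 e) e)) \<le> \<epsilon>\<^sub>1" using E0(3) by simp
  also have "(\<Sum>(e, f)\<in>E1 \<times> (F1 - F0). k e f) = (\<Sum>e\<in>E1. \<Sum>f\<in>F1 - F0. k e f)"
    by (rule sum.cartesian_product[symmetric])
  also have "\<dots> = (\<Sum>f\<in>F1 - F0. \<Sum>e\<in>E1. k e f)" by (rule sum.swap)
  also have "\<dots> \<le> (\<Sum>f\<in>F1 - F0. Re (cinner (\<rho>\<^sub>2 f) f))"
    unfolding k_def by (intro sum_mono coupling_marginal_le(2)[OF T \<gamma>] E1)
  also have "\<dots> = (\<Sum>f\<in>F1. Re (cinner (\<rho>\<^sub>2 f) f)) - (\<Sum>f\<in>F0. Re (cinner (\<rho>\<^sub>2 f) f))"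
    by (rule sum_diff[OF F1(1,3)])
  also have "(\<Sum>f\<in>F1. Re (cinner (\<rho>\<^sub>2 f) f)) \<le> trace_norm \<rho>\<^sub>2"
    by (rule finite_sum_le_has_sum[OF psd_trace_class_has_sum(1)[OF \<rho>2 is_onb_some_onb] F1(1,2)])
      (use \<rho>2 in \<open>simp add: psd_trace_class_def psd_opD(2)\<close>)
  also have "trace_norm \<rho>\<^sub>2 - (\<Sum>f\<in>F0. Re (cinner (\<rho>\<^sub>2 f) f)) \<le> \<epsilon>\<^sub>2" using F0(3) by simp
  finally show ?thesis by (simp add: k_def)
qed

lemma coupling_tail_le_image:
  fixes t :: "'a::chilbert_space \<Rightarrow> 'b::chilbert_space \<Rightarrow> 'c::chilbert_space"
  assumes T: "is_hilbert_tensor_product t" and \<gamma>: "\<gamma> \<in> couplings t \<rho>\<^sub>1 \<rho>\<^sub>2"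
    and \<rho>1: "\<rho>\<^sub>1 \<in> psd_trace_class" and \<rho>2: "\<rho>\<^sub>2 \<in> psd_trace_class"
    and E0: "finite E0" "E0 \<subseteq> some_onb" "trace_norm \<rho>\<^sub>1 - \<epsilon>\<^sub>1 \<le> (\<Sum>e\<in>E0. Re (cinner (\<rho>\<^sub>1 e) e))"
    and F0: "finite F0" "F0 \<subseteq> some_onb" "trace_norm \<rho>\<^sub>2 - \<epsilon>\<^sub>2 \<le> (\<Sum>f\<in>F0. Re (cinner (\<rho>\<^sub>2 f) f))"
    and H: "finite H" "H \<subseteq> (\<lambda>(e, f). t e f) ` (some_onb \<times> some_onb) - (\<lambda>(e, f). t e f) ` (E0 \<times> F0)"
  shows "(\<Sum>h\<in>H. Re (cinner (\<gamma> h) h)) \<le> \<epsilon>\<^sub>1 + \<epsilon>\<^sub>2"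
proof -
  let ?u = "\<lambda>(e, f). t e f"
  have "H \<subseteq> ?u ` (some_onb \<times> some_onb - E0 \<times> F0)" using H(2) by blast
  then obtain J where J: "J \<subseteq> some_onb \<times> some_onb - E0 \<times> F0" "finite J" "H = ?u ` J"
    using finite_subset_image[OF H(1)] by metis
  have "inj_on ?u J"
    by (rule inj_on_subset[OF orthonormal_tensor(2)[OF T is_onb_some_onb is_onb_some_onb]]) (use J(1) in blast)
  then have "(\<Sum>h\<in>H. Re (cinner (\<gamma> h) h)) = (\<Sum>(e, f)\<in>J. Re (cinner (\<gamma> (t e f)) (t e f)))"
    by (simp add: J(3) sum.reindex case_prod_unfold)
  also have "\<dots> \<le> \<epsilon>\<^sub>1 + \<epsilon>\<^sub>2"
    by (rule coupling_tail_le[OF T \<gamma> \<rho>1 \<rho>2 E0 F0 J(2,1)])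
  finally show ?thesis .
qed

text \<open>The empty rectangle leaves all mass outside, with the full traces as errors. This is
  cruder than the exact value, the trace of either marginal, but only a bound uniform over the
  couplings is needed.\<close>

lemma coupling_trace_norm_le:
  fixes t :: "'a::chilbert_space \<Rightarrow> 'b::chilbert_space \<Rightarrow> 'c::chilbert_space"
  assumes T: "is_hilbert_tensor_product t" and \<gamma>: "\<gamma> \<in> couplings t \<rho>\<^sub>1 \<rho>\<^sub>2"
    and \<rho>1: "\<rho>\<^sub>1 \<in> psd_trace_class" and \<rho>2: "\<rho>\<^sub>2 \<in> psd_trace_class"
  shows "trace_norm \<gamma> \<le> trace_norm \<rho>\<^sub>1 + trace_norm \<rho>\<^sub>2"
proof -
  have p: "\<gamma> \<in> psd_trace_class" using \<gamma> by (simp add: couplings_def)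
  show ?thesis
  proof (rule has_sum_le_finite_sums[OF psd_trace_class_has_sum(1)[OF p orthonormal_tensor(1)[OF T is_onb_some_onb is_onb_some_onb]]])
    fix H assume "finite H" "H \<subseteq> (\<lambda>(e, f). t e f) ` (some_onb \<times> some_onb)"
    then show "(\<Sum>h\<in>H. Re (cinner (\<gamma> h) h)) \<le> trace_norm \<rho>\<^sub>1 + trace_norm \<rho>\<^sub>2"
      using coupling_tail_le_image[OF T \<gamma> \<rho>1 \<rho>2, of "{}" "trace_norm \<rho>\<^sub>1" "{}" "trace_norm \<rho>\<^sub>2" H] by simp
  qed
qed

subsection \<open>Compactness\<close>

lemma Metric_space_trace_dist:
  assumes M: "M \<subseteq> trace_class"
  shows "Metric_space M trace_dist"
proof
  fix x y z :: "'a \<Rightarrow>\<^sub>L 'a"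
  show "0 \<le> trace_dist x y" by (simp add: trace_dist_def trace_norm_nonneg)
  \<comment> \<open>Symmetry is demanded of arbitrary operators, not only of members of
    \<open>M\<close>. A difference that is not trace class has \<open>trace_norm\<close> 0 by
    convention, and so has its negative.\<close>
  have le: "trace_norm (x - y) \<le> trace_norm (y - x)" for x y :: "'a \<Rightarrow>\<^sub>L 'a"
  proof (cases "x - y \<in> trace_class")
    case True
    then have "y - x \<in> trace_class" using trace_class_uminus(1) by fastforce
    then show ?thesis using trace_class_uminus(2)[of "y - x"] by simp
  next
    case False
    then show ?thesis using trace_norm_nonneg[of "y - x"] by (simp add: trace_norm_def)
  qed
  show "trace_dist x y = trace_dist y x"
    unfolding trace_dist_def by (intro antisym le)
  assume x: "x \<in> M" and y: "y \<in> M"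
  then have tc: "x \<in> trace_class" "y \<in> trace_class" using M by auto
  show "trace_dist x y = 0 \<longleftrightarrow> x = y"
    using trace_norm_eq_0[OF trace_class_diff(1)[OF tc]] trace_class_zero(2)
    by (auto simp: trace_dist_def)
  assume z: "z \<in> M"
  then have "z \<in> trace_class" using M by auto
  then show "trace_dist x z \<le> trace_dist x y + trace_dist y z"
    using trace_class_add(2)[OF trace_class_diff(1)[OF tc] trace_class_diff(1)[OF tc(2)], of z]
    by (simp add: trace_dist_def)
qed

lemma couplings_trace_class: "couplings t \<rho>\<^sub>1 \<rho>\<^sub>2 \<subseteq> trace_class"
  by (auto simp: couplings_def psd_trace_class_def)

lemma couplings_mcomplete:
  fixes t :: "'a::chilbert_space \<Rightarrow> 'b::chilbert_space \<Rightarrow> 'c::chilbert_space"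
  assumes T: "is_hilbert_tensor_product t"
  shows "Metric_space.mcomplete (couplings t \<rho>\<^sub>1 \<rho>\<^sub>2) trace_dist"
proof -
  let ?M = "couplings t \<rho>\<^sub>1 \<rho>\<^sub>2"
  interpret M: Metric_space ?M trace_dist
    by (rule Metric_space_trace_dist[OF couplings_trace_class])
  show ?thesis
    unfolding M.mcomplete_def
  proof (intro allI impI)
    fix \<sigma> assume \<sigma>: "M.MCauchy \<sigma>"
    then have mem: "\<sigma> n \<in> ?M" for n by (auto simp: M.MCauchy_def)
    then have tc: "\<sigma> n \<in> trace_class" and psd: "psd_op (\<sigma> n)"
      and p: "partial_trace2 t (\<sigma> n) = \<rho>\<^sub>1" "partial_trace1 t (\<sigma> n) = \<rho>\<^sub>2" for n
      by (auto simp: couplings_def psd_trace_class_def)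
    have cau: "\<exists>N. \<forall>m\<ge>N. \<forall>n\<ge>N. trace_norm (\<sigma> m - \<sigma> n) < r" if "r > 0" for r
      using \<sigma> that unfolding M.MCauchy_def trace_dist_def by meson
    obtain L where L: "L \<in> trace_class" "\<sigma> \<longlonglongrightarrow> L" "(\<lambda>n. trace_norm (\<sigma> n - L)) \<longlonglongrightarrow> 0"
      by (rule trace_norm_Cauchy_convergent[OF tc cau])
    have lim: "(\<lambda>n. cinner (\<sigma> n x) x) \<longlonglongrightarrow> cinner (L x) x" for x
      by (intro tendsto_cinner tendsto_intros L)
    have "psd_op L"
    proof (rule psd_opI[OF trace_class_clinear[OF L(1)]])
      show "0 \<le> Re (cinner (L x) x)" for x
        by (rule LIMSEQ_le_const[OF tendsto_Re[OF lim]]) (use psd_opD(2)[OF psd] in blast)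
      show "Im (cinner (L x) x) = 0" for x
        using tendsto_Im[OF lim[of x]] psd_opD(3)[OF psd] by (simp add: LIMSEQ_const_iff)
    qed
    moreover have "partial_trace1 t L = \<rho>\<^sub>2"
    proof -
      \<comment> \<open>All members have the same marginal, so its distance to the marginal of the
        limit lies below a null sequence.\<close>
      have "norm (\<rho>\<^sub>2 - partial_trace1 t L) \<le> 0"
        by (rule LIMSEQ_le_const[OF L(3)]) (use partial_trace1_diff[OF T tc L(1)] p in auto)
      then show ?thesis by simp
    qed
    moreover have "partial_trace2 t L = \<rho>\<^sub>1"
    proof -
      have "norm (\<rho>\<^sub>1 - partial_trace2 t L) \<le> 0"
        by (rule LIMSEQ_le_const[OF L(3)]) (use partial_trace2_diff[OF T tc L(1)] p in auto)
      then show ?thesis by simp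
    qed
    ultimately have "L \<in> ?M" using L(1) by (simp add: couplings_def psd_trace_class_def)
    moreover have "\<exists>N. \<forall>n\<ge>N. \<sigma> n \<in> ?M \<and> trace_dist (\<sigma> n) L < r" if "r > 0" for r
      using LIMSEQ_D[OF L(3) that] mem by (simp add: trace_dist_def trace_norm_nonneg)
    ultimately show "\<exists>x. limitin M.mtopology \<sigma> x sequentially"
      unfolding M.limit_metric_sequentially by blast
  qed
qed

text \<open>One representative is kept for each code, so the centres lie in \<open>M\<close> itself,
  as total boundedness of \<open>M\<close> as a metric space requires.\<close>

lemma finite_codes_imp_finite_cover:
  assumes "finite (c ` M)" "\<And>x y. x \<in> M \<Longrightarrow> y \<in> M \<Longrightarrow> c x = c y \<Longrightarrow> d x y < r"
  obtains K where "finite K" "K \<subseteq> M" "\<And>y. y \<in> M \<Longrightarrow> \<exists>x\<in>K. d x y < r"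
proof
  let ?K = "inv_into M c ` (c ` M)"
  show "finite ?K" using assms(1) by blast
  show "?K \<subseteq> M" by (auto intro: inv_into_into)
  show "\<exists>x\<in>?K. d x y < r" if "y \<in> M" for y
    using that assms(2)[of "inv_into M c (c y)" y] by (auto intro: inv_into_into f_inv_into_f)
qed

text \<open>Rounding the finitely many matrix entries of a compression to multiples of \<open>\<delta>\<close> leaves finitely
  many possibilities.\<close>

lemma couplings_totally_bounded:
  fixes t :: "'a::chilbert_space \<Rightarrow> 'b::chilbert_space \<Rightarrow> 'c::chilbert_space"
  assumes T: "is_hilbert_tensor_product t"
    and \<rho>1: "\<rho>\<^sub>1 \<in> psd_trace_class" and \<rho>2: "\<rho>\<^sub>2 \<in> psd_trace_class" and r: "r > 0"
  obtains K where "finite K" "K \<subseteq> couplings t \<rho>\<^sub>1 \<rho>\<^sub>2"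
    "\<And>\<gamma>. \<gamma> \<in> couplings t \<rho>\<^sub>1 \<rho>\<^sub>2 \<Longrightarrow> \<exists>\<gamma>'\<in>K. trace_dist \<gamma>' \<gamma> < r"
proof -
  let ?M = "couplings t \<rho>\<^sub>1 \<rho>\<^sub>2" and ?u = "\<lambda>(e, f). t e f"
  \<comment> \<open>A uniform bound for the trace norms and the matrix entries of all couplings. The
    added 1 permits division by it even if both marginals vanish.\<close>
  define \<tau> where "\<tau> = trace_norm \<rho>\<^sub>1 + trace_norm \<rho>\<^sub>2 + 1"
  have \<tau>: "\<tau> > 0" using trace_norm_nonneg[of \<rho>\<^sub>1] trace_norm_nonneg[of \<rho>\<^sub>2] by (simp add: \<tau>_def)
  \<comment> \<open>Chosen so that the compression error 2 sqrt \<epsilon> sqrt \<tau> equals r /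
    4.\<close>
  define \<epsilon> where "\<epsilon> = (r / 8)\<^sup>2 / \<tau>"
  have \<epsilon>: "\<epsilon> > 0" "sqrt \<epsilon> * sqrt \<tau> = r / 8"
    using r \<tau> by (auto simp: \<epsilon>_def simp flip: real_sqrt_mult)
  have \<epsilon>2: "\<epsilon> / 2 > 0" using \<epsilon> by simp
  obtain E0 where E0: "finite E0" "E0 \<subseteq> some_onb" "trace_norm \<rho>\<^sub>1 - \<epsilon> / 2 \<le> (\<Sum>e\<in>E0. Re (cinner (\<rho>\<^sub>1 e) e))"
    using has_sum_finite_approximation[OF psd_trace_class_has_sum(1)[OF \<rho>1 is_onb_some_onb] \<epsilon>2]
    unfolding dist_real_def by (metis abs_le_D2 diff_le_eq minus_diff_eq add.commute)
  obtain F0 where F0: "finite F0" "F0 \<subseteq> some_onb" "trace_norm \<rho>\<^sub>2 - \<epsilon> / 2 \<le> (\<Sum>f\<in>F0. Re (cinner (\<rho>\<^sub>2 f) f))"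
    using has_sum_finite_approximation[OF psd_trace_class_has_sum(1)[OF \<rho>2 is_onb_some_onb] \<epsilon>2]
    unfolding dist_real_def by (metis abs_le_D2 diff_le_eq minus_diff_eq add.commute)
  define G where "G = ?u ` (some_onb \<times> some_onb)"
  define H where "H = ?u ` (E0 \<times> F0)"
  have G: "is_onb G" unfolding G_def by (rule orthonormal_tensor(1)[OF T is_onb_some_onb is_onb_some_onb])
  have H: "finite H" "H \<subseteq> G" using E0 F0 by (auto simp: H_def G_def)
  have on: "orthonormal H" using G H by (auto simp: is_onb_iff intro: orthonormal_subset)
  define n where "n = real (card H) * real (card H) + 1"
  have n: "n > 0" by (simp add: n_def add_nonneg_pos)
  \<comment> \<open>Entries with equal codes differ by at most 2 \<delta> in modulus. There are
    fewer than \<open>n\<close> entries, so compressions with equal codes differ by at most 2 n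
    \<delta> = r / 4. With two compression errors the total is 3 r / 4.\<close>
  define \<delta> where "\<delta> = r / (8 * n)"
  have \<delta>: "\<delta> > 0" using r n by (simp add: \<delta>_def)
  have err: "nuc_le (\<gamma> - compression H \<gamma>) (r / 4)" if \<gamma>: "\<gamma> \<in> ?M" for \<gamma>
  proof -
    have "nuc_le (\<gamma> - compression H \<gamma>) (2 * (sqrt \<epsilon> * sqrt (trace_norm \<gamma>)))"
    proof (rule nuc_le_compression_error[OF _ G H])
      show "\<gamma> \<in> psd_trace_class" using \<gamma> by (simp add: couplings_def)
      show "(\<Sum>h\<in>F. Re (cinner (\<gamma> h) h)) \<le> \<epsilon>" if "finite F" "F \<subseteq> G - H" for F
        using coupling_tail_le_image[OF T \<gamma> \<rho>1 \<rho>2 E0 F0 that[unfolded G_def H_def]] by simp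
    qed
    moreover have "sqrt \<epsilon> * sqrt (trace_norm \<gamma>) \<le> sqrt \<epsilon> * sqrt \<tau>"
      using coupling_trace_norm_le[OF T \<gamma> \<rho>1 \<rho>2] \<epsilon>(1) by (intro mult_left_mono) (auto simp: \<tau>_def)
    then have "2 * (sqrt \<epsilon> * sqrt (trace_norm \<gamma>)) \<le> r / 4" by (simp add: \<epsilon>(2))
    ultimately show ?thesis by (rule nuc_le_mono)
  qed
  \<comment> \<open>The restriction to \<open>H \<times> H\<close> places the codes in an
    extensional function space, which is finite since its domain and range are.\<close>
  define c where "c \<gamma> = (\<lambda>(g, h) \<in> H \<times> H. (\<lfloor>Re (cinner (\<gamma> h) g) / \<delta>\<rfloor>, \<lfloor>Im (cinner (\<gamma> h) g) / \<delta>\<rfloor>))"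
    for \<gamma> :: "'c \<Rightarrow>\<^sub>L 'c"
  define B where "B = {\<lfloor>- \<tau> / \<delta>\<rfloor>..\<lfloor>\<tau> / \<delta>\<rfloor>}"
  have "c ` ?M \<subseteq> (H \<times> H) \<rightarrow>\<^sub>E B \<times> B"
  proof (rule image_subsetI)
    fix \<gamma> assume \<gamma>: "\<gamma> \<in> ?M"
    have bd: "cmod (cinner (\<gamma> h) g) \<le> \<tau>" if "g \<in> H" "h \<in> H" for g h
    proof -
      have 1: "norm g = 1" "norm h = 1" using that on by (auto simp: orthonormal_def)
      have "cmod (cinner (\<gamma> h) g) \<le> norm (\<gamma> h) * norm g" by (rule cmod_cinner_le)
      also have "\<dots> \<le> norm \<gamma>" using norm_blinfun[of \<gamma> h] by (simp add: 1)
      also have "\<dots> \<le> trace_norm \<gamma>" using \<gamma> couplings_trace_class by (blast intro: norm_le_trace_norm)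
      also have "\<dots> \<le> \<tau>" using coupling_trace_norm_le[OF T \<gamma> \<rho>1 \<rho>2] by (simp add: \<tau>_def)
      finally show ?thesis .
    qed
    have fl: "\<lfloor>x / \<delta>\<rfloor> \<in> B" if "\<bar>x\<bar> \<le> \<tau>" for x
    proof -
      have "- \<tau> / \<delta> \<le> x / \<delta>" "x / \<delta> \<le> \<tau> / \<delta>"
        using that \<delta> by (intro divide_right_mono; simp)+
      then show ?thesis unfolding B_def by (simp add: floor_mono)
    qed
    show "c \<gamma> \<in> (H \<times> H) \<rightarrow>\<^sub>E B \<times> B"
      unfolding c_def by (auto intro!: fl order_trans[OF abs_Re_le_cmod] order_trans[OF abs_Im_le_cmod] bd)
  qed
  moreover have "finite ((H \<times> H) \<rightarrow>\<^sub>E B \<times> B)"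
    by (rule finite_PiE) (use H in \<open>auto simp: B_def\<close>)
  ultimately have fin: "finite (c ` ?M)" by (rule finite_subset)
  have close: "trace_dist \<gamma> \<gamma>' < r" if \<gamma>: "\<gamma> \<in> ?M" and \<gamma>': "\<gamma>' \<in> ?M" and eq: "c \<gamma> = c \<gamma>'" for \<gamma> \<gamma>'
  proof -
    have tc: "\<gamma> \<in> trace_class" "\<gamma>' \<in> trace_class" using \<gamma> \<gamma>' couplings_trace_class by auto
    have fl: "\<bar>x - y\<bar> \<le> \<delta>" if "\<lfloor>x / \<delta>\<rfloor> = \<lfloor>y / \<delta>\<rfloor>" for x y
    proof -
      have "\<bar>x / \<delta> - y / \<delta>\<bar> \<le> 1" using that by linarith
      then show ?thesis using \<delta> by (simp add: diff_divide_distrib[symmetric] abs_divide field_simps)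
    qed
    have ent: "cmod (cinner (\<gamma> h) g - cinner (\<gamma>' h) g) \<le> 2 * \<delta>" if "g \<in> H" "h \<in> H" for g h
    proof -
      have "c \<gamma> (g, h) = c \<gamma>' (g, h)" by (simp add: eq)
      then have "\<bar>Re (cinner (\<gamma> h) g) - Re (cinner (\<gamma>' h) g)\<bar> \<le> \<delta>" "\<bar>Im (cinner (\<gamma> h) g) - Im (cinner (\<gamma>' h) g)\<bar> \<le> \<delta>"
        using that by (auto simp: c_def intro!: fl)
      then show ?thesis
        using cmod_le[of "cinner (\<gamma> h) g - cinner (\<gamma>' h) g"] by simp
    qed
    have "nuc_le (compression H \<gamma> - compression H \<gamma>') (real (card H) * (real (card H) * (2 * \<delta>)))"
      by (rule nuc_le_compression_diff[OF trace_class_clinear[OF tc(1)] trace_class_clinear[OF tc(2)] on ent])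
    moreover have "real (card H) * (real (card H) * (2 * \<delta>)) \<le> r / 4"
    proof -
      have "real (card H) * (real (card H) * (2 * \<delta>)) \<le> n * (2 * \<delta>)"
        using \<delta> by (simp add: n_def algebra_simps)
      also have "\<dots> = r / 4" using n by (simp add: \<delta>_def)
      finally show ?thesis .
    qed
    ultimately have 1: "nuc_le (compression H \<gamma> - compression H \<gamma>') (r / 4)" by (rule nuc_le_mono)
    have 2: "nuc_le (compression H \<gamma>' - \<gamma>') (r / 4)"
      using nuc_le_scaleC[OF err[OF \<gamma>'], of "-1"] scaleR_scaleC[of "-1" "\<gamma>' - compression H \<gamma>'"] by simp
    have "nuc_le (\<gamma> - \<gamma>') (r / 4 + (r / 4 + r / 4))"
      using nuc_le_add[OF err[OF \<gamma>] nuc_le_add[OF 1 2]] by simp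
    then have "trace_norm (\<gamma> - \<gamma>') \<le> r / 4 + (r / 4 + r / 4)"
      by (intro nuc_le_trace_class(2)[OF trace_class_clinear[OF trace_class_diff(1)[OF tc]]])
    then show ?thesis using r by (simp add: trace_dist_def)
  qed
  show thesis
  proof (rule finite_codes_imp_finite_cover[OF fin close])
    fix K assume "finite K" "K \<subseteq> ?M" "\<And>y. y \<in> ?M \<Longrightarrow> \<exists>x\<in>K. trace_dist x y < r"
    then show thesis by (rule that)
  qed
qed

theorem proposition5p1:
  fixes t :: "'a::chilbert_space \<Rightarrow> 'b::chilbert_space \<Rightarrow> 'c::chilbert_space"
    and \<rho>\<^sub>1 :: "'a \<Rightarrow>\<^sub>L 'a" and \<rho>\<^sub>2 :: "'b \<Rightarrow>\<^sub>L 'b"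
  assumes "separable_space (euclidean :: 'a topology)"
    and "separable_space (euclidean :: 'b topology)"
    and "is_hilbert_tensor_product t"
    and "\<rho>\<^sub>1 \<in> psd_trace_class"
    and "\<rho>\<^sub>2 \<in> psd_trace_class"
    and "trace_op \<rho>\<^sub>1 = trace_op \<rho>\<^sub>2"
  shows "couplings t \<rho>\<^sub>1 \<rho>\<^sub>2 \<noteq> {} \<and>
    convex (couplings t \<rho>\<^sub>1 \<rho>\<^sub>2) \<and>
    Metric_space (couplings t \<rho>\<^sub>1 \<rho>\<^sub>2) trace_dist \<and>
    compact_space (Metric_space.mtopology (couplings t \<rho>\<^sub>1 \<rho>\<^sub>2) trace_dist) \<and>
    (\<forall>\<gamma>. (\<forall>m. \<gamma> m \<in> couplings t \<rho>\<^sub>1 \<rho>\<^sub>2) \<longrightarrow>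
      (\<exists>\<gamma>' r. \<gamma>' \<in> couplings t \<rho>\<^sub>1 \<rho>\<^sub>2 \<and> strict_mono (r :: nat \<Rightarrow> nat) \<and>
        (\<lambda>k. trace_norm (\<gamma> (r k) - \<gamma>')) \<longlonglongrightarrow> 0))"
proof -
  let ?M = "couplings t \<rho>\<^sub>1 \<rho>\<^sub>2"
  note T = assms(3)
  interpret M: Metric_space ?M trace_dist
    by (rule Metric_space_trace_dist[OF couplings_trace_class])
  have "complex_of_real (trace_norm \<rho>\<^sub>1) = of_real (trace_norm \<rho>\<^sub>2)"
    using assms(6) by (simp only: psd_trace_class_has_sum(2)[OF assms(4) is_onb_some_onb]
        psd_trace_class_has_sum(2)[OF assms(5) is_onb_some_onb])
  then have ne: "?M \<noteq> {}"
    by (intro couplings_nonempty[OF T assms(4,5)]) (simp only: of_real_eq_iff)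
  have "M.mtotally_bounded ?M"
    unfolding M.mtotally_bounded_def
  proof (intro allI impI)
    fix r :: real assume "r > 0"
    then obtain K where K: "finite K" "K \<subseteq> ?M" "\<And>\<gamma>. \<gamma> \<in> ?M \<Longrightarrow> \<exists>\<gamma>'\<in>K. trace_dist \<gamma>' \<gamma> < r"
      using couplings_totally_bounded[OF T assms(4,5)] by metis
    then have "?M \<subseteq> (\<Union>x\<in>K. M.mball x r)" by (force simp: M.in_mball)
    with K show "\<exists>K. finite K \<and> K \<subseteq> ?M \<and> ?M \<subseteq> (\<Union>x\<in>K. M.mball x r)" by blast
  qed
  then have compact: "compact_space M.mtopology"
    using couplings_mcomplete[OF T] M.compact_space_eq_mcomplete_mtotally_bounded by blast
  have "\<exists>\<gamma>' r. \<gamma>' \<in> ?M \<and> strict_mono (r :: nat \<Rightarrow> nat) \<and> (\<lambda>k. trace_norm (\<gamma> (r k) - \<gamma>')) \<longlonglongrightarrow> 0"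
    if \<gamma>: "\<forall>m. \<gamma> m \<in> ?M" for \<gamma>
  proof -
    obtain l r where lr: "l \<in> ?M" "strict_mono (r :: nat \<Rightarrow> nat)" "limitin M.mtopology (\<gamma> \<circ> r) l sequentially"
      using compact \<gamma> unfolding M.compact_space_sequentially by blast
    have "(\<lambda>k. trace_norm (\<gamma> (r k) - l)) \<longlonglongrightarrow> 0"
      using lr(3) unfolding M.limit_metric_sequentially
      by (intro LIMSEQ_I) (simp add: trace_dist_def trace_norm_nonneg, blast)
    then show ?thesis using lr by blast
  qed
  then show ?thesis
    using ne convex_couplings[OF T] M.Metric_space_axioms compact by blast
qed

end
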